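(* Let $(W,S)$ be a finite Coxeter system, let $\delta$ be an automorphism of $W$ with $\delta(S)=S$, and let $H_0$ be the $0$-Hecke algebra of $W$ over $\mathbb{C}$. Then the elements $\{t_{\le \Sigma}\}_{\Sigma \in W_{\delta,\max}/\approx_\delta}$ form a $\mathbb{C}$-basis of the $\delta$-center $Z(H_0)_\delta$.
   Context: $(W,S)$ is a finite Coxeter system with length function $\ell$ and Bruhat order $\le$. $H_0$ is the $\mathbb{C}$-algebra with $\mathbb{C}$-basis $\{t_w : w\in W\}$ and multiplication determined by $t_w t_{w'}=t_{ww'}$ if $\ell(ww')=\ell(w)+\ell(w')$, and $(t_s+1)t_s=0$ for $s\in S$. The automorphism $\delta$ acts on $H_0$ as the algebra automorphism with $\delta(t_w)=t_{\delta(w)}$. The $\delta$-center is $Z(H_0)_\delta=\{h\in H_0 : h'h=h\,\delta(h') \text{ for all } h'\in H_0\}$. Elements $w,w'\in W$ are $\delta$-conjugate if $w'=xw\delta(x)^{-1}$ for some $x\in W$; $cl(W)_\delta$ is the set of $\delta$-conjugacy classes. For $\mathcal{O}\in cl(W)_\delta$, $\mathcal{O}_{\max}$ is the set of elements of maximal length in $\mathcal{O}$, and $W_{\delta,\max}=\bigsqcup_{\mathcal{O}\in cl(W)_\delta}\mathcal{O}_{\max}$. For $s\in S$ write $w\xrightarrow{s}_\delta w'$ if $w'=sw\delta(s)$ and $\ell(w')\le\ell(w)$. Write $w\to_\delta w'$ if there is a finite sequence $w=w_0,w_1,\dots,w_n=w'$ such that for each $k$, $w_{k-1}\xrightarrow{s}_\delta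 w_k$ for some $s\in S$. Write $w\approx_\delta w'$ if $w\to_\delta w'$ and $w'\to_\delta w$; this is an equivalence relation. The set $W_{\delta,\max}$ is a union of $\approx_\delta$-equivalence classes, and $W_{\delta,\max}/\approx_\delta$ is the set of these classes. For $\Sigma\in W_{\delta,\max}/\approx_\delta$, set $W_{\le\Sigma}=\{x\in W : x\le w \text{ for some } w\in\Sigma\}$ and $t_{\le\Sigma}=\sum_{x\in W_{\le\Sigma}}t_x\in H_0$. *)

theory Defs
  imports
    "HOL-Algebra.Algebra"
    "Jordan_Normal_Form.VS_Connect"
begin

section \<open>Coxeter systems\<close>

definition word_prod :: "('a, 'm) monoid_scheme \<Rightarrow> 'a list \<Rightarrow> 'a" where
  "word_prod W ws = foldr (\<lambda>x y. x \<otimes>\<^bsub>W\<^esub> y) ws \<one>\<^bsub>W\<^esub>"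

text \<open>
  One application of a defining relation \<open>(s s')\<^sup>m = 1\<close>, where \<open>m\<close> is the order of \<open>s s'\<close> in \<open>W\<close>.
  The case \<open>s = s'\<close> is the relation \<open>s s = 1\<close>. \<open>group.ord\<close> is \<open>0\<close> for elements of infinite
  order, so such pairs contribute no relation.
\<close>

inductive relation_step :: "('a, 'm) monoid_scheme \<Rightarrow> 'a set \<Rightarrow> 'a list \<Rightarrow> 'a list \<Rightarrow> bool"
  for W :: "('a, 'm) monoid_scheme" and S :: "'a set" where
  "s \<in> S \<Longrightarrow> s' \<in> S \<Longrightarrow>
     relation_step W S (us @ concat (replicate (group.ord W (s \<otimes>\<^bsub>W\<^esub> s')) [s, s']) @ vs) (us @ vs)"

text \<open>
  \<open>W\<close> is presented by the generators \<open>S\<close> with the relations above. As the relations make each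
  generator its own inverse, words in \<open>S\<close> suffice: no formal inverses are needed. The last
  condition says that any relation between generators that holds in \<open>W\<close> is a consequence of the
  defining ones.
\<close>

definition coxeter_system :: "('a, 'm) monoid_scheme \<Rightarrow> 'a set \<Rightarrow> bool" where
  "coxeter_system W S \<longleftrightarrow>
     group W \<and> S \<subseteq> carrier W \<and> generate W S = carrier W \<and>
     (\<forall>s\<in>S. group.ord W s = 2) \<and>
     (\<forall>us\<in>lists S. \<forall>vs\<in>lists S.
        word_prod W us = word_prod W vs \<longrightarrow> equivclp (relation_step W S) us vs)"

definition cox_length :: "('a, 'm) monoid_scheme \<Rightarrow> 'a set \<Rightarrow> 'a \<Rightarrow> nat" where
  "cox_length W S w = (LEAST n. \<exists>ws\<in>lists S. length ws = n \<and> word_prod W ws = w)"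

definition reflections :: "('a, 'm) monoid_scheme \<Rightarrow> 'a set \<Rightarrow> 'a set" where
  "reflections W S = {x \<otimes>\<^bsub>W\<^esub> s \<otimes>\<^bsub>W\<^esub> inv\<^bsub>W\<^esub> x | x s. x \<in> carrier W \<and> s \<in> S}"

definition bruhat_step :: "('a, 'm) monoid_scheme \<Rightarrow> 'a set \<Rightarrow> 'a \<Rightarrow> 'a \<Rightarrow> bool" where
  "bruhat_step W S x y \<longleftrightarrow>
     x \<in> carrier W \<and> (\<exists>r\<in>reflections W S. y = x \<otimes>\<^bsub>W\<^esub> r) \<and> cox_length W S x < cox_length W S y"

definition bruhat_le :: "('a, 'm) monoid_scheme \<Rightarrow> 'a set \<Rightarrow> 'a \<Rightarrow> 'a \<Rightarrow> bool" where
  "bruhat_le W S = (bruhat_step W S)\<^sup>*\<^sup>*"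


section \<open>Twisted conjugacy\<close>

definition twisted_conj_rel :: "('a, 'm) monoid_scheme \<Rightarrow> ('a \<Rightarrow> 'a) \<Rightarrow> 'a rel" where
  "twisted_conj_rel W \<delta> =
     {(w, w'). w \<in> carrier W \<and> (\<exists>x\<in>carrier W. w' = x \<otimes>\<^bsub>W\<^esub> w \<otimes>\<^bsub>W\<^esub> inv\<^bsub>W\<^esub> (\<delta> x))}"

definition twisted_classes :: "('a, 'm) monoid_scheme \<Rightarrow> ('a \<Rightarrow> 'a) \<Rightarrow> 'a set set" where
  "twisted_classes W \<delta> = carrier W // twisted_conj_rel W \<delta>"

definition max_length_elems :: "('a, 'm) monoid_scheme \<Rightarrow> 'a set \<Rightarrow> 'a set \<Rightarrow> 'a set" where
  "max_length_elems W S C = {w \<in> C. \<forall>v\<in>C. cox_length W S v \<le> cox_length W S w}"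

definition twisted_max :: "('a, 'm) monoid_scheme \<Rightarrow> 'a set \<Rightarrow> ('a \<Rightarrow> 'a) \<Rightarrow> 'a set" where
  "twisted_max W S \<delta> = (\<Union>C\<in>twisted_classes W \<delta>. max_length_elems W S C)"

definition twisted_step ::
  "('a, 'm) monoid_scheme \<Rightarrow> 'a set \<Rightarrow> ('a \<Rightarrow> 'a) \<Rightarrow> 'a \<Rightarrow> 'a \<Rightarrow> bool" where
  "twisted_step W S \<delta> w w' \<longleftrightarrow>
     (\<exists>s\<in>S. w' = s \<otimes>\<^bsub>W\<^esub> w \<otimes>\<^bsub>W\<^esub> \<delta> s \<and> cox_length W S w' \<le> cox_length W S w)"

definition twisted_arrow ::
  "('a, 'm) monoid_scheme \<Rightarrow> 'a set \<Rightarrow> ('a \<Rightarrow> 'a) \<Rightarrow> 'a \<Rightarrow> 'a \<Rightarrow> bool" where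
  "twisted_arrow W S \<delta> = (twisted_step W S \<delta>)\<^sup>*\<^sup>*"

definition twisted_approx_rel ::
  "('a, 'm) monoid_scheme \<Rightarrow> 'a set \<Rightarrow> ('a \<Rightarrow> 'a) \<Rightarrow> 'a rel" where
  "twisted_approx_rel W S \<delta> =
     {(w, w'). w \<in> carrier W \<and> w' \<in> carrier W \<and>
               twisted_arrow W S \<delta> w w' \<and> twisted_arrow W S \<delta> w' w}"

definition twisted_max_classes ::
  "('a, 'm) monoid_scheme \<Rightarrow> 'a set \<Rightarrow> ('a \<Rightarrow> 'a) \<Rightarrow> 'a set set" where
  "twisted_max_classes W S \<delta> = twisted_max W S \<delta> // twisted_approx_rel W S \<delta>"


section \<open>The 0-Hecke algebra\<close>

abbreviation complex_field :: "complex ring" where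
  "complex_field \<equiv> class_ring"

text \<open>
  The family \<open>(b i)\<close>, \<open>i \<in> I\<close>, is a basis of the subspace \<open>U\<close> of the complex vector space \<open>V\<close>.
  Injectivity is required because the members of a basis family are pairwise distinct,
  which \<open>lin_dep\<close>, a predicate on sets of vectors, cannot express.
\<close>

definition basis_family ::
  "(complex, 'h, 'n) module_scheme \<Rightarrow> 'h set \<Rightarrow> 'i set \<Rightarrow> ('i \<Rightarrow> 'h) \<Rightarrow> bool" where
  "basis_family V U I b \<longleftrightarrow>
     b \<in> I \<rightarrow> U \<and> inj_on b I \<and>
     \<not> module.lin_dep complex_field V (b ` I) \<and>
     LinearCombinations.module.span complex_field V (b ` I) = U"

text \<open>The library's locale \<open>algebra\<close> is restricted to commutative algebras.\<close>

definition complex_algebra :: "(complex, 'h, 'n) module_scheme \<Rightarrow> bool" where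
  "complex_algebra H \<longleftrightarrow>
     ring H \<and> vectorspace complex_field H \<and>
     (\<forall>c. \<forall>x\<in>carrier H. \<forall>y\<in>carrier H.
        (c \<odot>\<^bsub>H\<^esub> x) \<otimes>\<^bsub>H\<^esub> y = c \<odot>\<^bsub>H\<^esub> (x \<otimes>\<^bsub>H\<^esub> y) \<and>
        x \<otimes>\<^bsub>H\<^esub> (c \<odot>\<^bsub>H\<^esub> y) = c \<odot>\<^bsub>H\<^esub> (x \<otimes>\<^bsub>H\<^esub> y))"

text \<open>
  \<open>H\<close> is the 0-Hecke algebra of \<open>(W, S)\<close> with standard basis \<open>(t w)\<close>. The conditions determine
  \<open>H\<close> and \<open>t\<close> up to a unique isomorphism; they force \<open>t 1\<close> to be the unit of \<open>H\<close>.
\<close>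

definition zero_hecke_algebra ::
  "('a, 'm) monoid_scheme \<Rightarrow> 'a set \<Rightarrow> (complex, 'h, 'n) module_scheme \<Rightarrow> ('a \<Rightarrow> 'h) \<Rightarrow> bool" where
  "zero_hecke_algebra W S H t \<longleftrightarrow>
     complex_algebra H \<and>
     basis_family H (carrier H) (carrier W) t \<and>
     (\<forall>w\<in>carrier W. \<forall>w'\<in>carrier W.
        cox_length W S (w \<otimes>\<^bsub>W\<^esub> w') = cox_length W S w + cox_length W S w' \<longrightarrow>
        t w \<otimes>\<^bsub>H\<^esub> t w' = t (w \<otimes>\<^bsub>W\<^esub> w')) \<and>
     (\<forall>s\<in>S. (t s \<oplus>\<^bsub>H\<^esub> \<one>\<^bsub>H\<^esub>) \<otimes>\<^bsub>H\<^esub> t s = \<zero>\<^bsub>H\<^esub>)"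

definition induced_automorphism ::
  "('a, 'm) monoid_scheme \<Rightarrow> ('a \<Rightarrow> 'a) \<Rightarrow> (complex, 'h, 'n) module_scheme \<Rightarrow> ('a \<Rightarrow> 'h) \<Rightarrow>
   ('h \<Rightarrow> 'h) \<Rightarrow> bool" where
  "induced_automorphism W \<delta> H t \<delta>\<^sub>H \<longleftrightarrow>
     \<delta>\<^sub>H \<in> ring_iso H H \<and>
     (\<forall>c. \<forall>h\<in>carrier H. \<delta>\<^sub>H (c \<odot>\<^bsub>H\<^esub> h) = c \<odot>\<^bsub>H\<^esub> \<delta>\<^sub>H h) \<and>
     (\<forall>w\<in>carrier W. \<delta>\<^sub>H (t w) = t (\<delta> w))"

definition twisted_center ::
  "(complex, 'h, 'n) module_scheme \<Rightarrow> ('h \<Rightarrow> 'h) \<Rightarrow> 'h set" where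
  "twisted_center H \<delta>\<^sub>H =
     {h \<in> carrier H. \<forall>h'\<in>carrier H. h' \<otimes>\<^bsub>H\<^esub> h = h \<otimes>\<^bsub>H\<^esub> \<delta>\<^sub>H h'}"

definition lower_set :: "('a, 'm) monoid_scheme \<Rightarrow> 'a set \<Rightarrow> 'a set \<Rightarrow> 'a set" where
  "lower_set W S \<Sigma> = {x \<in> carrier W. \<exists>w\<in>\<Sigma>. bruhat_le W S x w}"

definition t_lower ::
  "('a, 'm) monoid_scheme \<Rightarrow> 'a set \<Rightarrow> (complex, 'h, 'n) module_scheme \<Rightarrow> ('a \<Rightarrow> 'h) \<Rightarrow>
   'a set \<Rightarrow> 'h" where
  "t_lower W S H t \<Sigma> = (\<Oplus>\<^bsub>H\<^esub>x\<in>lower_set W S \<Sigma>. t x)"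

end

theory Submission
  imports Defs "HOL-Analysis.Function_Topology" "HOL-Library.Function_Algebras"
begin

text \<open>
  Expand an element of the algebra as \<open>h = \<Sum> a(w) t\<^sub>w\<close>. It lies in the twisted centre iff \<open>t\<^sub>s h = h t\<^bsub>\<delta>(s)\<^esub>\<close>
  for every \<open>s \<in> S\<close>, and comparing coefficients turns this into linear equations for the function \<open>a\<close> on
  the group (\<open>central\<close>, \<open>twisted_center_iff\<close>). Two consequences of these equations matter. The function \<open>a\<close>
  is unchanged by a step \<open>w \<mapsto> s w \<delta>(s)\<close> that preserves the length, and when such a step increases the
  length, \<open>a(w)\<close> equals the value of \<open>a\<close> at some element that is longer than \<open>w\<close>.

  The indicator functions of the sets \<open>W\<^bsub>\<le>\<Sigma>\<^esub>\<close> solve the equations by the lifting property of the Bruhat order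
  (\<open>central_below\<close>), and they are independent because \<open>\<Sigma>\<close> is the set of longest elements of \<open>W\<^bsub>\<le>\<Sigma>\<^esub>\<close>
  (\<open>below_independent\<close>). For spanning, let \<open>w\<close> be a longest element in the support of a solution \<open>a\<close>. By the two
  consequences above, length-nondecreasing steps starting at \<open>w\<close> stay in the support and never gain length.
  If one knows that such steps lead from any element to one of maximal length in its class
  (\<open>ascend_to_maximal\<close>), then \<open>w\<close> itself has maximal length in its class, and \<open>a(w) t\<^bsub>\<le>\<Sigma>\<^esub>\<close>, with \<open>\<Sigma>\<close> the class of
  \<open>w\<close>, can be subtracted to shrink the support from the top (\<open>below_span\<close>).

  The deep ingredient is \<open>ascend_to_maximal\<close>, the analogue for maximal lengths of a theorem of Geck, Kim and
  Pfeiffer. The proof is geometric, after an idea of He and Nie. Let \<open>W\<close> act on its geometric representation,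
  equipped with an invariant inner product, and put \<open>g = w\<delta>\<close>. The length of \<open>x\<^sup>-\<^sup>1 w \<delta>(x)\<close> is the number of root
  hyperplanes that separate the chamber \<open>xC\<close> from \<open>g xC\<close>, and an elementary step crosses one wall of the
  chamber. If \<open>v\<close> lies on the wall orthogonal to \<open>\<beta>\<close> and \<open>\<langle>gv + g\<^sup>-\<^sup>1v, \<beta>\<rangle> > 0\<close>, then crossing that wall does not
  decrease the number. So the chamber may follow a point \<open>v\<close> that moves in the direction \<open>\<lambda>v - (gv + g\<^sup>-\<^sup>1v)\<close>,
  where \<open>\<lambda>\<close> is the least eigenvalue of \<open>g + g\<^sup>-\<^sup>1\<close>. Since this direction decreases the norm of \<open>v\<close> and fixes its projection to the
  \<open>\<lambda>\<close>-eigenspace \<open>K\<close>, the closed reachable chambers contain a generic point of \<open>K\<close>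
  (\<open>chamber_meets_eigenspace\<close>). Near such a point, the number of separating hyperplanes that do not contain
  \<open>K\<close> does not depend on the point (\<open>crossing_count_constant\<close>), while the hyperplanes that contain \<open>K\<close> belong to a
  smaller root system stable under \<open>g\<close>, to which induction applies (\<open>reach_maximal_descents\<close>).
\<close>


section \<open>Functions on a finite set as a Euclidean space\<close>

instantiation "fun" :: (type, real_vector) real_vector
begin

definition scaleR_fun_def: "r *\<^sub>R f = (\<lambda>x. r *\<^sub>R f x)"

instance
  by standard (auto simp: scaleR_fun_def plus_fun_def scaleR_add_right scaleR_add_left)

end

lemma scaleR_apply: "(r *\<^sub>R f) x = r *\<^sub>R f x"
  by (simp add: scaleR_fun_def)

text \<open>
  Functions are used as vectors, so evaluation of vector operations at a point should happen on request only;
  otherwise simplification turns equations between vectors into equations between abstractions.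
\<close>

declare plus_fun_apply [simp del] zero_fun_apply [simp del] minus_apply [simp del] uminus_apply [simp del]

lemmas pointwise = plus_fun_apply zero_fun_apply minus_apply uminus_apply scaleR_apply

lemma sum_apply: "(\<Sum>i\<in>I. f i) x = (\<Sum>i\<in>I. f i x)" for f :: "'j \<Rightarrow> 'i \<Rightarrow> 'b::real_vector"
  by (induction I rule: infinite_finite_induct) (auto simp: pointwise)

lemma linear_apply_sum:
  assumes "linear L"
  shows "L (\<Sum>i\<in>I. c i *\<^sub>R f i) = (\<Sum>i\<in>I. c i *\<^sub>R L (f i))"
  using assms by (simp add: linear_sum linear_scale)

definition unit_vector :: "'i \<Rightarrow> 'i \<Rightarrow> real" where "unit_vector i = (\<lambda>j. if j = i then 1 else 0)"

text \<open>
  The vectors are all functions \<open>'i \<Rightarrow> real\<close>, so that the dimension \<open>card I\<close> can be arbitrary while the type stays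
  fixed, and the product topology on functions supplies compactness. The form is bilinear on the whole type but
  is positive definite only on the functions supported in \<open>I\<close>. The last assumption makes coordinates
  bounded by the norm; averaging a standard inner product over a group preserves it.
\<close>

locale euclidean_form =
  fixes I :: "'i set" and b :: "('i \<Rightarrow> real) \<Rightarrow> ('i \<Rightarrow> real) \<Rightarrow> real"
  assumes finite_I: "finite I"
    and b_add: "b (u + v) w = b u w + b v w"
    and b_scale: "b (r *\<^sub>R u) w = r * b u w"
    and b_sym: "b u v = b v u"
    and b_coord: "\<lbrakk>\<And>j. j \<notin> I \<Longrightarrow> v j = 0; i \<in> I\<rbrakk> \<Longrightarrow> (v i)\<^sup>2 \<le> b v v"
begin

definition E :: "('i \<Rightarrow> real) set" where
  "E = {v. \<forall>j. j \<notin> I \<longrightarrow> v j = 0}"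

lemma b_add_right: "b w (u + v) = b w u + b w v"
  by (metis b_add b_sym)

lemma b_scale_right: "b w (r *\<^sub>R u) = r * b w u"
  by (metis b_scale b_sym)

lemma b_zero [simp]: "b 0 w = 0" "b w 0 = 0"
  using b_scale[of 0 0 w] b_scale_right[of w 0 0] by simp_all

lemma b_minus: "b (- u) w = - b u w" "b w (- u) = - b w u"
  using b_scale[of "-1" u w] b_scale_right[of w "-1" u] by simp_all

lemma b_diff: "b (u - v) w = b u w - b v w" "b w (u - v) = b w u - b w v"
  using b_add[of u "-v" w] b_add_right[of w u "-v"] by (simp_all add: b_minus)

lemma b_sum: "b (\<Sum>i\<in>A. f i) w = (\<Sum>i\<in>A. b (f i) w)"
  by (induction A rule: infinite_finite_induct) (simp_all add: b_add)

lemma b_sum_right: "b w (\<Sum>i\<in>A. f i) = (\<Sum>i\<in>A. b w (f i))"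
  by (induction A rule: infinite_finite_induct) (simp_all add: b_add_right)

lemmas b_simps = b_add b_add_right b_scale b_scale_right b_minus b_diff

lemma E_closed_ops [intro]:
  "0 \<in> E" "u \<in> E \<Longrightarrow> v \<in> E \<Longrightarrow> u + v \<in> E" "u \<in> E \<Longrightarrow> r *\<^sub>R u \<in> E"
  "u \<in> E \<Longrightarrow> v \<in> E \<Longrightarrow> u - v \<in> E" "u \<in> E \<Longrightarrow> - u \<in> E"
  by (auto simp: E_def pointwise)

lemma b_pos: "v \<in> E \<Longrightarrow> v \<noteq> 0 \<Longrightarrow> b v v > 0"
proof -
  assume v: "v \<in> E" "v \<noteq> 0"
  then obtain i where i: "v i \<noteq> 0" by (auto simp: fun_eq_iff pointwise)
  then have "i \<in> I" using v by (auto simp: E_def)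
  then have "(v i)\<^sup>2 \<le> b v v" using b_coord[of v i] v by (auto simp: E_def)
  then show ?thesis using i by (smt (verit) zero_less_power2)
qed

lemma E_expansion: "v \<in> E \<Longrightarrow> v = (\<Sum>i\<in>I. v i *\<^sub>R unit_vector i)"
proof (rule ext)
  fix j assume v: "v \<in> E"
  have "(\<Sum>i\<in>I. v i *\<^sub>R unit_vector i) j = (\<Sum>i\<in>I. if i = j then v i else 0)"
    by (auto simp: sum_apply unit_vector_def pointwise intro!: sum.cong)
  also have "\<dots> = v j" using v finite_I by (auto simp: E_def)
  finally show "v j = (\<Sum>i\<in>I. v i *\<^sub>R unit_vector i) j" by simp
qed

lemma continuous_coord: "continuous_on A (\<lambda>v::'i \<Rightarrow> real. v i)"
  using continuous_on_product_coordinates by (rule continuous_on_subset) simp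

lemma continuous_quadratic:
  assumes "linear L" shows "continuous_on E (\<lambda>v. b (L v) v)"
proof -
  have eq: "b (L v) v = (\<Sum>i\<in>I. \<Sum>j\<in>I. v i * (v j * b (L (unit_vector i)) (unit_vector j)))" if "v \<in> E" for v
  proof -
    have "b (L v) v = b (L (\<Sum>i\<in>I. v i *\<^sub>R unit_vector i)) (\<Sum>j\<in>I. v j *\<^sub>R unit_vector j)"
      using arg_cong[OF E_expansion[OF that], of "\<lambda>u. b (L u) u"] .
    also have "\<dots> = (\<Sum>i\<in>I. \<Sum>j\<in>I. v i * (v j * b (L (unit_vector i)) (unit_vector j)))"
      unfolding linear_apply_sum[OF assms] b_sum b_sum_right
      by (subst sum.swap) (simp add: b_simps mult.left_commute)
    finally show ?thesis .
  qed
  have "continuous_on E (\<lambda>v. \<Sum>i\<in>I. \<Sum>j\<in>I. v i * (v j * b (L (unit_vector i)) (unit_vector j)))"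
    by (intro continuous_on_sum continuous_on_mult continuous_on_const continuous_coord)
  then show ?thesis by (rule continuous_on_eq) (rule eq[symmetric])
qed

lemma continuous_linear_form: "continuous_on E (\<lambda>v. b v w)"
proof -
  have eq: "b v w = (\<Sum>i\<in>I. v i * b (unit_vector i) w)" if "v \<in> E" for v
    using arg_cong[OF E_expansion[OF that], of "\<lambda>u. b u w"] by (simp only: b_sum b_scale)
  have "continuous_on E (\<lambda>v. \<Sum>i\<in>I. v i * b (unit_vector i) w)"
    by (intro continuous_on_sum continuous_on_mult continuous_on_const continuous_coord)
  then show ?thesis by (rule continuous_on_eq) (rule eq[symmetric])
qed

lemma closed_E: "closed E"
proof -
  have "E = (\<Inter>j\<in>-I. {v. v j = 0})" by (auto simp: E_def)
  moreover have "closed \<dots>"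
    by (intro closed_INT ballI closed_Collect_eq continuous_on_const continuous_coord)
  ultimately show ?thesis by simp
qed

lemma compact_box: "compact {v \<in> E. \<forall>i\<in>I. \<bar>v i\<bar> \<le> M}"
proof -
  have "{v \<in> E. \<forall>i\<in>I. \<bar>v i\<bar> \<le> M} = (\<Pi>\<^sub>E i\<in>UNIV. if i \<in> I then {-M..M} else {0})"
  proof (rule Set.set_eqI)
    fix v
    have "v \<in> (\<Pi>\<^sub>E i\<in>UNIV. if i \<in> I then {-M..M} else {0}) \<longleftrightarrow>
        (\<forall>i. v i \<in> (if i \<in> I then {-M..M} else {0}))"
      by (simp only: PiE_iff) simp
    also have "\<dots> \<longleftrightarrow> v \<in> {v \<in> E. \<forall>i\<in>I. \<bar>v i\<bar> \<le> M}"
      unfolding E_def mem_Collect_eq by (metis abs_le_iff atLeastAtMost_iff minus_le_iff singleton_iff)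
    finally show "v \<in> {v \<in> E. \<forall>i\<in>I. \<bar>v i\<bar> \<le> M} \<longleftrightarrow>
        v \<in> (\<Pi>\<^sub>E i\<in>UNIV. if i \<in> I then {-M..M} else {0})" ..
  qed
  moreover have "compactin (product_topology (\<lambda>i. euclidean) UNIV)
      (\<Pi>\<^sub>E i\<in>UNIV. if i \<in> I then {-M..M::real} else {0})"
    by (subst compactin_PiE) auto
  ultimately show ?thesis
    by (simp add: euclidean_product_topology)
qed

text \<open>
  The form bounds every coordinate, so a ball is a closed subset of a product of compact intervals.
\<close>

lemma compact_ball: "compact {v \<in> E. b v v \<le> M}"
proof -
  have lin: "linear (\<lambda>v::'i \<Rightarrow> real. v)" by (rule linear_ident)
  have clo: "closed {v \<in> E. b v v \<in> {..M}}"
    using continuous_closed_preimage[OF continuous_quadratic[OF lin] closed_E, of "{..M}"]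
    by (simp add: vimage_def Int_def)
  have "\<bar>v i\<bar> \<le> sqrt M" if "v \<in> E" "b v v \<le> M" "i \<in> I" for v i
    using b_coord[of v i] that by (intro real_le_rsqrt) (auto simp: E_def)
  then have eq: "{v \<in> E. b v v \<le> M} = {v \<in> E. b v v \<in> {..M}} \<inter> {v \<in> E. \<forall>i\<in>I. \<bar>v i\<bar> \<le> sqrt M}"
    by auto
  show ?thesis
    unfolding eq by (rule closed_Int_compact[OF clo compact_box])
qed

text \<open>
  The condition with \<open>M\<close> says that the sublevel set through \<open>x\<close> is bounded; it holds both for the norm, where \<open>L\<close> is
  the identity, and for any quadratic form on the unit sphere.
\<close>

lemma attains_min:
  assumes "Y \<subseteq> E" "closed Y" "x \<in> Y" "linear L" and bd: "\<And>v. v \<in> Y \<Longrightarrow> b (L v) v \<le> b (L x) x \<Longrightarrow> b v v \<le> M"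
  obtains v where "v \<in> Y" "\<And>u. u \<in> Y \<Longrightarrow> b (L v) v \<le> b (L u) u"
proof -
  let ?K = "Y \<inter> {v \<in> E. b v v \<le> M}"
  have "compact ?K" using assms(2) compact_ball by (rule closed_Int_compact)
  moreover have "x \<in> ?K" using assms(1,3) bd[OF assms(3)] by auto
  moreover have "continuous_on ?K (\<lambda>v. b (L v) v)"
    using continuous_quadratic[OF assms(4)] by (rule continuous_on_subset) auto
  ultimately obtain v where v: "v \<in> ?K" "\<And>u. u \<in> ?K \<Longrightarrow> b (L v) v \<le> b (L u) u"
    using continuous_attains_inf[of ?K "\<lambda>v. b (L v) v"] by blast
  have "b (L v) v \<le> b (L u) u" if "u \<in> Y" for u
  proof (cases "b u u \<le> M")
    case True then show ?thesis using v(2)[of u] that assms(1) by blast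
  next
    case False
    then have "b (L x) x < b (L u) u" using bd[OF that] by linarith
    then show ?thesis using v(2)[OF \<open>x \<in> ?K\<close>] by linarith
  qed
  then show ?thesis using that[of v] v(1) by blast
qed

lemma closed_orth: "closed {v \<in> E. \<forall>n\<in>N. b v n = f n}"
proof -
  have "closed {v \<in> E. b v n = f n}" for n
    using continuous_closed_preimage[OF continuous_linear_form closed_E, of "{f n}" n]
    by (simp add: vimage_def Int_def)
  then have "closed (E \<inter> (\<Inter>n\<in>N. {v \<in> E. b v n = f n}))"
    by (intro closed_Int closed_E closed_INT ballI)
  moreover have "E \<inter> (\<Inter>n\<in>N. {v \<in> E. b v n = f n}) = {v \<in> E. \<forall>n\<in>N. b v n = f n}" by auto
  ultimately show ?thesis by simp
qed

lemma closed_halfspaces: "closed {v \<in> E. \<forall>n\<in>N. 0 \<le> b v n}"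
proof -
  have "closed {v \<in> E. 0 \<le> b v n}" for n
    using continuous_closed_preimage[OF continuous_linear_form closed_E, of "{0..}" n]
    by (simp add: vimage_def Int_def)
  then have "closed (E \<inter> (\<Inter>n\<in>N. {v \<in> E. 0 \<le> b v n}))"
    by (intro closed_Int closed_E closed_INT ballI)
  moreover have "E \<inter> (\<Inter>n\<in>N. {v \<in> E. 0 \<le> b v n}) = {v \<in> E. \<forall>n\<in>N. 0 \<le> b v n}" by auto
  ultimately show ?thesis by simp
qed

end


section \<open>Root systems and simple systems\<close>

context euclidean_form
begin

definition refl :: "('i \<Rightarrow> real) \<Rightarrow> ('i \<Rightarrow> real) \<Rightarrow> ('i \<Rightarrow> real)" where
  "refl \<beta> v = v - (2 * b v \<beta> / b \<beta> \<beta>) *\<^sub>R \<beta>"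

lemma linear_refl: "linear (refl \<beta>)"
  by (rule linearI) (simp_all add: refl_def b_simps algebra_simps add_divide_distrib)

lemma refl_orthogonal: "b v \<beta> = 0 \<Longrightarrow> refl \<beta> v = v"
  by (simp add: refl_def)

lemma b_root_pos: "\<beta> \<in> E \<Longrightarrow> \<beta> \<noteq> 0 \<Longrightarrow> b \<beta> \<beta> \<noteq> 0"
  using b_pos by force

lemma refl_minus: "refl \<beta> (- v) = - refl \<beta> v"
  by (simp add: refl_def b_minus)

context
  fixes \<beta> assumes nz: "b \<beta> \<beta> \<noteq> 0"
begin

lemma refl_self: "refl \<beta> \<beta> = - \<beta>"
proof -
  have "refl \<beta> \<beta> = \<beta> - 2 *\<^sub>R \<beta>" using nz by (simp add: refl_def)
  then show ?thesis by (simp add: scaleR_2)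
qed

lemma b_refl_beta: "b (refl \<beta> v) \<beta> = - b v \<beta>"
  using nz by (simp add: refl_def b_simps field_simps)

lemma refl_refl: "refl \<beta> (refl \<beta> v) = v"
  unfolding refl_def[of \<beta> "refl \<beta> v"] b_refl_beta by (simp add: refl_def)

lemma b_refl_shift: "b (refl \<beta> u) v = b u (refl \<beta> v)"
  by (simp add: refl_def b_simps b_sym)

lemma inj_refl: "inj (refl \<beta>)"
  by (metis injI refl_refl)

end

text \<open>
  The last clause makes the positive multiples of a root distinct from the other roots. Roots may have different
  lengths.
\<close>

definition root_set :: "('i \<Rightarrow> real) set \<Rightarrow> bool" where
  "root_set \<Psi> \<longleftrightarrow> finite \<Psi> \<and> \<Psi> \<subseteq> E \<and> 0 \<notin> \<Psi> \<and> (\<forall>\<alpha>\<in>\<Psi>. \<forall>\<beta>\<in>\<Psi>. refl \<beta> \<alpha> \<in> \<Psi>) \<and>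
     (\<forall>\<alpha>\<in>\<Psi>. \<forall>c>0. c *\<^sub>R \<alpha> \<in> \<Psi> \<longrightarrow> c = 1)"

text \<open>
  A simple system \<open>\<Delta>\<close> stands for a chamber, namely the set of vectors that pair nonnegatively with \<open>\<Delta>\<close>, and
  \<open>pos \<Psi> \<Delta>\<close> consists of the roots that are nonnegative on this chamber.
\<close>

definition pos :: "('i \<Rightarrow> real) set \<Rightarrow> ('i \<Rightarrow> real) set \<Rightarrow> ('i \<Rightarrow> real) set" where
  "pos \<Psi> \<Delta> = {\<alpha> \<in> \<Psi>. \<exists>c. (\<forall>\<gamma>\<in>\<Delta>. 0 \<le> c \<gamma>) \<and> \<alpha> = (\<Sum>\<gamma>\<in>\<Delta>. c \<gamma> *\<^sub>R \<gamma>)}"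

lemma posI:
  assumes "\<alpha> \<in> \<Psi>" "\<And>\<gamma>. \<gamma> \<in> \<Delta> \<Longrightarrow> 0 \<le> c \<gamma>" "\<alpha> = (\<Sum>\<gamma>\<in>\<Delta>. c \<gamma> *\<^sub>R \<gamma>)"
  shows "\<alpha> \<in> pos \<Psi> \<Delta>"
  unfolding pos_def mem_Collect_eq using assms by (intro conjI exI[of _ c]) simp_all

definition simple_system :: "('i \<Rightarrow> real) set \<Rightarrow> ('i \<Rightarrow> real) set \<Rightarrow> bool" where
  "simple_system \<Psi> \<Delta> \<longleftrightarrow> \<Delta> \<subseteq> \<Psi> \<and> independent \<Delta> \<and> (\<forall>\<alpha>\<in>\<Psi>. \<alpha> \<in> pos \<Psi> \<Delta> \<or> - \<alpha> \<in> pos \<Psi> \<Delta>)"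

lemma pos_subset: "pos \<Psi> \<Delta> \<subseteq> \<Psi>"
  by (auto simp: pos_def)

lemma root_setD:
  assumes "root_set \<Psi>"
  shows "finite \<Psi>" "\<Psi> \<subseteq> E" "0 \<notin> \<Psi>" "\<alpha> \<in> \<Psi> \<Longrightarrow> \<beta> \<in> \<Psi> \<Longrightarrow> refl \<beta> \<alpha> \<in> \<Psi>"
    "\<alpha> \<in> \<Psi> \<Longrightarrow> 0 < c \<Longrightarrow> c *\<^sub>R \<alpha> \<in> \<Psi> \<Longrightarrow> c = 1"
  using assms by (auto simp: root_set_def)

lemma root_nz:
  assumes "root_set \<Psi>" "\<beta> \<in> \<Psi>" shows "b \<beta> \<beta> \<noteq> 0"
  using assms b_root_pos root_setD(2,3) by (metis subsetD)

lemma root_minus: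
  assumes "root_set \<Psi>" "\<beta> \<in> \<Psi>" shows "- \<beta> \<in> \<Psi>"
  using root_setD(4)[OF assms(1,2,2)] refl_self[OF root_nz[OF assms]] by simp

lemma simple_finite: "root_set \<Psi> \<Longrightarrow> simple_system \<Psi> \<Delta> \<Longrightarrow> finite \<Delta>"
  by (auto simp: simple_system_def root_set_def intro: finite_subset)

lemma simple_sum_zero:
  assumes "root_set \<Psi>" "simple_system \<Psi> \<Delta>" "(\<Sum>\<gamma>\<in>\<Delta>. c \<gamma> *\<^sub>R \<gamma>) = 0" "\<gamma> \<in> \<Delta>"
  shows "c \<gamma> = 0"
  using independentD[of \<Delta> \<Delta> c \<gamma>] simple_finite[OF assms(1,2)] assms by (auto simp: simple_system_def)

lemma simple_pos:
  assumes "root_set \<Psi>" "simple_system \<Psi> \<Delta>" "\<beta> \<in> \<Delta>" shows "\<beta> \<in> pos \<Psi> \<Delta>"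
proof -
  have "\<beta> = (\<Sum>\<gamma>\<in>\<Delta>. if \<gamma> = \<beta> then \<gamma> else 0)"
    using simple_finite[OF assms(1,2)] assms(3) by simp
  also have "\<dots> = (\<Sum>\<gamma>\<in>\<Delta>. (if \<gamma> = \<beta> then 1 else 0) *\<^sub>R \<gamma>)" by (intro sum.cong) auto
  finally have "\<beta> = (\<Sum>\<gamma>\<in>\<Delta>. (if \<gamma> = \<beta> then 1 else 0) *\<^sub>R \<gamma>)" .
  moreover have "\<beta> \<in> \<Psi>" using assms by (auto simp: simple_system_def)
  ultimately show ?thesis by (intro posI[where c = "\<lambda>\<gamma>. if \<gamma> = \<beta> then 1 else 0"]) simp_all
qed

lemma pos_not_neg:
  assumes "root_set \<Psi>" "simple_system \<Psi> \<Delta>" "\<alpha> \<in> pos \<Psi> \<Delta>" shows "- \<alpha> \<notin> pos \<Psi> \<Delta>"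
proof
  assume "- \<alpha> \<in> pos \<Psi> \<Delta>"
  then obtain d where d: "\<And>\<gamma>. \<gamma> \<in> \<Delta> \<Longrightarrow> 0 \<le> d \<gamma>" "- \<alpha> = (\<Sum>\<gamma>\<in>\<Delta>. d \<gamma> *\<^sub>R \<gamma>)" by (auto simp: pos_def)
  obtain c where c: "\<And>\<gamma>. \<gamma> \<in> \<Delta> \<Longrightarrow> 0 \<le> c \<gamma>" "\<alpha> = (\<Sum>\<gamma>\<in>\<Delta>. c \<gamma> *\<^sub>R \<gamma>)"
    using assms(3) by (auto simp: pos_def)
  have "(\<Sum>\<gamma>\<in>\<Delta>. (c \<gamma> + d \<gamma>) *\<^sub>R \<gamma>) = \<alpha> + - \<alpha>"
    unfolding d(2) by (simp only: scaleR_add_left sum.distrib c(2)[symmetric])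
  also have "\<dots> = 0" by (rule add.right_inverse)
  finally have "c \<gamma> + d \<gamma> = 0" if "\<gamma> \<in> \<Delta>" for \<gamma>
    using that by (rule simple_sum_zero[OF assms(1,2)])
  then have "c \<gamma> = 0" if "\<gamma> \<in> \<Delta>" for \<gamma>
    using c(1)[OF that] d(1)[OF that] that by force
  then have "\<alpha> = 0" using c(2) by simp
  then show False using assms(1,3) pos_subset root_setD(3) by blast
qed

lemma pos_iff_not_neg:
  assumes "root_set \<Psi>" "simple_system \<Psi> \<Delta>" "\<alpha> \<in> \<Psi>"
  shows "- \<alpha> \<in> pos \<Psi> \<Delta> \<longleftrightarrow> \<alpha> \<notin> pos \<Psi> \<Delta>"
  using assms pos_not_neg[OF assms(1,2)] by (auto simp: simple_system_def)

text \<open>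
  A positive root other than \<open>\<beta>\<close> has a positive coefficient at some simple root \<open>\<gamma> \<noteq> \<beta>\<close>, since no other multiple of
  \<open>\<beta>\<close> is a positive root. The reflection in \<open>\<beta>\<close> leaves that coefficient alone, so the image cannot be negative.
\<close>

lemma refl_pos:
  assumes R: "root_set \<Psi>" and S: "simple_system \<Psi> \<Delta>" and \<beta>: "\<beta> \<in> \<Delta>"
    and \<alpha>: "\<alpha> \<in> pos \<Psi> \<Delta>" and ne: "\<alpha> \<noteq> \<beta>"
  shows "refl \<beta> \<alpha> \<in> pos \<Psi> \<Delta>"
proof (rule ccontr)
  have fin: "finite \<Delta>" using simple_finite[OF R S] .
  have \<beta>\<Psi>: "\<beta> \<in> \<Psi>" "\<alpha> \<in> \<Psi>" using \<beta> S \<alpha> pos_subset by (auto simp: simple_system_def)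
  assume "refl \<beta> \<alpha> \<notin> pos \<Psi> \<Delta>"
  then have "- refl \<beta> \<alpha> \<in> pos \<Psi> \<Delta>"
    using pos_iff_not_neg[OF R S] root_setD(4)[OF R \<beta>\<Psi>(2,1)] by blast
  then obtain d where d: "\<And>\<gamma>. \<gamma> \<in> \<Delta> \<Longrightarrow> 0 \<le> d \<gamma>" "- refl \<beta> \<alpha> = (\<Sum>\<gamma>\<in>\<Delta>. d \<gamma> *\<^sub>R \<gamma>)" by (auto simp: pos_def)
  obtain c where c: "\<And>\<gamma>. \<gamma> \<in> \<Delta> \<Longrightarrow> 0 \<le> c \<gamma>" "\<alpha> = (\<Sum>\<gamma>\<in>\<Delta>. c \<gamma> *\<^sub>R \<gamma>)"
    using \<alpha> by (auto simp: pos_def)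
  \<comment> \<open>\<open>\<alpha>\<close> and \<open>refl \<beta> \<alpha>\<close> differ by \<open>k \<beta>\<close>, so all coefficients other than the one at \<open>\<beta>\<close> cancel\<close>
  define k where "k = 2 * b \<alpha> \<beta> / b \<beta> \<beta>"
  have "k *\<^sub>R \<beta> = (\<Sum>\<gamma>\<in>\<Delta>. (if \<gamma> = \<beta> then k *\<^sub>R \<gamma> else 0))" using fin \<beta> by simp
  then have "k *\<^sub>R \<beta> = (\<Sum>\<gamma>\<in>\<Delta>. (if \<gamma> = \<beta> then k else 0) *\<^sub>R \<gamma>)"
    by (simp add: if_distrib[of "\<lambda>x. x *\<^sub>R _"] cong: if_cong)
  then have "(\<Sum>\<gamma>\<in>\<Delta>. (c \<gamma> + d \<gamma> - (if \<gamma> = \<beta> then k else 0)) *\<^sub>R \<gamma>) = \<alpha> + - refl \<beta> \<alpha> - k *\<^sub>R \<beta>"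
    unfolding d(2) by (simp only: scaleR_add_left scaleR_diff_left sum.distrib sum_subtractf c(2)[symmetric])
  also have "\<dots> = 0" by (simp add: refl_def k_def)
  finally have "c \<gamma> + d \<gamma> - (if \<gamma> = \<beta> then k else 0) = 0" if "\<gamma> \<in> \<Delta>" for \<gamma>
    using simple_sum_zero[OF R S _ that] by fast
  then have z: "c \<gamma> = 0" if "\<gamma> \<in> \<Delta>" "\<gamma> \<noteq> \<beta>" for \<gamma>
    using c(1)[OF that(1)] d(1)[OF that(1)] that by force
  have "\<alpha> = (\<Sum>\<gamma>\<in>\<Delta>. if \<gamma> = \<beta> then c \<beta> *\<^sub>R \<beta> else 0)"
    unfolding c(2) by (rule sum.cong) (auto simp: z)
  then have eq: "\<alpha> = c \<beta> *\<^sub>R \<beta>" using fin \<beta> by simp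
  moreover have "c \<beta> \<noteq> 0" using eq \<beta>\<Psi>(2) root_setD(3)[OF R] by auto
  ultimately have "c \<beta> = 1" using root_setD(5)[OF R \<beta>\<Psi>(1), of "c \<beta>"] \<beta>\<Psi>(2) c(1)[OF \<beta>] by simp
  then show False using eq ne by simp
qed

lemma pos_refl_image:
  assumes R: "root_set \<Psi>" and S: "simple_system \<Psi> \<Delta>" and \<beta>: "\<beta> \<in> \<Psi>"
  shows "pos \<Psi> (refl \<beta> ` \<Delta>) = refl \<beta> ` pos \<Psi> \<Delta>"
proof -
  note nz = root_nz[OF R \<beta>]
  have inj: "inj_on (refl \<beta>) \<Delta>" using inj_refl[OF nz] by (rule inj_on_subset) simp
  have sub: "refl \<beta> ` pos \<Psi> D \<subseteq> pos \<Psi> (refl \<beta> ` D)" if "inj_on (refl \<beta>) D" for D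
  proof
    fix x assume "x \<in> refl \<beta> ` pos \<Psi> D"
    then obtain \<alpha> c where c: "x = refl \<beta> \<alpha>" "\<alpha> \<in> \<Psi>" "\<And>\<gamma>. \<gamma> \<in> D \<Longrightarrow> 0 \<le> c \<gamma>" "\<alpha> = (\<Sum>\<gamma>\<in>D. c \<gamma> *\<^sub>R \<gamma>)"
      by (auto simp: pos_def)
    have "x = (\<Sum>\<gamma>\<in>D. c \<gamma> *\<^sub>R refl \<beta> \<gamma>)" unfolding c(1,4) by (rule linear_apply_sum[OF linear_refl])
    also have "\<dots> = (\<Sum>\<gamma>\<in>refl \<beta> ` D. c (refl \<beta> \<gamma>) *\<^sub>R \<gamma>)"
      by (simp add: sum.reindex[OF that] refl_refl[OF nz])
    finally have "x = (\<Sum>\<gamma>\<in>refl \<beta> ` D. c (refl \<beta> \<gamma>) *\<^sub>R \<gamma>)" .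
    moreover have "0 \<le> c (refl \<beta> \<gamma>)" if "\<gamma>\<in>refl \<beta> ` D" for \<gamma> using that c(3) by (auto simp: refl_refl[OF nz])
    moreover have "x \<in> \<Psi>" using root_setD(4)[OF R c(2) \<beta>] c(1) by simp
    ultimately show "x \<in> pos \<Psi> (refl \<beta> ` D)" by (intro posI[where c = "\<lambda>\<gamma>. c (refl \<beta> \<gamma>)"])
  qed
  have "refl \<beta> ` pos \<Psi> (refl \<beta> ` \<Delta>) \<subseteq> pos \<Psi> \<Delta>"
    using sub[of "refl \<beta> ` \<Delta>"] inj_refl[OF nz] by (simp add: image_image refl_refl[OF nz] inj_on_def inj_def)
  then have "refl \<beta> ` refl \<beta> ` pos \<Psi> (refl \<beta> ` \<Delta>) \<subseteq> refl \<beta> ` pos \<Psi> \<Delta>" by blast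
  then show ?thesis using sub[OF inj] by (simp add: image_image refl_refl[OF nz])
qed

lemma pos_refl_simple:
  assumes R: "root_set \<Psi>" and S: "simple_system \<Psi> \<Delta>" and \<beta>: "\<beta> \<in> \<Delta>"
  shows "pos \<Psi> (refl \<beta> ` \<Delta>) = insert (- \<beta>) (pos \<Psi> \<Delta> - {\<beta>})"
proof -
  have \<beta>\<Psi>: "\<beta> \<in> \<Psi>" using \<beta> S by (auto simp: simple_system_def)
  note nz = root_nz[OF R \<beta>\<Psi>]
  have \<beta>P: "\<beta> \<in> pos \<Psi> \<Delta>" using simple_pos[OF R S \<beta>] .
  have ne: "refl \<beta> \<alpha> \<noteq> \<beta>" if "\<alpha> \<in> pos \<Psi> \<Delta>" for \<alpha>
  proof
    assume "refl \<beta> \<alpha> = \<beta>"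
    then have "\<alpha> = - \<beta>" using refl_self[OF nz] refl_refl[OF nz] by metis
    then show False using that pos_not_neg[OF R S \<beta>P] by simp
  qed
  have "refl \<beta> ` (pos \<Psi> \<Delta> - {\<beta>}) \<subseteq> pos \<Psi> \<Delta> - {\<beta>}"
    using refl_pos[OF R S \<beta>] ne by auto
  moreover from this have "refl \<beta> ` refl \<beta> ` (pos \<Psi> \<Delta> - {\<beta>}) \<subseteq> refl \<beta> ` (pos \<Psi> \<Delta> - {\<beta>})" by blast
  ultimately have eq: "refl \<beta> ` (pos \<Psi> \<Delta> - {\<beta>}) = pos \<Psi> \<Delta> - {\<beta>}"
    by (auto simp add: image_image refl_refl[OF nz])
  have "refl \<beta> ` pos \<Psi> \<Delta> = insert (refl \<beta> \<beta>) (refl \<beta> ` (pos \<Psi> \<Delta> - {\<beta>}))"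
    using \<beta>P by blast
  then show ?thesis using pos_refl_image[OF R S \<beta>\<Psi>] eq refl_self[OF nz] by simp
qed

lemma refl_simple_system:
  assumes R: "root_set \<Psi>" and S: "simple_system \<Psi> \<Delta>" and \<beta>: "\<beta> \<in> \<Psi>"
  shows "simple_system \<Psi> (refl \<beta> ` \<Delta>)"
proof -
  note nz = root_nz[OF R \<beta>]
  have "refl \<beta> ` \<Delta> \<subseteq> \<Psi>" using S root_setD(4)[OF R _ \<beta>] by (auto simp: simple_system_def)
  moreover have "independent (refl \<beta> ` \<Delta>)"
    using S linear_independent_injective_image[OF linear_refl _ inj_on_subset[OF inj_refl[OF nz] subset_UNIV]] by (simp add: simple_system_def)
  moreover have "\<alpha> \<in> pos \<Psi> (refl \<beta> ` \<Delta>) \<or> - \<alpha> \<in> pos \<Psi> (refl \<beta> ` \<Delta>)" if "\<alpha> \<in> \<Psi>" for \<alpha>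
  proof -
    have "refl \<beta> \<alpha> \<in> pos \<Psi> \<Delta> \<or> - refl \<beta> \<alpha> \<in> pos \<Psi> \<Delta>"
      using S root_setD(4)[OF R that \<beta>] by (simp add: simple_system_def)
    then show ?thesis unfolding pos_refl_image[OF R S \<beta>]
      by (metis image_eqI refl_minus refl_refl[OF nz])
  qed
  ultimately show ?thesis by (simp add: simple_system_def)
qed

lemma pos_nonneg_pairing:
  assumes "\<alpha> \<in> pos \<Psi> \<Delta>" "\<And>\<gamma>. \<gamma> \<in> \<Delta> \<Longrightarrow> 0 \<le> b v \<gamma>" shows "0 \<le> b v \<alpha>"
proof -
  obtain c where c: "\<And>\<gamma>. \<gamma> \<in> \<Delta> \<Longrightarrow> 0 \<le> c \<gamma>" "\<alpha> = (\<Sum>\<gamma>\<in>\<Delta>. c \<gamma> *\<^sub>R \<gamma>)"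
    using assms(1) by (auto simp: pos_def)
  show ?thesis unfolding c(2) b_sum_right b_scale_right by (intro sum_nonneg mult_nonneg_nonneg c assms)
qed

lemma root_set_restrict:
  assumes "root_set \<Psi>" shows "root_set {\<alpha> \<in> \<Psi>. \<forall>n\<in>N. b \<alpha> n = 0}"
proof -
  have "b (refl \<beta> \<alpha>) n = 0" if "b \<alpha> n = 0" "b \<beta> n = 0" for \<alpha> \<beta> n
    using that by (simp add: refl_def b_simps)
  then show ?thesis using assms by (auto simp: root_set_def)
qed

text \<open>
  If \<open>v\<close> is in the closed chamber and \<open>\<langle>v, \<alpha>\<rangle> = 0\<close> for a positive root \<open>\<alpha> = \<Sum> c\<^sub>\<gamma> \<gamma>\<close>, then all terms of
  \<open>\<Sum> c\<^sub>\<gamma> \<langle>v, \<gamma>\<rangle>\<close> vanish, so only simple roots orthogonal to \<open>v\<close> occur. Thus the roots orthogonal to \<open>v\<close> form a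
  root system whose simple roots are among those of the chamber.
\<close>

lemma pos_restrict:
  assumes R: "root_set \<Psi>" and S: "simple_system \<Psi> \<Delta>" and v: "\<And>\<gamma>. \<gamma> \<in> \<Delta> \<Longrightarrow> 0 \<le> b v \<gamma>"
    and \<Psi>': "\<Psi>' = {\<alpha> \<in> \<Psi>. b v \<alpha> = 0}"
  shows "pos \<Psi>' (\<Delta> \<inter> \<Psi>') = pos \<Psi> \<Delta> \<inter> \<Psi>'"
proof (intro equalityI subsetI)
  have fin: "finite \<Delta>" using simple_finite[OF R S] .
  fix \<alpha> assume "\<alpha> \<in> pos \<Psi>' (\<Delta> \<inter> \<Psi>')"
  then obtain c where c: "\<alpha> \<in> \<Psi>'" "\<And>\<gamma>. \<gamma> \<in> \<Delta> \<inter> \<Psi>' \<Longrightarrow> 0 \<le> c \<gamma>" "\<alpha> = (\<Sum>\<gamma>\<in>\<Delta> \<inter> \<Psi>'. c \<gamma> *\<^sub>R \<gamma>)"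
    by (auto simp: pos_def)
  have "\<alpha> = (\<Sum>\<gamma>\<in>\<Delta>. (if \<gamma> \<in> \<Psi>' then c \<gamma> else 0) *\<^sub>R \<gamma>)"
    unfolding c(3) using fin by (simp add: sum.inter_restrict if_distrib[of "\<lambda>x. x *\<^sub>R _"] cong: if_cong)
  moreover have "\<alpha> \<in> \<Psi>" using c(1) \<Psi>' by simp
  ultimately have "\<alpha> \<in> pos \<Psi> \<Delta>"
    using c(2) by (intro posI[where c = "\<lambda>\<gamma>. if \<gamma> \<in> \<Psi>' then c \<gamma> else 0"]) simp_all
  then show "\<alpha> \<in> pos \<Psi> \<Delta> \<inter> \<Psi>'" using c(1) by simp
next
  have fin: "finite \<Delta>" using simple_finite[OF R S] .
  fix \<alpha> assume \<alpha>: "\<alpha> \<in> pos \<Psi> \<Delta> \<inter> \<Psi>'"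
  then obtain c where c: "\<And>\<gamma>. \<gamma> \<in> \<Delta> \<Longrightarrow> 0 \<le> c \<gamma>" "\<alpha> = (\<Sum>\<gamma>\<in>\<Delta>. c \<gamma> *\<^sub>R \<gamma>)" by (auto simp: pos_def)
  have "(\<Sum>\<gamma>\<in>\<Delta>. c \<gamma> * b v \<gamma>) = b v \<alpha>" unfolding c(2) b_sum_right b_scale_right ..
  also have "\<dots> = 0" using \<alpha> \<Psi>' by simp
  finally have z: "c \<gamma> * b v \<gamma> = 0" if "\<gamma> \<in> \<Delta>" for \<gamma>
    using that sum_nonneg_eq_0_iff[OF fin, of "\<lambda>\<gamma>. c \<gamma> * b v \<gamma>"] c(1) v by simp
  have "c \<gamma> *\<^sub>R \<gamma> = (if \<gamma> \<in> \<Psi>' then c \<gamma> *\<^sub>R \<gamma> else 0)" if "\<gamma> \<in> \<Delta>" for \<gamma>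
    using z[OF that] that S by (auto simp: \<Psi>' simple_system_def)
  then have "\<alpha> = (\<Sum>\<gamma>\<in>\<Delta>. if \<gamma> \<in> \<Psi>' then c \<gamma> *\<^sub>R \<gamma> else 0)" unfolding c(2) by (rule sum.cong[OF HOL.refl])
  then have "\<alpha> = (\<Sum>\<gamma>\<in>\<Delta> \<inter> \<Psi>'. c \<gamma> *\<^sub>R \<gamma>)" using fin by (simp add: sum.inter_restrict)
  then show "\<alpha> \<in> pos \<Psi>' (\<Delta> \<inter> \<Psi>')" using \<alpha> c(1) by (intro posI[where c = c]) simp_all
qed

lemma simple_system_restrict:
  assumes R: "root_set \<Psi>" and S: "simple_system \<Psi> \<Delta>" and v: "\<And>\<gamma>. \<gamma> \<in> \<Delta> \<Longrightarrow> 0 \<le> b v \<gamma>"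
    and \<Psi>': "\<Psi>' = {\<alpha> \<in> \<Psi>. b v \<alpha> = 0}"
  shows "simple_system \<Psi>' (\<Delta> \<inter> \<Psi>')"
proof -
  have "independent (\<Delta> \<inter> \<Psi>')" using S independent_mono[of \<Delta> "\<Delta> \<inter> \<Psi>'"] by (simp add: simple_system_def)
  moreover have "\<alpha> \<in> pos \<Psi> \<Delta> \<inter> \<Psi>' \<or> - \<alpha> \<in> pos \<Psi> \<Delta> \<inter> \<Psi>'" if "\<alpha> \<in> \<Psi>'" for \<alpha>
    using S that root_minus[OF R] by (auto simp: simple_system_def \<Psi>' b_minus)
  moreover have "pos \<Psi>' (\<Delta> \<inter> \<Psi>') = pos \<Psi> \<Delta> \<inter> \<Psi>'" using assms by (rule pos_restrict)
  ultimately show ?thesis unfolding simple_system_def by (intro conjI ballI) simp_all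
qed

lemma card_exchange_le:
  assumes "finite A" "finite B" "A - {x} \<subseteq> B - {y}" "y \<in> B"
  shows "card A \<le> card B"
proof -
  have "card A \<le> card (insert x (A - {x}))" using assms(1) by (intro card_mono) auto
  also have "\<dots> \<le> Suc (card (A - {x}))" by (rule card_insert_le_m1) simp_all
  also have "\<dots> \<le> Suc (card (B - {y}))" using assms card_mono[of "B - {y}" "A - {x}"] by simp
  also have "\<dots> = card B" using assms(2,4) by (rule card_Suc_Diff1)
  finally show ?thesis .
qed

text \<open>
  The number of root hyperplanes that separate the chamber of \<open>\<Delta>\<close> from its image under \<open>g\<close>; for the chambers of
  a Coxeter group it is the length of a twisted conjugate.
\<close>

definition descents :: "(('i \<Rightarrow> real) \<Rightarrow> ('i \<Rightarrow> real)) \<Rightarrow> ('i \<Rightarrow> real) set \<Rightarrow> ('i \<Rightarrow> real) set \<Rightarrow> nat" where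
  "descents g \<Psi> \<Delta> = card {\<alpha> \<in> pos \<Psi> \<Delta>. g \<alpha> \<notin> pos \<Psi> \<Delta>}"

definition ascent_step :: "(('i \<Rightarrow> real) \<Rightarrow> ('i \<Rightarrow> real)) \<Rightarrow> ('i \<Rightarrow> real) set \<Rightarrow> ('i \<Rightarrow> real) set \<Rightarrow> ('i \<Rightarrow> real) set \<Rightarrow> bool" where
  "ascent_step g \<Psi> \<Delta> \<Delta>' \<longleftrightarrow> (\<exists>\<beta>\<in>\<Delta>. \<Delta>' = refl \<beta> ` \<Delta> \<and> descents g \<Psi> \<Delta> \<le> descents g \<Psi> \<Delta>')"

text \<open>
  If \<open>g \<beta> = \<beta>\<close>, no descent is lost. Otherwise, replacing \<open>\<beta>\<close> by \<open>- \<beta>\<close> among the positive roots only affects the descent status of \<open>\<plusminus>\<beta>\<close> and \<open>\<plusminus>g\<^sup>-\<^sup>1\<beta>\<close>. If \<open>g \<beta>\<close> is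
  positive, then \<open>- \<beta>\<close> becomes a descent and at most \<open>- g\<^sup>-\<^sup>1\<beta>\<close> is lost; if \<open>g\<^sup>-\<^sup>1\<beta>\<close> is positive, it
  becomes a descent and at most \<open>\<beta>\<close> is lost.
\<close>

lemma descents_mono:
  assumes R: "root_set \<Psi>" and S: "simple_system \<Psi> \<Delta>" and \<beta>: "\<beta> \<in> \<Delta>"
    and g: "\<And>\<alpha>. g (- \<alpha>) = - g \<alpha>" "\<And>\<alpha>. g (h \<alpha>) = \<alpha>" "\<And>\<alpha>. h (g \<alpha>) = \<alpha>" "g ` \<Psi> = \<Psi>"
    and up: "g \<beta> \<in> pos \<Psi> \<Delta> \<or> h \<beta> \<in> pos \<Psi> \<Delta>"
  shows "descents g \<Psi> \<Delta> \<le> descents g \<Psi> (refl \<beta> ` \<Delta>)"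
proof -
  let ?P = "pos \<Psi> \<Delta>"
  let ?P' = "insert (- \<beta>) (?P - {\<beta>})"
  let ?N = "{\<alpha> \<in> ?P. g \<alpha> \<notin> ?P}" and ?N' = "{\<alpha> \<in> ?P'. g \<alpha> \<notin> ?P'}"
  have fin: "finite ?P" using pos_subset root_setD(1)[OF R] by (rule finite_subset)
  have \<beta>P: "\<beta> \<in> ?P" using simple_pos[OF R S \<beta>] .
  have m\<beta>: "- \<beta> \<notin> ?P" using pos_not_neg[OF R S \<beta>P] .
  have PN: "\<alpha> \<in> ?P \<Longrightarrow> - \<alpha> \<notin> ?P" for \<alpha> using pos_not_neg[OF R S] .
  have h\<Psi>: "h \<alpha> \<in> \<Psi>" if "\<alpha> \<in> \<Psi>" for \<alpha> using g that by (metis image_iff)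
  have hm: "h (- \<alpha>) = - h \<alpha>" for \<alpha> using g by metis
  have "card ?N \<le> card ?N'"
  proof (cases "g \<beta> = \<beta>")
    case True
    have "?N \<subseteq> ?N'"
    proof
      fix \<alpha> assume \<alpha>: "\<alpha> \<in> ?N"
      then have "\<alpha> \<noteq> \<beta>" using True \<beta>P by auto
      moreover have "g \<alpha> \<noteq> - \<beta>" 
      proof
        assume "g \<alpha> = - \<beta>"
        then have "g \<alpha> = g (- \<beta>)" using True g(1) by simp
        then have "\<alpha> = - \<beta>" using g(3) by metis
        then show False using \<alpha> m\<beta> by simp
      qed
      ultimately show "\<alpha> \<in> ?N'" using \<alpha> by auto
    qed
    then show ?thesis using fin by (intro card_mono) auto
  next
    case False
    show ?thesis
    proof (cases "g \<beta> \<in> ?P")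
      case True
      let ?x = "- h \<beta>"
      have "?N - {?x} \<subseteq> ?N' - {- \<beta>}"
      proof
        fix \<alpha> assume \<alpha>: "\<alpha> \<in> ?N - {?x}"
        then have "\<alpha> \<noteq> \<beta>" using True by auto
        moreover have "g \<alpha> \<noteq> - \<beta>"
        proof
          assume "g \<alpha> = - \<beta>"
          then have "\<alpha> = - h \<beta>" using g(3)[of \<alpha>] hm[of \<beta>] by simp
          then show False using \<alpha> by simp
        qed
        ultimately show "\<alpha> \<in> ?N' - {- \<beta>}" using \<alpha> m\<beta> by auto
      qed
      moreover have "- \<beta> \<in> ?N'" using PN[OF True] g(1) False by auto
      ultimately show ?thesis using fin by (intro card_exchange_le[of _ _ "?x" "- \<beta>"]) simp_all
    next
      case F2: False
      then have hP: "h \<beta> \<in> ?P" using up by simp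
      have hne: "h \<beta> \<noteq> \<beta>" using False g(2) by metis
      have "?N - {\<beta>} \<subseteq> ?N' - {h \<beta>}"
      proof
        fix \<alpha> assume \<alpha>: "\<alpha> \<in> ?N - {\<beta>}"
        have "g \<alpha> \<noteq> - \<beta>"
        proof
          assume "g \<alpha> = - \<beta>"
          then have "\<alpha> = - h \<beta>" using g(3) hm by metis
          then show False using \<alpha> PN[OF hP] by simp
        qed
        moreover have "\<alpha> \<noteq> h \<beta>" using \<alpha> \<beta>P g(2) by auto
        ultimately show "\<alpha> \<in> ?N' - {h \<beta>}" using \<alpha> by auto
      qed
      moreover have "\<beta> \<noteq> - \<beta>" using \<beta>P m\<beta> by metis
      then have "h \<beta> \<in> ?N'" using hP hne by (auto simp: g(2))
      ultimately show ?thesis using fin by (intro card_exchange_le[of _ _ "\<beta>" "h \<beta>"]) simp_all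
    qed
  qed
  then show ?thesis by (simp only: descents_def pos_refl_simple[OF R S \<beta>])
qed

end


section \<open>Following a point towards an eigenspace\<close>

text \<open>
  Here \<open>h\<close> is the inverse of \<open>g\<close>. It is a parameter because it is used as often as \<open>g\<close>: the argument is about the
  self-adjoint operator \<open>g + h\<close>.
\<close>

locale euclidean_isometry = euclidean_form +
  fixes g h :: "('a \<Rightarrow> real) \<Rightarrow> ('a \<Rightarrow> real)"
  assumes linear_g: "linear g" and linear_h: "linear h"
    and gh [simp]: "g (h v) = v" and hg [simp]: "h (g v) = v"
    and adjoint: "b (g u) v = b u (h v)"
    and E_g: "v \<in> E \<Longrightarrow> g v \<in> E" and E_h: "v \<in> E \<Longrightarrow> h v \<in> E"
begin

definition A :: "('a \<Rightarrow> real) \<Rightarrow> ('a \<Rightarrow> real)" where "A v = g v + h v"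

lemma adjoint': "b (h u) v = b u (g v)"
  using adjoint[of v u] b_sym by metis

lemma linear_A: "linear A"
  using linear_g linear_h
  by (intro linearI) (simp_all add: A_def linear_add linear_scale scaleR_add_right)

lemma A_symmetric: "b (A u) v = b u (A v)"
  by (simp add: A_def b_simps adjoint adjoint')

lemma A_simps: "A (u + v) = A u + A v" "A (r *\<^sub>R v) = r *\<^sub>R A v" "A (u - v) = A u - A v"
  using linear_A by (simp_all add: linear_add linear_scale linear_diff)

lemma E_A: "v \<in> E \<Longrightarrow> A v \<in> E"
  using E_g E_h by (auto simp: A_def)

lemma g_minus: "g (- v) = - g v" "h (- v) = - h v"
  using linear_g linear_h by (simp_all add: linear_neg)

lemma stable_h: "g ` \<Psi> = \<Psi> \<Longrightarrow> \<alpha> \<in> \<Psi> \<Longrightarrow> h \<alpha> \<in> \<Psi>"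
  by (metis hg image_iff)

definition reach :: "('a \<Rightarrow> real) set \<Rightarrow> ('a \<Rightarrow> real) set \<Rightarrow> ('a \<Rightarrow> real) set set" where
  "reach \<Psi> \<Delta> = {\<Delta>'. (ascent_step g \<Psi>)\<^sup>*\<^sup>* \<Delta> \<Delta>'}"

lemma ascent_step_simple:
  assumes "root_set \<Psi>" "simple_system \<Psi> \<Delta>" "ascent_step g \<Psi> \<Delta> \<Delta>'" shows "simple_system \<Psi> \<Delta>'"
proof -
  obtain \<beta> where "\<beta> \<in> \<Delta>" "\<Delta>' = refl \<beta> ` \<Delta>" using assms(3) by (auto simp: ascent_step_def)
  moreover have "\<Delta> \<subseteq> \<Psi>" using assms(2) by (simp add: simple_system_def)
  ultimately show ?thesis using refl_simple_system[OF assms(1,2), of \<beta>] by auto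
qed

lemma reach_simple:
  assumes R: "root_set \<Psi>" and S: "simple_system \<Psi> \<Delta>" and "\<Delta>' \<in> reach \<Psi> \<Delta>" shows "simple_system \<Psi> \<Delta>'"
proof -
  have "(ascent_step g \<Psi>)\<^sup>*\<^sup>* \<Delta> \<Delta>'" using assms(3) by (simp add: reach_def)
  then show ?thesis by (induction rule: rtranclp_induct) (auto intro: S ascent_step_simple[OF R])
qed

lemma finite_reach:
  assumes R: "root_set \<Psi>" and S: "simple_system \<Psi> \<Delta>" shows "finite (reach \<Psi> \<Delta>)"
proof -
  have "reach \<Psi> \<Delta> \<subseteq> Pow \<Psi>" using reach_simple[OF R S] by (auto simp: simple_system_def)
  then show ?thesis using root_setD(1)[OF R] finite_subset by auto
qed

text \<open>
  Let \<open>v\<close> be in the closed chamber of \<open>\<Delta>\<close>, on the wall of \<open>\<beta> \<in> \<Delta>\<close>, with \<open>\<langle>A v, \<beta>\<rangle> > 0\<close>. Then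
  \<open>\<langle>v, g \<beta>\<rangle> + \<langle>v, h \<beta>\<rangle> > 0\<close>, so \<open>g \<beta>\<close> or \<open>h \<beta>\<close> is positive and crossing the wall is an ascent step; the new closed
  chamber still contains \<open>v\<close>. Each crossing removes \<open>\<beta>\<close> from the finite set of positive roots \<open>\<alpha>\<close> with
  \<open>\<langle>v, \<alpha>\<rangle> = 0 < \<langle>A v, \<alpha>\<rangle>\<close>, so the process stops, at a chamber that contains \<open>v - \<tau> A v\<close> for small \<open>\<tau> > 0\<close>.
\<close>

lemma boundary_chamber:
  assumes R: "root_set \<Psi>" and st: "g ` \<Psi> = \<Psi>" and S: "simple_system \<Psi> \<Delta>"
    and "\<And>\<gamma>. \<gamma> \<in> \<Delta> \<Longrightarrow> 0 \<le> b v \<gamma>"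
  shows "\<exists>\<Delta>'\<in>reach \<Psi> \<Delta>. \<forall>\<gamma>\<in>\<Delta>'. 0 \<le> b v \<gamma> \<and> (b v \<gamma> = 0 \<longrightarrow> b (A v) \<gamma> \<le> 0)"
  using S assms(4)
proof (induction "card {\<alpha> \<in> pos \<Psi> \<Delta>. b v \<alpha> = 0 \<and> 0 < b (A v) \<alpha>}" arbitrary: \<Delta> rule: less_induct)
  case less
  note S = less.prems(1)
  show ?case
  proof (cases "\<forall>\<gamma>\<in>\<Delta>. b v \<gamma> = 0 \<longrightarrow> b (A v) \<gamma> \<le> 0")
    case True
    then show ?thesis using less.prems(2) by (intro bexI[of _ \<Delta>]) (auto simp: reach_def)
  next
    case False
    then obtain \<beta> where \<beta>: "\<beta> \<in> \<Delta>" "b v \<beta> = 0" "0 < b (A v) \<beta>" by force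
    have \<beta>\<Psi>: "\<beta> \<in> \<Psi>" using \<beta> S by (auto simp: simple_system_def)
    note nz = root_nz[OF R \<beta>\<Psi>]
    let ?D = "refl \<beta> ` \<Delta>"
    have fin: "finite (pos \<Psi> \<Delta>)" using pos_subset root_setD(1)[OF R] by (rule finite_subset)
    have neg: "b v \<alpha> \<le> 0" if "\<alpha> \<in> \<Psi>" "\<alpha> \<notin> pos \<Psi> \<Delta>" for \<alpha>
      using pos_nonneg_pairing[of "- \<alpha>" \<Psi> \<Delta> v] less.prems(2) pos_iff_not_neg[OF R S that(1)] that(2)
      by (auto simp: b_minus)
    have "b v (g \<beta>) + b v (h \<beta>) > 0" using \<beta>(3) unfolding A_symmetric by (simp add: A_def b_simps)
    then have "b v (g \<beta>) > 0 \<or> b v (h \<beta>) > 0" by linarith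
    then have up: "g \<beta> \<in> pos \<Psi> \<Delta> \<or> h \<beta> \<in> pos \<Psi> \<Delta>"
      using neg[of "g \<beta>"] neg[of "h \<beta>"] st stable_h[OF st \<beta>\<Psi>] \<beta>\<Psi> by force
    have step: "ascent_step g \<Psi> \<Delta> ?D"
      unfolding ascent_step_def
      using descents_mono[OF R S \<beta>(1) g_minus(1) gh hg st up] \<beta>(1) by blast
    have S': "simple_system \<Psi> ?D" using refl_simple_system[OF R S \<beta>\<Psi>] .
    have v: "0 \<le> b v \<gamma>" if \<gamma>: "\<gamma> \<in> ?D" for \<gamma>
    proof -
      obtain \<gamma>' where "\<gamma> = refl \<beta> \<gamma>'" "\<gamma>' \<in> \<Delta>" using \<gamma> by auto
      then show ?thesis using less.prems(2)[of \<gamma>'] b_refl_shift[OF nz, of v \<gamma>'] refl_orthogonal[OF \<beta>(2)] by simp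
    qed
    have "{\<alpha> \<in> pos \<Psi> ?D. b v \<alpha> = 0 \<and> 0 < b (A v) \<alpha>} \<subset> {\<alpha> \<in> pos \<Psi> \<Delta>. b v \<alpha> = 0 \<and> 0 < b (A v) \<alpha>}"
    proof
      show "{\<alpha> \<in> pos \<Psi> ?D. b v \<alpha> = 0 \<and> 0 < b (A v) \<alpha>} \<subseteq> {\<alpha> \<in> pos \<Psi> \<Delta>. b v \<alpha> = 0 \<and> 0 < b (A v) \<alpha>}"
        unfolding pos_refl_simple[OF R S \<beta>(1)] using \<beta> by (auto simp: b_minus)
      have "\<beta> \<noteq> - \<beta>" using simple_pos[OF R S \<beta>(1)] pos_not_neg[OF R S] by metis
      then have "\<beta> \<notin> pos \<Psi> ?D" unfolding pos_refl_simple[OF R S \<beta>(1)] by simp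
      then show "{\<alpha> \<in> pos \<Psi> ?D. b v \<alpha> = 0 \<and> 0 < b (A v) \<alpha>} \<noteq> {\<alpha> \<in> pos \<Psi> \<Delta>. b v \<alpha> = 0 \<and> 0 < b (A v) \<alpha>}"
        using \<beta> simple_pos[OF R S \<beta>(1)] by blast
    qed
    then have "card {\<alpha> \<in> pos \<Psi> ?D. b v \<alpha> = 0 \<and> 0 < b (A v) \<alpha>} < card {\<alpha> \<in> pos \<Psi> \<Delta>. b v \<alpha> = 0 \<and> 0 < b (A v) \<alpha>}"
      using fin by (intro psubset_card_mono) auto
    then obtain \<Delta>' where \<Delta>': "\<Delta>' \<in> reach \<Psi> ?D" "\<forall>\<gamma>\<in>\<Delta>'. 0 \<le> b v \<gamma> \<and> (b v \<gamma> = 0 \<longrightarrow> b (A v) \<gamma> \<le> 0)"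
      using less.hyps[OF _ S' v] by blast
    have "\<Delta>' \<in> reach \<Psi> \<Delta>" using \<Delta>'(1) step by (auto simp: reach_def intro: converse_rtranclp_into_rtranclp)
    then show ?thesis using \<Delta>'(2) by blast
  qed
qed

definition perp :: "('a \<Rightarrow> real) set \<Rightarrow> ('a \<Rightarrow> real) set" where
  "perp \<Psi> = {n \<in> E. \<forall>\<alpha>\<in>\<Psi>. b n \<alpha> = 0}"

text \<open>
  The double orthogonal complement is the linear span of \<open>\<Psi>\<close>. In this form it is closed by definition.
\<close>

definition dperp :: "('a \<Rightarrow> real) set \<Rightarrow> ('a \<Rightarrow> real) set" where
  "dperp \<Psi> = {v \<in> E. \<forall>n\<in>perp \<Psi>. b v n = 0}"

lemma dperp_ops:
  "u \<in> dperp \<Psi> \<Longrightarrow> v \<in> dperp \<Psi> \<Longrightarrow> u + v \<in> dperp \<Psi>" "u \<in> dperp \<Psi> \<Longrightarrow> v \<in> dperp \<Psi> \<Longrightarrow> u - v \<in> dperp \<Psi>"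
  "u \<in> dperp \<Psi> \<Longrightarrow> r *\<^sub>R u \<in> dperp \<Psi>" "u \<in> dperp \<Psi> \<Longrightarrow> u \<in> E" "0 \<in> dperp \<Psi>"
  by (auto simp: dperp_def b_simps)

lemma subset_dperp: "\<Psi> \<subseteq> E \<Longrightarrow> \<Psi> \<subseteq> dperp \<Psi>"
  using b_sym by (auto simp: dperp_def perp_def)

lemma dperp_A:
  assumes st: "g ` \<Psi> = \<Psi>" and v: "v \<in> dperp \<Psi>" shows "A v \<in> dperp \<Psi>"
proof -
  have "b (A v) n = 0" if n: "n \<in> perp \<Psi>" for n
  proof -
    have "A n \<in> perp \<Psi>"
      using n st stable_h[OF st] E_A[of n] A_symmetric[of n]
      by (auto simp: perp_def A_def b_simps)
    then show ?thesis using v unfolding A_symmetric by (simp add: dperp_def)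
  qed
  then show ?thesis using v E_A[of v] by (simp add: dperp_def)
qed

lemma dperp_orthogonal:
  assumes "v \<in> dperp \<Psi>" "\<And>\<alpha>. \<alpha> \<in> \<Psi> \<Longrightarrow> b v \<alpha> = 0" shows "v = 0"
proof (rule ccontr)
  assume "v \<noteq> 0"
  moreover have "v \<in> perp \<Psi>" using assms by (simp add: perp_def dperp_def)
  then have "b v v = 0" using assms(1) by (simp add: dperp_def)
  ultimately show False using b_pos[of v] assms(1) by (simp add: dperp_def)
qed

text \<open>
  Minimise \<open>\<langle>A v, v\<rangle>\<close> over the unit sphere of the span of the roots. A vector at which \<open>\<langle>A v, v\<rangle> - l \<langle>v, v\<rangle>\<close> vanishes is
  a minimum of this nonnegative form. Moving from \<open>v\<close> along \<open>A v - l v\<close> would make the form negative unless this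
  direction is zero.
\<close>

lemma minimal_eigenvalue:
  assumes R: "root_set \<Psi>" and st: "g ` \<Psi> = \<Psi>" and ne: "\<Psi> \<noteq> {}"
  obtains l where "\<And>v. v \<in> dperp \<Psi> \<Longrightarrow> l * b v v \<le> b (A v) v"
    "\<And>v. v \<in> dperp \<Psi> \<Longrightarrow> b (A v) v = l * b v v \<Longrightarrow> A v = l *\<^sub>R v"
    "\<exists>k\<in>dperp \<Psi>. k \<noteq> 0 \<and> A k = l *\<^sub>R k"
proof -
  let ?V = "dperp \<Psi>"
  let ?X = "{v \<in> ?V. b v v = 1}"
  obtain \<alpha> where \<alpha>: "\<alpha> \<in> \<Psi>" using ne by blast
  have \<alpha>E: "\<alpha> \<in> E" "\<alpha> \<noteq> 0" using \<alpha> root_setD(2,3)[OF R] by auto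
  have \<alpha>V: "\<alpha> \<in> ?V" "0 < b \<alpha> \<alpha>"
    using \<alpha> subset_dperp[OF root_setD(2)[OF R]] b_pos[OF \<alpha>E] by auto
  have norm: "(1 / sqrt (b v v)) *\<^sub>R v \<in> ?X" if "v \<in> ?V" "b v v > 0" for v
    using that dperp_ops by (simp add: b_simps)
  have 1: "closed {v \<in> E. b v v \<in> {1}}"
    using continuous_closed_preimage[OF continuous_quadratic[OF linear_ident] closed_E, of "{1}"]
    by (simp add: vimage_def Int_def)
  have 2: "closed ?V" unfolding dperp_def by (rule closed_orth[of _ "\<lambda>_. 0"])
  have 3: "?X = {v \<in> E. b v v \<in> {1}} \<inter> ?V" using dperp_ops(4) by auto
  have cl: "closed ?X" unfolding 3 by (rule closed_Int[OF 1 2])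
  have "?X \<subseteq> E" using dperp_ops(4) by blast
  then obtain k where k: "k \<in> ?X" "\<And>u. u \<in> ?X \<Longrightarrow> b (A k) k \<le> b (A u) u"
    using attains_min[OF _ cl norm[OF \<alpha>V] linear_A, of 1] by auto
  define l where "l = b (A k) k"
  have min: "l * b v v \<le> b (A v) v" if "v \<in> ?V" for v
  proof (cases "v = 0")
    case False
    then have p: "b v v > 0" using b_pos that dperp_ops(4) by blast
    have "l \<le> b (A ((1 / sqrt (b v v)) *\<^sub>R v)) ((1 / sqrt (b v v)) *\<^sub>R v)"
      unfolding l_def by (rule k(2)[OF norm[OF that p]])
    also have "\<dots> = b (A v) v / b v v" using p by (simp add: A_simps b_simps)
    finally show ?thesis using p by (simp add: field_simps)
  qed (simp add: A_simps)
  have eig: "A v = l *\<^sub>R v" if v: "v \<in> ?V" "b (A v) v = l * b v v" for v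
  proof (rule ccontr)
    assume ne: "A v \<noteq> l *\<^sub>R v"
    define u where "u = A v - l *\<^sub>R v"
    have uV: "u \<in> ?V" unfolding u_def using dperp_A[OF st] v dperp_ops by simp
    have u0: "u \<noteq> 0" using ne by (simp add: u_def)
    have up: "b u u > 0" using b_pos[of u] uV u0 dperp_ops(4) by simp
    define c where "c = b (A u) u - l * b u u"
    have c0: "0 \<le> c" using min[OF uV] by (simp add: c_def)
    have key: "0 \<le> 2 * x * b u u + x\<^sup>2 * c" for x
    proof -
      have "v + x *\<^sub>R u \<in> ?V" using v uV dperp_ops by simp
      from min[OF this] have "0 \<le> b (A (v + x *\<^sub>R u)) (v + x *\<^sub>R u) - l * b (v + x *\<^sub>R u) (v + x *\<^sub>R u)" by simp
      also have "\<dots> = (b (A v) v - l * b v v) + 2 * x * (b (A v) u - l * b v u) + x\<^sup>2 * c"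
        using A_symmetric[of u v] b_sym[of u v] b_sym[of u "A v"] A_symmetric[of v v]
        by (simp add: A_simps b_simps c_def power2_eq_square algebra_simps)
      also have "b (A v) u - l * b v u = b u u"
        using b_sym[of v "A v"] by (simp add: u_def b_simps)
      finally show ?thesis using v(2) by simp
    qed
    \<comment> \<open>a negative \<open>x\<close> so small that the linear term dominates the quadratic one\<close>
    define x where "x = - (b u u / (c + 1))"
    have "x * (2 * b u u + x * c) = 2 * x * b u u + x\<^sup>2 * c" by (simp add: power2_eq_square algebra_simps)
    then have "0 \<le> x * (2 * b u u + x * c)" using key[of x] by simp
    moreover have "x < 0" using up c0 by (simp add: x_def)
    moreover have "2 * b u u + x * c > 0"
    proof -
      have "c / (c + 1) < 2" using c0 by (simp add: field_simps)
      then have "b u u * (c / (c + 1)) < b u u * 2" using up by (rule mult_strict_left_mono)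
      then show ?thesis by (simp add: x_def)
    qed
    ultimately show False by (simp add: mult_less_0_iff zero_le_mult_iff)
  qed
  have "k \<in> ?V" "b k k = 1" using k(1) by auto
  then have "k \<noteq> 0" "A k = l *\<^sub>R k" using eig[of k] by (auto simp: l_def)
  with \<open>k \<in> ?V\<close> show ?thesis using that min eig by blast
qed

lemma eventually_pairing_nonneg:
  assumes "finite \<Delta>" "\<And>\<gamma>. \<gamma> \<in> \<Delta> \<Longrightarrow> 0 \<le> b v \<gamma>" "\<And>\<gamma>. \<gamma> \<in> \<Delta> \<Longrightarrow> b v \<gamma> = 0 \<Longrightarrow> 0 \<le> b d \<gamma>"
  shows "\<forall>\<^sub>F \<tau> in at_right 0. \<forall>\<gamma>\<in>\<Delta>. 0 \<le> b (v + \<tau> *\<^sub>R d) \<gamma>"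
proof (rule eventually_ball_finite[OF assms(1)], rule ballI)
  fix \<gamma> assume \<gamma>: "\<gamma> \<in> \<Delta>"
  show "\<forall>\<^sub>F \<tau> in at_right 0. 0 \<le> b (v + \<tau> *\<^sub>R d) \<gamma>"
  proof (cases "b v \<gamma> = 0")
    case True
    have "\<forall>\<^sub>F \<tau>::real in at_right 0. 0 < \<tau>" by (rule eventually_at_right_less)
    then show ?thesis by eventually_elim (use True assms(3)[OF \<gamma>] in \<open>simp add: b_simps\<close>)
  next
    case False
    then have "0 < b v \<gamma>" using assms(2)[OF \<gamma>] by simp
    moreover have "((\<lambda>\<tau>. b v \<gamma> + \<tau> * b d \<gamma>) \<longlongrightarrow> b v \<gamma> + 0 * b d \<gamma>) (at_right 0)"
      by (intro tendsto_intros)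
    ultimately have "\<forall>\<^sub>F \<tau> in at_right 0. 0 < b v \<gamma> + \<tau> * b d \<gamma>"
      by (intro order_tendstoD(1)[where y = "b v \<gamma> + 0 * b d \<gamma>"]) simp_all
    then show ?thesis by eventually_elim (simp add: b_simps)
  qed
qed

text \<open>
  Among the vectors in the reachable closed chambers that have the same pairings with \<open>K\<close> as \<open>v0\<close>, take \<open>p\<close> of least norm. If
  \<open>p \<notin> K\<close>, then \<open>p + \<tau> (l p - A p)\<close> is another such vector for small \<open>\<tau> > 0\<close>, by the lemma \<open>boundary_chamber\<close> and
  because \<open>l p - A p\<close> is orthogonal to \<open>K\<close>. Its norm is smaller because \<open>\<langle>l p - A p, p\<rangle> < 0\<close>. So \<open>p\<close> is the
  orthogonal projection of \<open>v0\<close> to \<open>K\<close>.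
\<close>

lemma chamber_meets_eigenspace:
  assumes R: "root_set \<Psi>" and st: "g ` \<Psi> = \<Psi>" and S: "simple_system \<Psi> \<Delta>"
    and min: "\<And>v. v \<in> dperp \<Psi> \<Longrightarrow> l * b v v \<le> b (A v) v"
      "\<And>v. v \<in> dperp \<Psi> \<Longrightarrow> b (A v) v = l * b v v \<Longrightarrow> A v = l *\<^sub>R v"
    and K: "K = {k \<in> dperp \<Psi>. A k = l *\<^sub>R k}"
    and v0: "v0 \<in> dperp \<Psi>" "\<And>\<gamma>. \<gamma> \<in> \<Delta> \<Longrightarrow> 0 \<le> b v0 \<gamma>"
  obtains p \<Delta>' where "p \<in> K" "\<Delta>' \<in> reach \<Psi> \<Delta>" "\<And>\<gamma>. \<gamma> \<in> \<Delta>' \<Longrightarrow> 0 \<le> b p \<gamma>"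
    "\<And>k. k \<in> K \<Longrightarrow> b p k = b v0 k"
proof -
  let ?T = "reach \<Psi> \<Delta>"
  let ?C = "\<lambda>\<Delta>'. {v \<in> E. \<forall>\<gamma>\<in>\<Delta>'. 0 \<le> b v \<gamma>}"
  let ?X = "dperp \<Psi> \<inter> {v \<in> E. \<forall>k\<in>K. b v k = b v0 k} \<inter> (\<Union>\<Delta>'\<in>?T. ?C \<Delta>')"
  have "closed (dperp \<Psi>)" unfolding dperp_def by (rule closed_orth[of _ "\<lambda>_. 0"])
  then have cl: "closed ?X"
    by (intro closed_Int closed_orth closed_UN finite_reach[OF R S] ballI closed_halfspaces)
  have "\<Delta> \<in> ?T" by (simp add: reach_def)
  then have v0X: "v0 \<in> ?X" using v0 dperp_ops(4) by blast
  have sub: "?X \<subseteq> E" by blast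
  obtain p where p: "p \<in> ?X" "\<And>u. u \<in> ?X \<Longrightarrow> b p p \<le> b u u"
    using attains_min[OF sub cl v0X linear_ident, of "b v0 v0"] by auto
  then obtain \<Delta>1 where \<Delta>1: "\<Delta>1 \<in> ?T" "\<And>\<gamma>. \<gamma> \<in> \<Delta>1 \<Longrightarrow> 0 \<le> b p \<gamma>" by blast
  have pV: "p \<in> dperp \<Psi>" "p \<in> E" using p(1) by blast+
  have "A p = l *\<^sub>R p"
  proof (rule ccontr)
    assume ne: "A p \<noteq> l *\<^sub>R p"
    define d where "d = l *\<^sub>R p - A p"
    have dV: "d \<in> dperp \<Psi>" unfolding d_def using pV dperp_A[OF st] dperp_ops by simp
    have neg: "b d p < 0" using min(1)[OF pV(1)] min(2)[OF pV(1)] ne by (force simp: d_def b_simps)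
    have S1: "simple_system \<Psi> \<Delta>1" using reach_simple[OF R S \<Delta>1(1)] .
    obtain \<Delta>2 where \<Delta>2: "\<Delta>2 \<in> reach \<Psi> \<Delta>1" "\<forall>\<gamma>\<in>\<Delta>2. 0 \<le> b p \<gamma> \<and> (b p \<gamma> = 0 \<longrightarrow> b (A p) \<gamma> \<le> 0)"
      using boundary_chamber[OF R st S1 \<Delta>1(2)] by blast
    have \<Delta>2T: "\<Delta>2 \<in> ?T" using \<Delta>1(1) \<Delta>2(1) by (auto simp: reach_def)
    have "finite \<Delta>2" using simple_finite[OF R reach_simple[OF R S \<Delta>2T]] .
    then have ev1: "\<forall>\<^sub>F \<tau> in at_right 0. \<forall>\<gamma>\<in>\<Delta>2. 0 \<le> b (p + \<tau> *\<^sub>R d) \<gamma>"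
      using \<Delta>2(2) by (intro eventually_pairing_nonneg) (auto simp: d_def b_simps)
    have "((\<lambda>\<tau>. 2 * b d p + \<tau> * b d d) \<longlongrightarrow> 2 * b d p + 0 * b d d) (at_right 0)"
      by (intro tendsto_intros)
    then have ev2: "\<forall>\<^sub>F \<tau> in at_right 0. 2 * b d p + \<tau> * b d d < 0"
      using neg by (intro order_tendstoD(2)[where y = "2 * b d p + 0 * b d d"]) simp_all
    have "\<forall>\<^sub>F \<tau>::real in at_right 0. 0 < \<tau>" by (rule eventually_at_right_less)
    with ev1 ev2 have "\<forall>\<^sub>F \<tau> in at_right 0. 0 < \<tau> \<and> 2 * b d p + \<tau> * b d d < 0 \<and> (\<forall>\<gamma>\<in>\<Delta>2. 0 \<le> b (p + \<tau> *\<^sub>R d) \<gamma>)"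
      by eventually_elim simp
    then obtain \<tau> where \<tau>: "0 < \<tau>" "2 * b d p + \<tau> * b d d < 0" "\<forall>\<gamma>\<in>\<Delta>2. 0 \<le> b (p + \<tau> *\<^sub>R d) \<gamma>"
      using eventually_happens[of _ "at_right (0::real)"] trivial_limit_at_right_real by blast
    have "b d k = 0" if "k \<in> K" for k
      using that unfolding K d_def by (simp add: b_simps A_symmetric)
    moreover have pd: "p + \<tau> *\<^sub>R d \<in> dperp \<Psi>" using pV(1) dV by (intro dperp_ops)
    moreover have "p + \<tau> *\<^sub>R d \<in> E" using dperp_ops(4)[OF pd] .
    ultimately have "p + \<tau> *\<^sub>R d \<in> ?X"
      using p(1) \<tau>(3) \<Delta>2T by (auto simp: b_simps)
    then have "b p p \<le> b (p + \<tau> *\<^sub>R d) (p + \<tau> *\<^sub>R d)" by (rule p(2))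
    also have "\<dots> = b p p + \<tau> * (2 * b d p + \<tau> * b d d)"
      using b_sym[of p d] by (simp add: b_simps algebra_simps)
    finally have "0 \<le> \<tau> * (2 * b d p + \<tau> * b d d)" by simp
    then show False using \<tau>(1,2) by (simp add: zero_le_mult_iff)
  qed
  then have "p \<in> K" using pV K by simp
  moreover have "b p k = b v0 k" if "k \<in> K" for k using p(1) that by blast
  ultimately show ?thesis using that \<Delta>1 by blast
qed

end


section \<open>Reaching the maximal number of descents\<close>

context euclidean_isometry
begin

text \<open>
  A discrete Sturm separation principle. The points \<open>(x, y)\<close> along an orbit of \<open>f\<close> turn around the origin in the
  direction given by the sign of the conserved Wronskian, by less than a half turn each time. Per full turn each
  coordinate changes from positive to negative once. Accordingly the difference of the two indicators telescopes:
  up to sign, it is the change of the indicator of one quadrant. If the Wronskian vanishes, \<open>x\<close> and \<open>y\<close> are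
  proportional along the orbit; the difference is zero or the change of the sign of \<open>x\<close>.
\<close>

lemma sign_change_balance:
  fixes x y :: "'r \<Rightarrow> real"
  assumes fin: "finite \<Psi>" and bij: "bij_betw f \<Psi> \<Psi>"
    and nz: "\<And>\<alpha>. \<alpha> \<in> \<Psi> \<Longrightarrow> x \<alpha> \<noteq> 0 \<and> y \<alpha> \<noteq> 0"
    and wronskian: "\<And>\<alpha>. \<alpha> \<in> \<Psi> \<Longrightarrow> x (f \<alpha>) * y (f (f \<alpha>)) - x (f (f \<alpha>)) * y (f \<alpha>) = x \<alpha> * y (f \<alpha>) - x (f \<alpha>) * y \<alpha>"
  shows "card {\<alpha> \<in> \<Psi>. 0 < x \<alpha> \<and> x (f \<alpha>) < 0} = card {\<alpha> \<in> \<Psi>. 0 < y \<alpha> \<and> y (f \<alpha>) < 0}"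
proof -
  define D where "D \<alpha> = x \<alpha> * y (f \<alpha>) - x (f \<alpha>) * y \<alpha>" for \<alpha>
  \<comment> \<open>which quadrant is used depends on the direction of rotation\<close>
  define \<phi> :: "'r \<Rightarrow> int" where "\<phi> \<alpha> =
      (if 0 < D \<alpha> then of_bool (x \<alpha> < 0 \<and> 0 < y \<alpha>)
       else if D \<alpha> < 0 then - of_bool (0 < x \<alpha> \<and> y \<alpha> < 0)
       else if x \<alpha> * y \<alpha> < 0 then - of_bool (0 < x \<alpha>) else 0)" for \<alpha>
  have fin': "f \<alpha> \<in> \<Psi>" if "\<alpha> \<in> \<Psi>" for \<alpha> using bij that by (auto simp: bij_betw_def)
  have step: "of_bool (0 < x \<alpha> \<and> x (f \<alpha>) < 0) - of_bool (0 < y \<alpha> \<and> y (f \<alpha>) < 0) = \<phi> (f \<alpha>) - \<phi> \<alpha>"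
    if \<alpha>: "\<alpha> \<in> \<Psi>" for \<alpha>
  proof -
    note n = nz[OF \<alpha>] nz[OF fin'[OF \<alpha>]]
    have D: "D (f \<alpha>) = D \<alpha>" using wronskian[OF \<alpha>] by (simp add: D_def)
    have neg: "x \<alpha> < 0 \<longleftrightarrow> \<not> 0 < x \<alpha>" "y \<alpha> < 0 \<longleftrightarrow> \<not> 0 < y \<alpha>"
      "x (f \<alpha>) < 0 \<longleftrightarrow> \<not> 0 < x (f \<alpha>)" "y (f \<alpha>) < 0 \<longleftrightarrow> \<not> 0 < y (f \<alpha>)"
      using n by linarith+
    have D\<alpha>: "D \<alpha> = x \<alpha> * y (f \<alpha>) - x (f \<alpha>) * y \<alpha>" by (simp add: D_def)
    have sgn: "u * v < 0 \<longleftrightarrow> (0 < u) \<noteq> (0 < v)" "0 < u * v \<longleftrightarrow> (0 < u) = (0 < v)"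
      if "u \<noteq> 0" "v \<noteq> 0" for u v :: real
      using that by (auto simp: mult_less_0_iff zero_less_mult_iff)
    have s: "x \<alpha> * y (f \<alpha>) < 0 \<longleftrightarrow> (0 < x \<alpha>) \<noteq> (0 < y (f \<alpha>))" "0 < x \<alpha> * y (f \<alpha>) \<longleftrightarrow> (0 < x \<alpha>) = (0 < y (f \<alpha>))"
      "x (f \<alpha>) * y \<alpha> < 0 \<longleftrightarrow> (0 < x (f \<alpha>)) \<noteq> (0 < y \<alpha>)" "0 < x (f \<alpha>) * y \<alpha> \<longleftrightarrow> (0 < x (f \<alpha>)) = (0 < y \<alpha>)"
      "x \<alpha> * y \<alpha> < 0 \<longleftrightarrow> (0 < x \<alpha>) \<noteq> (0 < y \<alpha>)" "x (f \<alpha>) * y (f \<alpha>) < 0 \<longleftrightarrow> (0 < x (f \<alpha>)) \<noteq> (0 < y (f \<alpha>))"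
      using n by (simp_all add: sgn)
    consider "0 < D \<alpha>" | "D \<alpha> < 0" | "D \<alpha> = 0" by linarith
    then show ?thesis
    proof cases
      case 1
      then have "\<not> (x \<alpha> * y (f \<alpha>) < 0 \<and> 0 < x (f \<alpha>) * y \<alpha>)" using D\<alpha> by linarith
      then show ?thesis unfolding \<phi>_def D neg s using 1
        by (cases "0 < x \<alpha>"; cases "0 < y \<alpha>"; cases "0 < x (f \<alpha>)"; cases "0 < y (f \<alpha>)"; simp)
    next
      case 2
      then have "\<not> (0 < x \<alpha> * y (f \<alpha>) \<and> x (f \<alpha>) * y \<alpha> < 0)" using D\<alpha> by linarith
      then show ?thesis unfolding \<phi>_def D neg s using 2
        by (cases "0 < x \<alpha>"; cases "0 < y \<alpha>"; cases "0 < x (f \<alpha>)"; cases "0 < y (f \<alpha>)"; simp)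
    next
      case 3
      then have eq: "x \<alpha> * y (f \<alpha>) = x (f \<alpha>) * y \<alpha>" using D\<alpha> by linarith
      then have "0 < x \<alpha> * y (f \<alpha>) \<longleftrightarrow> 0 < x (f \<alpha>) * y \<alpha>" by simp
      then show ?thesis unfolding \<phi>_def D neg s using 3
        by (cases "0 < x \<alpha>"; cases "0 < y \<alpha>"; cases "0 < x (f \<alpha>)"; cases "0 < y (f \<alpha>)"; simp)
    qed
  qed
  have "int (card {\<alpha> \<in> \<Psi>. 0 < x \<alpha> \<and> x (f \<alpha>) < 0}) - int (card {\<alpha> \<in> \<Psi>. 0 < y \<alpha> \<and> y (f \<alpha>) < 0})
      = (\<Sum>\<alpha>\<in>\<Psi>. of_bool (0 < x \<alpha> \<and> x (f \<alpha>) < 0) - of_bool (0 < y \<alpha> \<and> y (f \<alpha>) < 0))"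
    using fin by (simp add: sum_subtractf Int_def conj_commute)
  also have "\<dots> = (\<Sum>\<alpha>\<in>\<Psi>. \<phi> (f \<alpha>)) - (\<Sum>\<alpha>\<in>\<Psi>. \<phi> \<alpha>)"
    by (simp add: step sum_subtractf)
  also have "(\<Sum>\<alpha>\<in>\<Psi>. \<phi> (f \<alpha>)) = (\<Sum>\<alpha>\<in>\<Psi>. \<phi> \<alpha>)"
    by (rule sum.reindex_bij_betw[OF bij])
  finally show ?thesis by simp
qed

text \<open>
  On an eigenvector \<open>v\<close> of \<open>g + h\<close>, the pairings with the roots \<open>\<alpha>, g \<alpha>, g\<^sup>2 \<alpha>, \<dots>\<close> satisfy the recurrence
  \<open>x\<^bsub>k+1\<^esub> + x\<^bsub>k-1\<^esub> = l x\<^sub>k\<close>, and two solutions of it have a constant Wronskian.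
\<close>

lemma crossing_count_constant:
  assumes fin: "finite \<Psi>" and st: "g ` \<Psi> = \<Psi>"
    and v: "A v = l *\<^sub>R v" "\<And>\<alpha>. \<alpha> \<in> \<Psi> \<Longrightarrow> b v \<alpha> \<noteq> 0"
    and w: "A w = l *\<^sub>R w" "\<And>\<alpha>. \<alpha> \<in> \<Psi> \<Longrightarrow> b w \<alpha> \<noteq> 0"
  shows "card {\<alpha> \<in> \<Psi>. 0 < b v \<alpha> \<and> b v (g \<alpha>) < 0} = card {\<alpha> \<in> \<Psi>. 0 < b w \<alpha> \<and> b w (g \<alpha>) < 0}"
proof (rule sign_change_balance[OF fin])
  have "inj_on g \<Psi>" by (metis hg inj_onI)
  then show "bij_betw g \<Psi> \<Psi>" using st by (simp add: bij_betw_def)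
  fix \<alpha> assume \<alpha>: "\<alpha> \<in> \<Psi>"
  show "b v \<alpha> \<noteq> 0 \<and> b w \<alpha> \<noteq> 0" using v w \<alpha> by blast
  have rec: "b u (g (g \<alpha>)) = l * b u (g \<alpha>) - b u \<alpha>" if "A u = l *\<^sub>R u" for u
  proof -
    have "b u (g (g \<alpha>)) + b u \<alpha> = b u (A (g \<alpha>))" by (simp add: A_def b_simps)
    also have "\<dots> = l * b u (g \<alpha>)" unfolding A_symmetric[symmetric] that by (simp add: b_simps)
    finally show ?thesis by simp
  qed
  show "b v (g \<alpha>) * b w (g (g \<alpha>)) - b v (g (g \<alpha>)) * b w (g \<alpha>) = b v \<alpha> * b w (g \<alpha>) - b v (g \<alpha>) * b w \<alpha>"
    unfolding rec[OF v(1)] rec[OF w(1)] by (simp add: algebra_simps)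
qed

lemma finite_roots: "finite {x. c + x * d = 0}" if "c \<noteq> 0 \<or> d \<noteq> 0" for c d :: real
proof (cases "d = 0")
  case False
  have "{x. c + x * d = 0} \<subseteq> {- c / d}" using False by (auto simp: field_simps)
  then show ?thesis by (rule finite_subset) simp
qed (use that in auto)

text \<open>
  Proceed one condition at a time: if \<open>k\<close> satisfies the new condition, then so does \<open>q + x k\<close> for all but one \<open>x\<close>,
  and each old condition also excludes at most one \<open>x\<close>.
\<close>

lemma generic_vector:
  assumes "finite F" and K: "0 \<in> K" "\<And>u v r. u \<in> K \<Longrightarrow> v \<in> K \<Longrightarrow> u + r *\<^sub>R v \<in> K"
    and "\<And>\<alpha>. \<alpha> \<in> F \<Longrightarrow> \<exists>k\<in>K. b k \<alpha> \<noteq> 0"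
  shows "\<exists>q\<in>K. \<forall>\<alpha>\<in>F. b q \<alpha> \<noteq> 0"
  using assms(1,4)
proof (induction F rule: finite_induct)
  case empty
  then show ?case using K(1) by blast
next
  case (insert \<alpha> F)
  then obtain q k where q: "q \<in> K" "\<forall>\<beta>\<in>F. b q \<beta> \<noteq> 0" and k: "k \<in> K" "b k \<alpha> \<noteq> 0" by blast
  have "finite (\<Union>\<beta>\<in>insert \<alpha> F. {x. b q \<beta> + x * b k \<beta> = 0})"
    using insert.hyps(1) q k by (intro finite_UN_I finite_roots) auto
  then obtain x where "x \<notin> (\<Union>\<beta>\<in>insert \<alpha> F. {x. b q \<beta> + x * b k \<beta> = 0})"
    using ex_new_if_finite[OF infinite_UNIV_char_0] by blast
  then have "\<forall>\<beta>\<in>insert \<alpha> F. b (q + x *\<^sub>R k) \<beta> \<noteq> 0" by (auto simp: b_simps)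
  then show ?case using K(2)[OF q(1) k(1)] by blast
qed

text \<open>
  The sum \<open>r\<close> of the positive roots satisfies \<open>refl \<beta> r = r - 2 \<beta>\<close> for simple \<open>\<beta>\<close>, whence \<open>\<langle>r, \<beta>\<rangle> = \<langle>\<beta>, \<beta>\<rangle>\<close>.
\<close>

lemma interior_vector:
  assumes R: "root_set \<Psi>" and S: "simple_system \<Psi> \<Delta>"
  obtains r where "r \<in> dperp \<Psi>" "\<And>\<gamma>. \<gamma> \<in> \<Delta> \<Longrightarrow> 0 < b r \<gamma>"
proof -
  let ?P = "pos \<Psi> \<Delta>"
  define r where "r = \<Sum>?P"
  have fin: "finite ?P" using pos_subset root_setD(1)[OF R] by (rule finite_subset)
  have sumP: "\<Sum>B \<in> dperp \<Psi>" if "B \<subseteq> \<Psi>" for B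
  proof -
    have "x \<in> dperp \<Psi>" if "x \<in> B" for x using that \<open>B \<subseteq> \<Psi>\<close> subset_dperp[OF root_setD(2)[OF R]] by blast
    then show ?thesis by (induction B rule: infinite_finite_induct) (auto intro: dperp_ops)
  qed
  have "0 < b r \<beta>" if \<beta>: "\<beta> \<in> \<Delta>" for \<beta>
  proof -
    have \<beta>\<Psi>: "\<beta> \<in> \<Psi>" using \<beta> S by (auto simp: simple_system_def)
    note nz = root_nz[OF R \<beta>\<Psi>]
    have \<beta>P: "\<beta> \<in> ?P" using simple_pos[OF R S \<beta>] .
    have m: "- \<beta> \<notin> ?P" using pos_not_neg[OF R S \<beta>P] .
    have "refl \<beta> r = \<Sum>(refl \<beta> ` ?P)"
      unfolding r_def linear_sum[OF linear_refl] using inj_on_subset[OF inj_refl[OF nz] subset_UNIV]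
      by (simp add: sum.reindex)
    also have "refl \<beta> ` ?P = insert (- \<beta>) (?P - {\<beta>})"
      using pos_refl_image[OF R S \<beta>\<Psi>] pos_refl_simple[OF R S \<beta>] by simp
    also have "\<Sum>\<dots> = r - 2 *\<^sub>R \<beta>"
      using fin m \<beta>P by (simp add: r_def sum_diff1 scaleR_2)
    finally have "refl \<beta> r = r - 2 *\<^sub>R \<beta>" .
    then have "- b r \<beta> = b r \<beta> - 2 * b \<beta> \<beta>" using b_refl_beta[OF nz, of r] by (simp add: b_simps)
    moreover have "0 < b \<beta> \<beta>" using \<beta>\<Psi> root_setD(2,3)[OF R] b_pos by (metis subsetD)
    ultimately show ?thesis by simp
  qed
  then show ?thesis using that[of r] sumP[OF pos_subset] by (simp add: r_def)
qed

lemma dperp_stable: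
  assumes st: "g ` \<Psi> = \<Psi>" and v: "v \<in> dperp \<Psi>" shows "g v \<in> dperp \<Psi>" "h v \<in> dperp \<Psi>"
proof -
  have "g n \<in> perp \<Psi>" "h n \<in> perp \<Psi>" if "n \<in> perp \<Psi>" for n
    using that st stable_h[OF st] E_g E_h by (auto simp: perp_def adjoint adjoint')
  then show "g v \<in> dperp \<Psi>" "h v \<in> dperp \<Psi>"
    using v E_g E_h by (simp_all add: dperp_def adjoint adjoint')
qed

text \<open>
  A reflection in a root orthogonal to \<open>v\<close> fixes \<open>v\<close> and permutes the roots that are positive on \<open>v\<close>. So moves inside
  the subsystem orthogonal to \<open>v\<close> extend to the whole system, and the descents outside the subsystem are
  determined by \<open>v\<close> alone.
\<close>

lemma ascent_lift:
  assumes R: "root_set \<Psi>" and S: "simple_system \<Psi> \<Delta>" and v: "\<And>\<gamma>. \<gamma> \<in> \<Delta> \<Longrightarrow> 0 \<le> b v \<gamma>"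
    and \<Psi>': "\<Psi>' = {\<alpha> \<in> \<Psi>. b v \<alpha> = 0}" and st: "g ` \<Psi> = \<Psi>" "g ` \<Psi>' = \<Psi>'"
    and reach: "D \<in> reach \<Psi>' (\<Delta> \<inter> \<Psi>')"
  obtains \<Delta>' where "\<Delta>' \<in> reach \<Psi> \<Delta>" "\<And>\<gamma>. \<gamma> \<in> \<Delta>' \<Longrightarrow> 0 \<le> b v \<gamma>" "\<Delta>' \<inter> \<Psi>' = D"
    "descents g \<Psi> \<Delta>' = descents g \<Psi>' D + card {\<alpha> \<in> \<Psi> - \<Psi>'. 0 < b v \<alpha> \<and> b v (g \<alpha>) < 0}"
proof -
  let ?c = "card {\<alpha> \<in> \<Psi> - \<Psi>'. 0 < b v \<alpha> \<and> b v (g \<alpha>) < 0}"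
  have count: "descents g \<Psi> \<Delta>' = descents g \<Psi>' (\<Delta>' \<inter> \<Psi>') + ?c"
    if S: "simple_system \<Psi> \<Delta>'" and v: "\<And>\<gamma>. \<gamma> \<in> \<Delta>' \<Longrightarrow> 0 \<le> b v \<gamma>" for \<Delta>'
  proof -
    have P: "pos \<Psi>' (\<Delta>' \<inter> \<Psi>') = pos \<Psi> \<Delta>' \<inter> \<Psi>'" using R S v \<Psi>' by (rule pos_restrict)
    have P2: "\<alpha> \<in> pos \<Psi> \<Delta>' \<longleftrightarrow> 0 < b v \<alpha>" if \<alpha>: "\<alpha> \<in> \<Psi> - \<Psi>'" for \<alpha>
    proof -
      have "b v \<alpha> \<noteq> 0" using \<alpha> \<Psi>' by blast
      moreover have "\<alpha> \<in> pos \<Psi> \<Delta>' \<Longrightarrow> 0 \<le> b v \<alpha>" "- \<alpha> \<in> pos \<Psi> \<Delta>' \<Longrightarrow> 0 \<le> b v (- \<alpha>)"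
        using pos_nonneg_pairing v by blast+
      ultimately show ?thesis using S \<alpha> by (auto simp: simple_system_def b_minus)
    qed
    have g\<Psi>: "g \<alpha> \<in> \<Psi>' \<longleftrightarrow> \<alpha> \<in> \<Psi>'" "\<alpha> \<in> \<Psi> \<Longrightarrow> g \<alpha> \<in> \<Psi>" for \<alpha>
      using st hg by (metis image_iff)+
    have gneg: "b v (g \<alpha>) < 0 \<longleftrightarrow> g \<alpha> \<notin> pos \<Psi> \<Delta>'" if \<alpha>: "\<alpha> \<in> \<Psi> - \<Psi>'" for \<alpha>
    proof -
      have "g \<alpha> \<in> \<Psi> - \<Psi>'" using \<alpha> g\<Psi> by blast
      then show ?thesis using P2[of "g \<alpha>"] \<Psi>' by force
    qed
    have "{\<alpha> \<in> pos \<Psi> \<Delta>'. g \<alpha> \<notin> pos \<Psi> \<Delta>'} =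
        {\<alpha> \<in> pos \<Psi>' (\<Delta>' \<inter> \<Psi>'). g \<alpha> \<notin> pos \<Psi>' (\<Delta>' \<inter> \<Psi>')} \<union> {\<alpha> \<in> \<Psi> - \<Psi>'. 0 < b v \<alpha> \<and> b v (g \<alpha>) < 0}"
      unfolding P using P2 gneg g\<Psi> pos_subset[of \<Psi> \<Delta>'] by blast
    moreover have "finite \<Psi>" using root_setD(1)[OF R] .
    then have "finite (pos \<Psi> \<Delta>')" using pos_subset by (rule rev_finite_subset)
    ultimately show ?thesis
      unfolding descents_def using \<open>finite \<Psi>\<close> by (simp only:) (rule card_Un_disjoint, auto simp: P)
  qed
  have "(ascent_step g \<Psi>')\<^sup>*\<^sup>* (\<Delta> \<inter> \<Psi>') D" using reach by (simp add: reach_def)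
  then have "\<exists>\<Delta>'\<in>reach \<Psi> \<Delta>. (\<forall>\<gamma>\<in>\<Delta>'. 0 \<le> b v \<gamma>) \<and> \<Delta>' \<inter> \<Psi>' = D"
  proof (induction rule: rtranclp_induct)
    case base
    then show ?case using v by (intro bexI[of _ \<Delta>]) (auto simp: reach_def)
  next
    case (step D D')
    then obtain \<Delta>' where \<Delta>': "\<Delta>' \<in> reach \<Psi> \<Delta>" "\<And>\<gamma>. \<gamma> \<in> \<Delta>' \<Longrightarrow> 0 \<le> b v \<gamma>" "\<Delta>' \<inter> \<Psi>' = D" by blast
    obtain \<beta> where \<beta>: "\<beta> \<in> D" "D' = refl \<beta> ` D" "descents g \<Psi>' D \<le> descents g \<Psi>' D'"
      using step.hyps(2) by (auto simp: ascent_step_def)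
    have \<beta>': "\<beta> \<in> \<Delta>'" "\<beta> \<in> \<Psi>" "b v \<beta> = 0" using \<beta>(1) \<Delta>'(3) \<Psi>' by auto
    note nz = root_nz[OF R \<beta>'(2)]
    let ?E = "refl \<beta> ` \<Delta>'"
    have S1: "simple_system \<Psi> \<Delta>'" using reach_simple[OF R S \<Delta>'(1)] .
    have S2: "simple_system \<Psi> ?E" using refl_simple_system[OF R S1 \<beta>'(2)] .
    have bv: "b v (refl \<beta> \<gamma>) = b v \<gamma>" for \<gamma>
      using b_refl_shift[OF nz, of v \<gamma>] refl_orthogonal[OF \<beta>'(3)] by simp
    have v2: "0 \<le> b v \<gamma>" if "\<gamma> \<in> ?E" for \<gamma> using that \<Delta>'(2) bv by auto
    have "refl \<beta> \<gamma> \<in> \<Psi>' \<longleftrightarrow> \<gamma> \<in> \<Psi>'" for \<gamma>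
      unfolding \<Psi>' using bv root_setD(4)[OF R _ \<beta>'(2)] refl_refl[OF nz] by (metis (no_types, lifting) mem_Collect_eq)
    then have int: "?E \<inter> \<Psi>' = D'" unfolding \<beta>(2) \<Delta>'(3)[symmetric] by blast
    have "descents g \<Psi> \<Delta>' \<le> descents g \<Psi> ?E"
      using count[OF S1 \<Delta>'(2)] count[OF S2 v2] int \<Delta>'(3) \<beta>(3) by simp
    then have "ascent_step g \<Psi> \<Delta>' ?E" using \<beta>'(1) by (auto simp: ascent_step_def)
    then have "?E \<in> reach \<Psi> \<Delta>" using \<Delta>'(1) by (auto simp: reach_def)
    then show ?case using v2 int by blast
  qed
  then obtain \<Delta>' where \<Delta>': "\<Delta>' \<in> reach \<Psi> \<Delta>" "\<And>\<gamma>. \<gamma> \<in> \<Delta>' \<Longrightarrow> 0 \<le> b v \<gamma>" "\<Delta>' \<inter> \<Psi>' = D" by blast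
  then show ?thesis using that count[OF reach_simple[OF R S \<Delta>'(1)] \<Delta>'(2)] by simp
qed

text \<open>
  Since \<open>M\<close> does not depend on \<open>\<Delta>\<close> and ascent steps do not decrease the number of descents, \<open>M\<close> is the maximum
  of that number over all simple systems. The subsystem \<open>\<Psi>'\<close> of roots orthogonal to the lowest eigenspace \<open>K\<close> is
  smaller than \<open>\<Psi>\<close> because a nonzero vector in the span of the roots cannot be orthogonal to all of them.
\<close>

theorem reach_maximal_descents:
  assumes "root_set \<Psi>" "g ` \<Psi> = \<Psi>"
  shows "\<exists>M. \<forall>\<Delta>. simple_system \<Psi> \<Delta> \<longrightarrow> (\<exists>\<Delta>'\<in>reach \<Psi> \<Delta>. descents g \<Psi> \<Delta>' = M)"
  using assms
proof (induction "card \<Psi>" arbitrary: \<Psi> rule: less_induct)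
  case less
  note R = less.prems(1) and st = less.prems(2)
  show ?case
  proof (cases "\<Psi> = {}")
    case True
    then have "descents g \<Psi> \<Delta> = 0" for \<Delta> by (simp add: descents_def pos_def)
    then show ?thesis by (auto simp: reach_def)
  next
    case ne: False
    obtain l where min: "\<And>v. v \<in> dperp \<Psi> \<Longrightarrow> l * b v v \<le> b (A v) v"
      "\<And>v. v \<in> dperp \<Psi> \<Longrightarrow> b (A v) v = l * b v v \<Longrightarrow> A v = l *\<^sub>R v"
      and ex: "\<exists>k\<in>dperp \<Psi>. k \<noteq> 0 \<and> A k = l *\<^sub>R k"
      using minimal_eigenvalue[OF R st ne] by blast
    define K where "K = {k \<in> dperp \<Psi>. A k = l *\<^sub>R k}"
    define \<Psi>' where "\<Psi>' = {\<alpha> \<in> \<Psi>. \<forall>k\<in>K. b \<alpha> k = 0}"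
    have K0: "0 \<in> K" using dperp_ops A_simps(2)[of 0 0] by (simp add: K_def)
    have Kadd: "u + r *\<^sub>R v \<in> K" if "u \<in> K" "v \<in> K" for u v r
      using that dperp_ops by (simp add: K_def A_simps scaleR_add_right mult.commute)
    have finR: "finite \<Psi>" using root_setD(1)[OF R] .
    have R': "root_set \<Psi>'" unfolding \<Psi>'_def by (rule root_set_restrict[OF R])
    have "\<Psi>' \<noteq> \<Psi>"
    proof
      assume eq: "\<Psi>' = \<Psi>"
      obtain k where k: "k \<in> K" "k \<noteq> 0" using ex by (auto simp: K_def)
      have "b k \<alpha> = 0" if "\<alpha> \<in> \<Psi>" for \<alpha> 
      proof -
        have "\<alpha> \<in> \<Psi>'" using that eq by simp
        then show ?thesis using k(1) b_sym[of k \<alpha>] by (simp add: \<Psi>'_def)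
      qed
      then show False using dperp_orthogonal[of k \<Psi>] k by (simp add: K_def)
    qed
    then have "\<Psi>' \<subset> \<Psi>" by (auto simp: \<Psi>'_def)
    then have card: "card \<Psi>' < card \<Psi>" using finR by (rule psubset_card_mono[rotated])
    have gK: "g k \<in> K" "h k \<in> K" if "k \<in> K" for k
    proof -
      have "A (g k) = g (A k)" "A (h k) = h (A k)"
        using linear_g linear_h by (simp_all add: A_def linear_add add.commute)
      then show "g k \<in> K" "h k \<in> K"
        using that dperp_stable[OF st] linear_g linear_h by (simp_all add: K_def linear_scale)
    qed
    have "g \<alpha> \<in> \<Psi>'" "h \<alpha> \<in> \<Psi>'" if "\<alpha> \<in> \<Psi>'" for \<alpha>
      using that gK st stable_h[OF st] by (auto simp: \<Psi>'_def adjoint adjoint')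
    then have st': "g ` \<Psi>' = \<Psi>'" by (metis (no_types, lifting) gh image_eqI image_subsetI subsetI subset_antisym)
    obtain M' where M': "\<And>\<Delta>. simple_system \<Psi>' \<Delta> \<Longrightarrow> \<exists>\<Delta>'\<in>reach \<Psi>' \<Delta>. descents g \<Psi>' \<Delta>' = M'"
      using less.hyps[OF card R' st'] by blast
    have "\<exists>k\<in>K. b k \<alpha> \<noteq> 0" if "\<alpha> \<in> \<Psi> - \<Psi>'" for \<alpha>
      using that b_sym[of \<alpha>] by (auto simp: \<Psi>'_def)
    then obtain q where q: "q \<in> K" "\<And>\<alpha>. \<alpha> \<in> \<Psi> - \<Psi>' \<Longrightarrow> b q \<alpha> \<noteq> 0"
      using generic_vector[of "\<Psi> - \<Psi>'" K] finR K0 Kadd by blast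
    define M where "M = M' + card {\<alpha> \<in> \<Psi> - \<Psi>'. 0 < b q \<alpha> \<and> b q (g \<alpha>) < 0}"
    have "\<exists>\<Delta>'\<in>reach \<Psi> \<Delta>. descents g \<Psi> \<Delta>' = M" if S: "simple_system \<Psi> \<Delta>" for \<Delta>
    proof -
      obtain r where r: "r \<in> dperp \<Psi>" "\<And>\<gamma>. \<gamma> \<in> \<Delta> \<Longrightarrow> 0 < b r \<gamma>" using interior_vector[OF R S] by metis
      obtain p0 where p0: "p0 \<in> K" "\<And>k. k \<in> K \<Longrightarrow> b p0 k = b r k"
        using chamber_meets_eigenspace[OF R st S min K_def r(1)] r(2) less_imp_le by metis
      \<comment> \<open>perturb \<open>r\<close> by a small multiple of \<open>q\<close>: its projection \<open>p0 + x q\<close> to \<open>K\<close> becomes generic\<close>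
      have "\<forall>\<^sub>F x in at_right 0. \<forall>\<gamma>\<in>\<Delta>. 0 \<le> b (r + x *\<^sub>R q) \<gamma>"
      proof (rule eventually_pairing_nonneg[OF simple_finite[OF R S]])
        show "0 \<le> b r \<gamma>" if "\<gamma> \<in> \<Delta>" for \<gamma> using r(2)[OF that] by simp
        show "0 \<le> b q \<gamma>" if "\<gamma> \<in> \<Delta>" "b r \<gamma> = 0" for \<gamma> using r(2)[OF that(1)] that(2) by simp
      qed
      moreover have "\<forall>\<^sub>F x in at_right 0. \<forall>\<alpha>\<in>\<Psi> - \<Psi>'. b p0 \<alpha> + x * b q \<alpha> \<noteq> 0"
      proof (rule eventually_ball_finite, use finR in simp, rule ballI)
        fix \<alpha> assume \<alpha>: "\<alpha> \<in> \<Psi> - \<Psi>'"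
        show "\<forall>\<^sub>F x in at_right 0. b p0 \<alpha> + x * b q \<alpha> \<noteq> 0"
        proof (cases "b p0 \<alpha> = 0")
          case True
          have "\<forall>\<^sub>F x::real in at_right 0. 0 < x" by (rule eventually_at_right_less)
          then show ?thesis by eventually_elim (use True q(2)[OF \<alpha>] in simp)
        next
          case False
          have "((\<lambda>x. b p0 \<alpha> + x * b q \<alpha>) \<longlongrightarrow> b p0 \<alpha> + 0 * b q \<alpha>) (at_right 0)"
            by (intro tendsto_intros)
          then show ?thesis by (rule tendsto_imp_eventually_ne) (use False in simp)
        qed
      qed
      ultimately have "\<forall>\<^sub>F x in at_right 0. (\<forall>\<gamma>\<in>\<Delta>. 0 \<le> b (r + x *\<^sub>R q) \<gamma>) \<and> (\<forall>\<alpha>\<in>\<Psi> - \<Psi>'. b p0 \<alpha> + x * b q \<alpha> \<noteq> 0)"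
        by eventually_elim simp
      then obtain x where x: "\<And>\<gamma>. \<gamma> \<in> \<Delta> \<Longrightarrow> 0 \<le> b (r + x *\<^sub>R q) \<gamma>" "\<And>\<alpha>. \<alpha> \<in> \<Psi> - \<Psi>' \<Longrightarrow> b p0 \<alpha> + x * b q \<alpha> \<noteq> 0"
        using eventually_happens[of _ "at_right (0::real)"] trivial_limit_at_right_real by blast
      have "r + x *\<^sub>R q \<in> dperp \<Psi>" using r(1) q(1) dperp_ops by (simp add: K_def)
      then obtain p \<Delta>1 where p: "p \<in> K" "\<Delta>1 \<in> reach \<Psi> \<Delta>" "\<And>\<gamma>. \<gamma> \<in> \<Delta>1 \<Longrightarrow> 0 \<le> b p \<gamma>"
        "\<And>k. k \<in> K \<Longrightarrow> b p k = b (r + x *\<^sub>R q) k"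
        using chamber_meets_eigenspace[OF R st S min K_def _ x(1)] by metis
      have "p = p0 + x *\<^sub>R q"
      proof -
        define e where "e = p - (p0 + x *\<^sub>R q)"
        have "e = p + (-1) *\<^sub>R (p0 + x *\<^sub>R q)" by (simp add: e_def)
        then have eK: "e \<in> K" using Kadd[OF p(1) Kadd[OF p0(1) q(1)], of "-1" x] by simp
        have "b e w = b p w - (b p0 w + x * b q w)" for w by (simp add: e_def b_simps)
        then have "b e e = b p e - (b p0 e + x * b q e)" .
        also have "\<dots> = 0" using p(4)[OF eK] p0(2)[OF eK] by (simp add: b_simps)
        finally have "e = 0" using b_pos[of e] eK dperp_ops(4) by (force simp: K_def)
        then show ?thesis by (simp add: e_def)
      qed
      then have reg: "b p \<alpha> \<noteq> 0" if "\<alpha> \<in> \<Psi> - \<Psi>'" for \<alpha> using x(2)[OF that] by (simp add: b_simps)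
      have \<Psi>'p: "\<Psi>' = {\<alpha> \<in> \<Psi>. b p \<alpha> = 0}"
        using reg p(1) b_sym[of p] by (auto simp: \<Psi>'_def)
      have S1: "simple_system \<Psi> \<Delta>1" using reach_simple[OF R S p(2)] .
      have "simple_system \<Psi>' (\<Delta>1 \<inter> \<Psi>')" using R S1 p(3) \<Psi>'p by (rule simple_system_restrict)
      then obtain D where D: "D \<in> reach \<Psi>' (\<Delta>1 \<inter> \<Psi>')" "descents g \<Psi>' D = M'" using M' by blast
      obtain \<Delta>2 where \<Delta>2: "\<Delta>2 \<in> reach \<Psi> \<Delta>1"
        "descents g \<Psi> \<Delta>2 = descents g \<Psi>' D + card {\<alpha> \<in> \<Psi> - \<Psi>'. 0 < b p \<alpha> \<and> b p (g \<alpha>) < 0}"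
        using ascent_lift[OF R S1 p(3) \<Psi>'p st st' D(1)] by blast
      have "g ` (\<Psi> - \<Psi>') = \<Psi> - \<Psi>'"
        using st st' by (metis hg image_set_diff inj_on_inverseI)
      then have "card {\<alpha> \<in> \<Psi> - \<Psi>'. 0 < b p \<alpha> \<and> b p (g \<alpha>) < 0} = card {\<alpha> \<in> \<Psi> - \<Psi>'. 0 < b q \<alpha> \<and> b q (g \<alpha>) < 0}"
        using finR p(1) q reg by (intro crossing_count_constant[where l = l]) (auto simp: K_def)
      then have "descents g \<Psi> \<Delta>2 = M" using \<Delta>2(2) D(2) by (simp add: M_def)
      moreover have "\<Delta>2 \<in> reach \<Psi> \<Delta>" using \<Delta>2(1) p(2) by (auto simp: reach_def)
      ultimately show ?thesis by blast
    qed
    then show ?thesis by blast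
  qed
qed

end


section \<open>Words and lengths in a Coxeter group\<close>

locale coxeter = group W for W :: "('a, 'm) monoid_scheme" (structure) +
  fixes S :: "'a set"
  assumes coxeter: "coxeter_system W S" and finite_W: "finite (carrier W)"
begin

abbreviation len :: "'a \<Rightarrow> nat" where "len \<equiv> cox_length W S"
abbreviation wprod :: "'a list \<Rightarrow> 'a" where "wprod \<equiv> word_prod W"

lemma S_carrier: "s \<in> S \<Longrightarrow> s \<in> carrier W"
  using coxeter by (auto simp: coxeter_system_def)

lemma finite_S: "finite S"
  using S_carrier finite_W by (meson finite_subset subsetI)

lemma S_ord: "s \<in> S \<Longrightarrow> ord s = 2"
  using coxeter by (auto simp: coxeter_system_def)

lemma S_square [simp]: "s \<in> S \<Longrightarrow> s \<otimes> s = \<one>"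
  using pow_ord_eq_1[of s] S_ord S_carrier by (simp add: numeral_2_eq_2)

lemma S_inv [simp]: "s \<in> S \<Longrightarrow> inv s = s"
  using inv_equality S_square S_carrier by blast

lemma ord_one: "ord \<one> = 1"
  using ord_eq_1[of \<one>] by simp

lemma S_cancel: "s \<in> S \<Longrightarrow> w \<in> carrier W \<Longrightarrow> w \<otimes> s \<otimes> s = w" "s \<in> S \<Longrightarrow> w \<in> carrier W \<Longrightarrow> s \<otimes> (s \<otimes> w) = w"
  using S_carrier by (simp_all add: m_assoc) (simp add: m_assoc[symmetric])

lemma wprod_Nil [simp]: "wprod [] = \<one>" and wprod_Cons [simp]: "wprod (x # xs) = x \<otimes> wprod xs"
  by (simp_all add: word_prod_def)

lemma wprod_closed [simp]: "us \<in> lists S \<Longrightarrow> wprod us \<in> carrier W"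
  by (induction us) (auto simp: S_carrier)

lemma wprod_append: "us \<in> lists S \<Longrightarrow> vs \<in> lists S \<Longrightarrow> wprod (us @ vs) = wprod us \<otimes> wprod vs"
  by (induction us) (auto simp: m_assoc S_carrier)

lemma wprod_rev: "us \<in> lists S \<Longrightarrow> wprod (rev us) = inv (wprod us)"
proof (induction us)
  case (Cons a us)
  then have "a \<in> S" "us \<in> lists S" "rev us \<in> lists S" by auto
  then show ?case using Cons.IH by (simp add: wprod_append inv_mult_group S_carrier)
qed simp

lemma word_exists: "w \<in> carrier W \<Longrightarrow> \<exists>ws\<in>lists S. wprod ws = w"
proof -
  assume "w \<in> carrier W"
  then have "w \<in> generate W S" using coxeter by (simp add: coxeter_system_def)
  then show ?thesis
  proof (induction rule: generate.induct)
    case one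
    then show ?case by (intro bexI[of _ "[]"]) auto
  next
    case (incl s)
    then show ?case using S_carrier by (intro bexI[of _ "[s]"]) auto
  next
    case (inv s)
    then show ?case using S_carrier by (intro bexI[of _ "[s]"]) auto
  next
    case (eng x y)
    then obtain us vs where "us \<in> lists S" "wprod us = x" "vs \<in> lists S" "wprod vs = y" by blast
    then show ?case by (intro bexI[of _ "us @ vs"]) (auto simp: wprod_append)
  qed
qed

lemma reduced_word:
  assumes "w \<in> carrier W" shows "\<exists>ws\<in>lists S. length ws = len w \<and> wprod ws = w"
proof -
  obtain ws where "ws \<in> lists S" "wprod ws = w" using word_exists[OF assms] by blast
  then show ?thesis unfolding cox_length_def
    by (intro LeastI[of "\<lambda>n. \<exists>ws\<in>lists S. length ws = n \<and> wprod ws = w" "length ws"] bexI[of _ ws]) auto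
qed

lemma len_le: "ws \<in> lists S \<Longrightarrow> len (wprod ws) \<le> length ws"
  unfolding cox_length_def by (rule Least_le) blast

lemma len_one [simp]: "len \<one> = 0"
  using len_le[of "[]"] by simp

lemma len_0: "w \<in> carrier W \<Longrightarrow> len w = 0 \<Longrightarrow> w = \<one>"
  using reduced_word[of w] by auto

lemma len_mult: "x \<in> carrier W \<Longrightarrow> y \<in> carrier W \<Longrightarrow> len (x \<otimes> y) \<le> len x + len y"
  by (metis reduced_word append_in_lists_conv len_le length_append wprod_append)

lemma len_inv: "w \<in> carrier W \<Longrightarrow> len (inv w) = len w"
proof -
  have "len (inv w) \<le> len w" if w: "w \<in> carrier W" for w
  proof -
    obtain ws where ws: "ws \<in> lists S" "length ws = len w" "wprod ws = w" using reduced_word[OF w] by blast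
    have "rev ws \<in> lists S" using ws(1) by auto
    from len_le[OF this] show ?thesis using wprod_rev[OF ws(1)] ws by simp
  qed
  then show "w \<in> carrier W \<Longrightarrow> len (inv w) = len w" by (metis inv_closed inv_inv le_antisym)
qed

lemma len_S_le: "s \<in> S \<Longrightarrow> len s \<le> 1"
  using len_le[of "[s]"] S_carrier by simp

lemma len_mult_S: "w \<in> carrier W \<Longrightarrow> s \<in> S \<Longrightarrow> len (w \<otimes> s) \<le> Suc (len w)"
  using len_mult[of w s] len_S_le[of s] S_carrier by fastforce

text \<open>
  Functions on words that respect the defining relations descend to the group. This is how the parity of the
  length and the geometric representation are obtained from the presentation.
\<close>

lemma equivclp_invariant:
  assumes "equivclp r x y" "\<And>x y. r x y \<Longrightarrow> f x = f y" shows "f x = f y"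
  using assms(1) by (induction rule: equivclp_induct) (auto dest: assms(2))

lemma length_concat_replicate: "length (concat (replicate n [a, b])) = 2 * n"
  by (induction n) auto

text \<open>
  Each defining relation has even length \<open>2m\<close>.
\<close>

lemma word_parity:
  assumes "us \<in> lists S" "vs \<in> lists S" "wprod us = wprod vs"
  shows "even (length us) = even (length vs)"
proof -
  have "equivclp (relation_step W S) us vs" using coxeter assms by (simp add: coxeter_system_def)
  then show ?thesis
    by (rule equivclp_invariant) (auto simp: length_concat_replicate elim!: relation_step.cases)
qed

lemma len_parity:
  assumes "w \<in> carrier W" "s \<in> S" shows "even (len (w \<otimes> s)) \<noteq> even (len w)"
proof -
  obtain ws where ws: "ws \<in> lists S" "length ws = len w" "wprod ws = w" using reduced_word[OF assms(1)] by blast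
  obtain vs where vs: "vs \<in> lists S" "length vs = len (w \<otimes> s)" "wprod vs = w \<otimes> s"
    using reduced_word[of "w \<otimes> s"] assms S_carrier by auto
  have "wprod (ws @ [s]) = wprod vs" using ws vs assms S_carrier by (simp add: wprod_append)
  then have "even (length (ws @ [s])) = even (length vs)" using ws vs assms by (intro word_parity) auto
  then show ?thesis using ws vs by simp
qed

lemma len_mult_S_cases:
  assumes "w \<in> carrier W" "s \<in> S"
  obtains "len (w \<otimes> s) = Suc (len w)" | "len w = Suc (len (w \<otimes> s))"
proof -
  have "len (w \<otimes> s) \<le> Suc (len w)" using len_mult_S[OF assms] .
  moreover have "len w \<le> Suc (len (w \<otimes> s))"
    using len_mult_S[of "w \<otimes> s" s] assms S_carrier by (simp add: S_cancel)
  moreover have "len (w \<otimes> s) \<noteq> len w" using len_parity[OF assms] by metis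
  ultimately show thesis using that by linarith
qed

lemma descent_exists:
  assumes "w \<in> carrier W" "w \<noteq> \<one>" obtains s where "s \<in> S" "len w = Suc (len (w \<otimes> s))"
proof -
  obtain ws where ws: "ws \<in> lists S" "length ws = len w" "wprod ws = w" using reduced_word[OF assms(1)] by blast
  have "ws \<noteq> []" using ws assms by auto
  then obtain us s where us: "ws = us @ [s]" by (metis rev_exhaust)
  have s: "s \<in> S" "us \<in> lists S" using ws us by auto
  have "w \<otimes> s = wprod us" using ws(3) us s S_carrier by (simp add: wprod_append S_cancel flip: ws(3))
  then have "len (w \<otimes> s) < len w" using len_le[OF s(2)] ws(2) us by simp
  then show thesis using that len_mult_S_cases[OF assms(1) s(1)] s(1) by (metis less_Suc_eq not_less_iff_gr_or_eq)
qed

lemma len_S: "s \<in> S \<Longrightarrow> len s = 1"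
  using len_mult_S_cases[of \<one> s "len s = 1"] S_carrier by auto


section \<open>The geometric representation\<close>

definition cartan :: "'a \<Rightarrow> 'a \<Rightarrow> real" where
  "cartan s t = - cos (pi / real (ord (s \<otimes> t)))"

text \<open>
  The pairing of \<open>f\<close> with the simple root of \<open>s\<close> in the Tits form, whose matrix has the entries
  \<open>- cos (\<pi> / m(s, t))\<close>.
\<close>

definition pairing :: "('a \<Rightarrow> real) \<Rightarrow> 'a \<Rightarrow> real" where
  "pairing f s = (\<Sum>t\<in>S. f t * cartan t s)"

definition gen_refl :: "'a \<Rightarrow> ('a \<Rightarrow> real) \<Rightarrow> ('a \<Rightarrow> real)" where
  "gen_refl s f = f - (2 * pairing f s) *\<^sub>R unit_vector s"

definition act :: "'a list \<Rightarrow> ('a \<Rightarrow> real) \<Rightarrow> ('a \<Rightarrow> real)" where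
  "act ws f = foldr gen_refl ws f"

lemma act_simps [simp]: "act [] f = f" "act (s # ws) f = gen_refl s (act ws f)" "act (us @ vs) f = act us (act vs f)"
  by (simp_all add: act_def)

lemma pairing_unit: "s \<in> S \<Longrightarrow> pairing (unit_vector s) t = cartan s t"
  using finite_S by (simp add: pairing_def unit_vector_def if_distrib[of "\<lambda>x. x * _"] cong: if_cong)

lemma pairing_linear: "pairing (f + g) s = pairing f s + pairing g s" "pairing (r *\<^sub>R f) s = r * pairing f s"
  "pairing (f - g) s = pairing f s - pairing g s" "pairing (- f) s = - pairing f s"
  by (simp_all add: pairing_def pointwise sum.distrib sum_subtractf sum_distrib_left algebra_simps sum_negf)

lemma linear_gen_refl: "linear (gen_refl s)"
  by (rule linearI) (simp_all add: gen_refl_def pairing_linear algebra_simps)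

lemma linear_act: "linear (act ws)"
proof (induction ws)
  case Nil
  show ?case by (rule linearI) simp_all
next
  case (Cons s ws)
  have "act (s # ws) = gen_refl s \<circ> act ws" by (rule ext) simp
  then show ?case using linear_compose[OF Cons linear_gen_refl] by metis
qed

lemma ord_commute:
  assumes "s \<in> S" "t \<in> S" shows "ord (s \<otimes> t) = ord (t \<otimes> s)"
proof -
  have "t \<otimes> s = inv (s \<otimes> t)" using assms S_carrier by (simp add: inv_mult_group)
  then show ?thesis using ord_inv[of "s \<otimes> t"] assms S_carrier by simp
qed

lemma cartan_commute: "s \<in> S \<Longrightarrow> t \<in> S \<Longrightarrow> cartan s t = cartan t s"
  by (simp add: cartan_def ord_commute)

lemma cartan_self [simp]: "s \<in> S \<Longrightarrow> cartan s s = 1"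
  by (simp add: cartan_def ord_one)

lemma gen_refl_unit: "s \<in> S \<Longrightarrow> t \<in> S \<Longrightarrow> gen_refl s (unit_vector t) = unit_vector t - (2 * cartan s t) *\<^sub>R unit_vector s"
  by (simp add: gen_refl_def pairing_unit cartan_commute)

lemma gen_refl_self: "s \<in> S \<Longrightarrow> gen_refl s (unit_vector s) = - unit_vector s"
  by (simp add: gen_refl_unit scaleR_2)

lemma gen_refl_gen_refl: "s \<in> S \<Longrightarrow> gen_refl s (gen_refl s f) = f"
  by (simp add: gen_refl_def pairing_linear pairing_unit algebra_simps)

lemma act_rev: "ws \<in> lists S \<Longrightarrow> act (rev ws) (act ws f) = f"
  by (induction ws arbitrary: f) (auto simp: gen_refl_gen_refl)

subsection \<open>Dihedral computations\<close>

text \<open>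
  The alternating word of length \<open>n\<close> in \<open>a\<close> and \<open>c\<close> that ends in \<open>a\<close>.
\<close>

fun ralt :: "'a \<Rightarrow> 'a \<Rightarrow> nat \<Rightarrow> 'a list" where
  "ralt a c 0 = []"
| "ralt a c (Suc n) = (if even n then a else c) # ralt a c n"

lemma ralt_lists: "a \<in> S \<Longrightarrow> c \<in> S \<Longrightarrow> ralt a c n \<in> lists S"
  by (induction n) auto

lemma length_ralt [simp]: "length (ralt a c n) = n"
  by (induction n) auto

lemma ralt_snoc: "ralt a c (Suc n) = ralt c a n @ [a]"
  by (induction n) auto

lemma ralt_double: "ralt t s (2 * n) = concat (replicate n [s, t])"
  by (induction n) auto

lemma rev_concat_replicate: "rev (concat (replicate n [s, t])) = concat (replicate n [t, s])"
proof (induction n)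
  case (Suc n)
  have "concat (replicate (Suc n) [t, s]) = concat (replicate n [t, s]) @ [t, s]"
    by (simp only: replicate_append_same[symmetric] replicate_Suc concat_append) simp
  then show ?case using Suc by simp
qed simp

text \<open>
  With \<open>x = \<pi> / m\<close> these are the numbers \<open>sin (n x) / sin x\<close>, that is, Chebyshev polynomials of the second kind at
  \<open>cos x\<close>. They are the coordinates of the roots of a dihedral group.
\<close>

definition dsin :: "'a \<Rightarrow> 'a \<Rightarrow> nat \<Rightarrow> real" where
  "dsin s t n = sin (real n * (pi / real (ord (s \<otimes> t)))) / sin (pi / real (ord (s \<otimes> t)))"

context
  fixes s t assumes st: "s \<in> S" "t \<in> S" "s \<noteq> t"
begin

lemma ord_ge_2: "2 \<le> ord (s \<otimes> t)"
proof -
  have c: "s \<otimes> t \<in> carrier W" using st S_carrier by simp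
  have "ord (s \<otimes> t) \<ge> 1" using ord_ge_1[OF finite_W c] .
  moreover have "ord (s \<otimes> t) \<noteq> 1"
  proof
    assume "ord (s \<otimes> t) = 1"
    then have "s \<otimes> t = \<one>" using ord_eq_1 c by simp
    then have "s = inv t" using st S_carrier inv_equality by metis
    then show False using st by simp
  qed
  ultimately show ?thesis by simp
qed

lemma sin_angle_pos: "0 < sin (pi / real (ord (s \<otimes> t)))"
  using ord_ge_2 by (intro sin_gt_zero) (auto simp: field_simps)

lemma dsin_0 [simp]: "dsin s t 0 = 0" and dsin_1 [simp]: "dsin s t (Suc 0) = 1"
  using sin_angle_pos by (simp_all add: dsin_def)

lemma dsin_rec: "dsin s t (Suc (Suc n)) = - 2 * cartan s t * dsin s t (Suc n) - dsin s t n"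
proof -
  let ?x = "pi / real (ord (s \<otimes> t))"
  have "sin (real (Suc n) * ?x + ?x) + sin (real (Suc n) * ?x - ?x) = 2 * cos ?x * sin (real (Suc n) * ?x)"
    by (simp add: sin_add sin_diff)
  moreover have "real (Suc n) * ?x + ?x = real (Suc (Suc n)) * ?x" "real (Suc n) * ?x - ?x = real n * ?x"
    by (simp_all add: algebra_simps add_divide_distrib)
  ultimately have "sin (real (Suc (Suc n)) * ?x) = 2 * cos ?x * sin (real (Suc n) * ?x) - sin (real n * ?x)" by simp
  then show ?thesis by (simp add: dsin_def cartan_def diff_divide_distrib)
qed

lemma dsin_nonneg: "n \<le> ord (s \<otimes> t) \<Longrightarrow> 0 \<le> dsin s t n"
proof -
  assume n: "n \<le> ord (s \<otimes> t)"
  let ?m = "real (ord (s \<otimes> t))"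
  have "0 < ?m" using ord_ge_2 by simp
  then have "real n * (pi / ?m) \<le> pi" using n by (simp add: field_simps)
  then have "0 \<le> sin (real n * (pi / ?m))" by (intro sin_ge_zero) simp_all
  then show ?thesis using sin_angle_pos by (simp add: dsin_def)
qed

lemma act_ralt: "act (ralt t s n) (unit_vector s) =
    dsin s t (Suc n) *\<^sub>R unit_vector (if even n then s else t) + dsin s t n *\<^sub>R unit_vector (if even n then t else s)"
proof (induction n)
  case (Suc n)
  let ?k = "cartan s t"
  have r: "gen_refl (if even n then t else s) (a *\<^sub>R unit_vector (if even n then s else t) + c *\<^sub>R unit_vector (if even n then t else s))
      = (- 2 * ?k * a - c) *\<^sub>R unit_vector (if even n then t else s) + a *\<^sub>R unit_vector (if even n then s else t)" for a c
    using st linear_gen_refl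
    by (auto simp: linear_add linear_scale gen_refl_self gen_refl_unit cartan_commute[of t s] algebra_simps)
  show ?case by (simp only: ralt.simps act_simps Suc r dsin_rec) simp
qed simp

end

lemma act_relation_unit:
  assumes "s \<in> S" "t \<in> S" "s \<noteq> t"
  shows "act (concat (replicate (ord (s \<otimes> t)) [s, t])) (unit_vector s) = unit_vector s"
proof -
  let ?m = "ord (s \<otimes> t)"
  have m: "0 < real ?m" using ord_ge_2[OF assms] by simp
  have e1: "real (2 * ?m) * (pi / ?m) = 2 * pi" using m by simp
  have 1: "dsin s t (2 * ?m) = 0" unfolding dsin_def e1 by simp
  have e2: "real (Suc (2 * ?m)) * (pi / ?m) = 2 * pi + pi / ?m" using m by (simp add: field_simps)
  have 2: "dsin s t (Suc (2 * ?m)) = 1"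
    unfolding dsin_def e2 sin_add using sin_angle_pos[OF assms] by simp
  show ?thesis unfolding ralt_double[symmetric] act_ralt[OF assms] 1 2 by simp
qed

text \<open>
  The two simple roots are fixed by the explicit formula for alternating words. As \<open>\<bar>cos (\<pi>/m)\<bar> < 1\<close>, every vector differs from
  one that pairs to zero with both roots, and is thus fixed by both reflections, by a combination of these roots.
\<close>

lemma act_relation:
  assumes "s \<in> S" "t \<in> S"
  shows "act (concat (replicate (ord (s \<otimes> t)) [s, t])) f = f"
proof (cases "s = t")
  case True
  then show ?thesis using assms by (simp add: ord_one gen_refl_gen_refl)
next
  case ne: False
  let ?m = "ord (s \<otimes> t)" and ?k = "cartan s t"
  let ?R = "concat (replicate ?m [s, t])"
  have Rl: "concat (replicate ?m [t, s]) \<in> lists S"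
    unfolding ralt_double[symmetric] using assms by (intro ralt_lists)
  have s: "act ?R (unit_vector s) = unit_vector s" by (rule act_relation_unit[OF assms ne])
  have "act (concat (replicate ?m [t, s])) (unit_vector t) = unit_vector t"
    using act_relation_unit[OF assms(2,1)] ne ord_commute[OF assms] by simp
  then have t: "act ?R (unit_vector t) = unit_vector t"
    using act_rev[OF Rl, of "unit_vector t"] by (simp add: rev_concat_replicate)
  have "?k\<^sup>2 < 1"
  proof -
    have "0 < (sin (pi / ?m))\<^sup>2" using sin_angle_pos[OF assms ne] by simp
    moreover have "(sin (pi / ?m))\<^sup>2 + ?k\<^sup>2 = 1" by (simp add: cartan_def)
    ultimately show ?thesis by linarith
  qed
  then have k: "1 - ?k\<^sup>2 \<noteq> 0" by simp
  define p q where "p = pairing f s" and "q = pairing f t"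
  define x where "x = (p - ?k * q) / (1 - ?k\<^sup>2)"
  define y where "y = (q - ?k * p) / (1 - ?k\<^sup>2)"
  define f0 where "f0 = f - x *\<^sub>R unit_vector s - y *\<^sub>R unit_vector t"
  have X: "x * (1 - ?k\<^sup>2) = p - ?k * q" and Y: "y * (1 - ?k\<^sup>2) = q - ?k * p" using k by (simp_all add: x_def y_def)
  have "(x + y * ?k) * (1 - ?k\<^sup>2) = x * (1 - ?k\<^sup>2) + ?k * (y * (1 - ?k\<^sup>2))" by (simp add: algebra_simps)
  also have "\<dots> = p * (1 - ?k\<^sup>2)" unfolding X Y by (simp add: algebra_simps power2_eq_square)
  finally have "(x + y * ?k) * (1 - ?k\<^sup>2) = p * (1 - ?k\<^sup>2)" .
  moreover have "(y + x * ?k) * (1 - ?k\<^sup>2) = y * (1 - ?k\<^sup>2) + ?k * (x * (1 - ?k\<^sup>2))" by (simp add: algebra_simps)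
  then have "(y + x * ?k) * (1 - ?k\<^sup>2) = q * (1 - ?k\<^sup>2)" unfolding X Y by (simp add: algebra_simps power2_eq_square)
  ultimately have xy: "x + y * ?k = p" "y + x * ?k = q" using k by simp_all
  have "pairing f0 s = 0" "pairing f0 t = 0"
    using assms xy by (simp_all add: f0_def pairing_linear pairing_unit cartan_commute[of t s] p_def[symmetric] q_def[symmetric])
  then have "gen_refl s f0 = f0" "gen_refl t f0 = f0" by (simp_all add: gen_refl_def)
  then have f0: "act (concat (replicate n [s, t])) f0 = f0" for n by (induction n) auto
  have f: "f = f0 + x *\<^sub>R unit_vector s + y *\<^sub>R unit_vector t" by (simp add: f0_def)
  show ?thesis unfolding f using linear_act[of ?R] by (simp only: linear_add linear_scale f0 s t)
qed

lemma act_cong: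
  assumes "us \<in> lists S" "vs \<in> lists S" "wprod us = wprod vs" shows "act us = act vs"
proof -
  have "equivclp (relation_step W S) us vs" using coxeter assms by (simp add: coxeter_system_def)
  then show ?thesis
    by (rule equivclp_invariant) (auto simp: fun_eq_iff act_relation elim!: relation_step.cases)
qed

definition rep :: "'a \<Rightarrow> ('a \<Rightarrow> real) \<Rightarrow> ('a \<Rightarrow> real)" where
  "rep w = act (SOME ws. ws \<in> lists S \<and> wprod ws = w)"

lemma rep_word: "ws \<in> lists S \<Longrightarrow> rep (wprod ws) = act ws"
  unfolding rep_def by (rule someI2[of _ ws]) (auto intro: act_cong)

lemma rep_one [simp]: "rep \<one> f = f"
  using rep_word[of "[]"] by simp

lemma rep_S: "s \<in> S \<Longrightarrow> rep s = gen_refl s"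
  using rep_word[of "[s]"] S_carrier by (auto simp: fun_eq_iff)

lemma rep_mult: "x \<in> carrier W \<Longrightarrow> y \<in> carrier W \<Longrightarrow> rep (x \<otimes> y) f = rep x (rep y f)"
proof -
  assume "x \<in> carrier W" "y \<in> carrier W"
  then obtain us vs where us: "us \<in> lists S" "wprod us = x" "vs \<in> lists S" "wprod vs = y" using word_exists by metis
  have "rep (wprod (us @ vs)) = act (us @ vs)" using us by (intro rep_word) auto
  then show ?thesis using us rep_word[OF us(1)] rep_word[OF us(3)] by (simp add: wprod_append)
qed

lemma linear_rep: "w \<in> carrier W \<Longrightarrow> linear (rep w)"
  using word_exists rep_word linear_act by metis

lemma rep_inv: "w \<in> carrier W \<Longrightarrow> rep (inv w) (rep w f) = f" "w \<in> carrier W \<Longrightarrow> rep w (rep (inv w) f) = f"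
  by (simp_all flip: rep_mult)

lemma ralt_wprod_relation:
  assumes st: "s \<in> S" "t \<in> S"
  shows "wprod (ralt t s n) \<otimes> inv (wprod (ralt s t n)) =
    (if even n then (s \<otimes> t) [^] n else t \<otimes> (s \<otimes> t) [^] n \<otimes> t)"
proof (induction n)
  case (Suc n)
  let ?D = "wprod (ralt t s n)" and ?D' = "wprod (ralt s t n)"
  have c: "?D \<in> carrier W" "?D' \<in> carrier W" "s \<in> carrier W" "t \<in> carrier W" "(s \<otimes> t) [^] n \<in> carrier W"
    using st ralt_lists S_carrier by auto
  show ?case
  proof (cases "even n")
    case True
    have "wprod (ralt t s (Suc n)) \<otimes> inv (wprod (ralt s t (Suc n))) = t \<otimes> (?D \<otimes> inv ?D') \<otimes> s"
      using True c st by (simp add: inv_mult_group m_assoc)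
    also have "\<dots> = t \<otimes> ((s \<otimes> t) [^] n \<otimes> (s \<otimes> t)) \<otimes> t"
      using Suc True c st by (simp add: m_assoc S_cancel)
    finally show ?thesis using True by simp
  next
    case False
    have "wprod (ralt t s (Suc n)) \<otimes> inv (wprod (ralt s t (Suc n))) = s \<otimes> (?D \<otimes> inv ?D') \<otimes> t"
      using False c st by (simp add: inv_mult_group m_assoc)
    also have "\<dots> = (s \<otimes> t) \<otimes> (s \<otimes> t) [^] n"
      using Suc False c st by (simp add: m_assoc)
    finally show ?thesis using False c by (simp add: nat_pow_comm[of "s \<otimes> t" 1 n, simplified])
  qed
qed simp

text \<open>
  The relation \<open>(st)\<^sup>m = 1\<close> in its braid form \<open>\<dots>st = \<dots>ts\<close> with \<open>m\<close> letters on each side.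
\<close>

lemma ralt_braid:
  assumes "s \<in> S" "t \<in> S"
  shows "wprod (ralt t s (ord (s \<otimes> t))) = wprod (ralt s t (ord (s \<otimes> t)))"
proof -
  have "(s \<otimes> t) [^] ord (s \<otimes> t) = \<one>" using pow_ord_eq_1 assms S_carrier by simp
  then have "wprod (ralt t s (ord (s \<otimes> t))) \<otimes> inv (wprod (ralt s t (ord (s \<otimes> t)))) = \<one>"
    using assms S_carrier by (simp add: ralt_wprod_relation)
  moreover have "wprod (ralt t s (ord (s \<otimes> t))) \<in> carrier W" "wprod (ralt s t (ord (s \<otimes> t))) \<in> carrier W"
    using ralt_lists assms by auto
  ultimately show ?thesis by (metis inv_closed inv_equality inv_inv)
qed

text \<open>
  By induction on the length. Choose a descent \<open>t \<noteq> s\<close> of \<open>w\<close> and split off from the right of \<open>w\<close> the longest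
  reduced alternating word in \<open>s\<close> and \<open>t\<close> that ends in \<open>t\<close>, say of length \<open>k\<close>, so \<open>w = v \<cdot> \<dots>st\<close>. The braid relation shows
  \<open>k < m\<close>, as otherwise \<open>s\<close> would be a descent of \<open>w\<close>. Neither \<open>s\<close> nor \<open>t\<close> is a descent of \<open>v\<close>, so \<open>v\<close> maps both simple roots to
  nonnegative vectors, and the alternating word maps the root of \<open>s\<close> to a nonnegative combination of the two.
\<close>

lemma rep_positive:
  assumes "w \<in> carrier W" "s \<in> S" "len (w \<otimes> s) = Suc (len w)"
  shows "0 \<le> rep w (unit_vector s) i"
  using assms
proof (induction "len w" arbitrary: w s rule: less_induct)
  case less
  note w = less.prems(1) and s = less.prems(2)
  show ?case
  proof (cases "w = \<one>")
    case True
    then show ?thesis by (simp add: unit_vector_def)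
  next
    case False
    then obtain t where t: "t \<in> S" "len w = Suc (len (w \<otimes> t))" using descent_exists[OF w] by blast
    have ne: "s \<noteq> t" using t less.prems(3) by auto
    let ?m = "ord (s \<otimes> t)"
    define v where "v k = w \<otimes> inv (wprod (ralt t s k))" for k
    define x where "x k = (if even k then t else s)" for k :: nat
    have rl: "ralt t s k \<in> lists S" "ralt s t k \<in> lists S" for k using ralt_lists s t by auto
    have vc: "v k \<in> carrier W" for k using w rl by (simp add: v_def)
    have xS: "x k \<in> S" for k using s t by (simp add: x_def)
    have vSuc: "v (Suc k) = v k \<otimes> x k" for k
      using w s t rl[of k] xS[of k] S_carrier by (simp add: v_def x_def inv_mult_group m_assoc)
    have wv: "w = v k \<otimes> wprod (ralt t s k)" for k using w rl by (simp add: v_def m_assoc)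
    define P where "P k \<longleftrightarrow> len (v k) + k = len w" for k
    have P0: "P 0" "P (Suc 0)" using w t by (auto simp: P_def v_def S_carrier)
    \<comment> \<open>otherwise the splitting could be rewritten so that \<open>w\<close> ends in \<open>s\<close>\<close>
    have "\<not> P ?m"
    proof
      assume Pm: "P ?m"
      obtain m' where m': "?m = Suc m'" using ord_ge_2[OF s t(1) ne] by (cases ?m) auto
      have "w = v ?m \<otimes> wprod (ralt s t ?m)" using wv ralt_braid[OF s t(1)] by metis
      also have "wprod (ralt s t ?m) = wprod (ralt t s m') \<otimes> s"
        unfolding m' ralt_snoc using rl s S_carrier by (simp add: wprod_append)
      finally have "w \<otimes> s = v ?m \<otimes> wprod (ralt t s m')"
        using vc rl s S_carrier by (simp add: m_assoc)
      then have "len (w \<otimes> s) \<le> len (v ?m) + m'"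
        using len_mult[of "v ?m" "wprod (ralt t s m')"] len_le[OF rl(1)[of m']] vc rl by force
      then show False using Pm m' less.prems(3) by (simp add: P_def)
    qed
    then obtain k where k: "k < ?m" "\<forall>i\<le>k. P i" "\<not> P (Suc k)"
      using ex_least_nat_less[of "\<lambda>k. \<not> P k" ?m] P0 by (metis not_less_eq_eq linorder_not_le)
    have k0: "0 < k" using k(3) P0 by (cases k) auto
    have Pk: "len (v k) + k = len w" using k(2) by (simp add: P_def)
    have lt: "len (v k) < len w" using Pk k0 by linarith
    have up1: "len (v k \<otimes> x k) = Suc (len (v k))"
      using k(3) Pk len_mult_S_cases[OF vc xS, of k k] unfolding P_def vSuc by fastforce
    have "v k \<otimes> x (k - 1) = v (k - 1)"
      using vSuc[of "k - 1"] k0 vc xS by (simp add: S_cancel)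
    moreover have "len (v (k - 1)) + (k - 1) = len w" using k(2) by (simp add: P_def)
    ultimately have up2: "len (v k \<otimes> x (k - 1)) = Suc (len (v k))" using Pk k0 by simp
    have "even (k - 1) \<longleftrightarrow> odd k" using k0 by (cases k) auto
    then have "x (k - 1) = (if even k then s else t)" using s by (simp add: x_def)
    then have up: "len (v k \<otimes> s) = Suc (len (v k))" "len (v k \<otimes> t) = Suc (len (v k))"
      using up1 up2 by (auto simp: x_def split: if_splits)
    have nn: "0 \<le> rep (v k) (unit_vector s) i" "0 \<le> rep (v k) (unit_vector t) i"
      using less.hyps[OF lt vc s up(1)] less.hyps[OF lt vc t(1) up(2)] by auto
    have "rep w (unit_vector s) = rep (v k) (act (ralt t s k) (unit_vector s))"
    proof -
      have "rep w (unit_vector s) = rep (v k \<otimes> wprod (ralt t s k)) (unit_vector s)" using wv[of k] by simp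
      also have "\<dots> = rep (v k) (rep (wprod (ralt t s k)) (unit_vector s))" using rep_mult[OF vc] rl by simp
      finally show ?thesis using rep_word[OF rl(1)] by simp
    qed
    also have "\<dots> = dsin s t (Suc k) *\<^sub>R rep (v k) (unit_vector (if even k then s else t))
        + dsin s t k *\<^sub>R rep (v k) (unit_vector (if even k then t else s))"
      unfolding act_ralt[OF s t(1) ne] using linear_rep[OF vc] by (simp only: linear_add linear_scale)
    finally have "rep w (unit_vector s) i = dsin s t (Suc k) * rep (v k) (unit_vector (if even k then s else t)) i
        + dsin s t k * rep (v k) (unit_vector (if even k then t else s)) i" by (simp add: pointwise)
    then show ?thesis using nn k(1) dsin_nonneg[OF s t(1) ne] by simp
  qed
qed

end


section \<open>Roots and inversions\<close>

context coxeter
begin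

lemma rep_diff: "w \<in> carrier W \<Longrightarrow> rep w (u - v) = rep w u - rep w v"
  and rep_scale: "w \<in> carrier W \<Longrightarrow> rep w (r *\<^sub>R u) = r *\<^sub>R rep w u"
  and rep_add: "w \<in> carrier W \<Longrightarrow> rep w (u + v) = rep w u + rep w v"
  and rep_minus: "w \<in> carrier W \<Longrightarrow> rep w (- u) = - rep w u"
  using linear_rep by (simp_all add: linear_diff linear_scale linear_add linear_neg)

text \<open>
  An invariant inner product, obtained by averaging the standard one over the group.
\<close>

definition bform :: "('a \<Rightarrow> real) \<Rightarrow> ('a \<Rightarrow> real) \<Rightarrow> real" where
  "bform u v = (\<Sum>w\<in>carrier W. \<Sum>s\<in>S. rep w u s * rep w v s)"

sublocale euclid: euclidean_form S bform
proof
  show "finite S" by (rule finite_S)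
  show "bform (u + v) w = bform u w + bform v w" for u v w
    by (simp add: bform_def rep_add pointwise distrib_right sum.distrib)
  show "bform (r *\<^sub>R u) w = r * bform u w" for r u w
    by (simp add: bform_def rep_scale pointwise sum_distrib_left mult.assoc)
  show "bform u v = bform v u" for u v
    by (simp add: bform_def mult.commute)
  show "(v i)\<^sup>2 \<le> bform v v" if "i \<in> S" for v i
  proof -
    have "(v i)\<^sup>2 = rep \<one> v i * rep \<one> v i" by (simp add: power2_eq_square)
    also have "\<dots> \<le> (\<Sum>s\<in>S. rep \<one> v s * rep \<one> v s)"
      using finite_S that by (intro member_le_sum) auto
    also have "\<dots> \<le> bform v v"
      unfolding bform_def using finite_W
      by (intro member_le_sum[of \<one> _ "\<lambda>w. \<Sum>s\<in>S. rep w v s * rep w v s"] sum_nonneg) auto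
    finally show ?thesis .
  qed
qed

lemma bform_rep: "x \<in> carrier W \<Longrightarrow> bform (rep x u) (rep x v) = bform u v"
proof -
  assume x: "x \<in> carrier W"
  have "bij_betw (\<lambda>w. w \<otimes> x) (carrier W) (carrier W)"
    using x by (intro bij_betwI[of _ _ _ "\<lambda>w. w \<otimes> inv x"]) (auto simp: m_assoc)
  then have "bform u v = (\<Sum>w\<in>carrier W. \<Sum>s\<in>S. rep (w \<otimes> x) u s * rep (w \<otimes> x) v s)"
    unfolding bform_def by (rule sum.reindex_bij_betw[symmetric])
  then show ?thesis using x by (simp add: bform_def rep_mult)
qed

lemma bform_rep_shift: "x \<in> carrier W \<Longrightarrow> bform (rep x u) v = bform u (rep (inv x) v)"
  using bform_rep[of "inv x" "rep x u" v] by (simp add: rep_inv)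

lemma unit_E: "s \<in> S \<Longrightarrow> unit_vector s \<in> euclid.E"
  by (auto simp: euclid.E_def unit_vector_def)

lemma unit_nz: "unit_vector s \<noteq> 0"
  by (auto simp: unit_vector_def fun_eq_iff pointwise)

lemma inj_unit: "inj unit_vector"
  by (rule injI) (auto simp: unit_vector_def fun_eq_iff split: if_splits)

lemma act_E: "ws \<in> lists S \<Longrightarrow> f \<in> euclid.E \<Longrightarrow> act ws f \<in> euclid.E"
proof (induction ws)
  case (Cons s ws)
  then have "s \<in> S" "act ws f \<in> euclid.E" by auto
  moreover have "act (s # ws) f = act ws f - (2 * pairing (act ws f) s) *\<^sub>R unit_vector s"
    by (simp only: act_simps gen_refl_def)
  ultimately show ?case using euclid.E_closed_ops(4)[OF _ euclid.E_closed_ops(3)[OF unit_E]] by metis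
qed simp

lemma rep_E: "w \<in> carrier W \<Longrightarrow> f \<in> euclid.E \<Longrightarrow> rep w f \<in> euclid.E"
  using word_exists rep_word act_E by metis

text \<open>
  The generator acts as an orthogonal reflection for every invariant inner product: invariance under \<open>s\<close> forces the
  coefficient of the root in \<open>gen_refl s f\<close> to be the orthogonal one.
\<close>

lemma refl_unit: "s \<in> S \<Longrightarrow> euclid.refl (unit_vector s) f = gen_refl s f"
proof -
  assume s: "s \<in> S"
  let ?e = "unit_vector s"
  have pos: "bform ?e ?e \<noteq> 0" using euclid.b_root_pos[OF unit_E[OF s] unit_nz] .
  have "bform f ?e = bform (gen_refl s f) (gen_refl s ?e)"
    using bform_rep[OF S_carrier[OF s], of f ?e] rep_S[OF s] by simp
  also have "\<dots> = - bform f ?e + 2 * pairing f s * bform ?e ?e"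
    using s by (simp add: gen_refl_self) (simp add: gen_refl_def euclid.b_simps)
  finally have "2 * bform f ?e / bform ?e ?e = 2 * pairing f s" using pos by (simp add: field_simps)
  then show ?thesis by (simp add: euclid.refl_def gen_refl_def)
qed

lemma refl_rep: "w \<in> carrier W \<Longrightarrow> euclid.refl (rep w \<beta>) f = rep w (euclid.refl \<beta> (rep (inv w) f))"
  using bform_rep_shift[of "inv w" f \<beta>] bform_rep[of w \<beta> \<beta>]
  by (simp add: euclid.refl_def rep_diff rep_scale rep_inv)

definition roots :: "('a \<Rightarrow> real) set" where
  "roots = {rep w (unit_vector s) | w s. w \<in> carrier W \<and> s \<in> S}"

lemma rep_roots: "w \<in> carrier W \<Longrightarrow> \<alpha> \<in> roots \<Longrightarrow> rep w \<alpha> \<in> roots"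
proof -
  assume w: "w \<in> carrier W" and "\<alpha> \<in> roots"
  then obtain x s where x: "x \<in> carrier W" "s \<in> S" "\<alpha> = rep x (unit_vector s)" by (auto simp: roots_def)
  then have "rep w \<alpha> = rep (w \<otimes> x) (unit_vector s)" using w by (simp add: rep_mult)
  then show "rep w \<alpha> \<in> roots" using w x unfolding roots_def by blast
qed

lemma unit_roots: "s \<in> S \<Longrightarrow> unit_vector s \<in> roots"
  unfolding roots_def by (metis (mono_tags, lifting) mem_Collect_eq one_closed rep_one)

text \<open>
  All roots have norm 1 in the Tits form, while their norms in \<open>bform\<close> may differ. This excludes roots that are
  proper multiples of other roots.
\<close>

definition tits :: "('a \<Rightarrow> real) \<Rightarrow> ('a \<Rightarrow> real) \<Rightarrow> real" where
  "tits f g = (\<Sum>s\<in>S. pairing f s * g s)"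

lemma tits_unit: "s \<in> S \<Longrightarrow> tits f (unit_vector s) = pairing f s"
  using finite_S by (simp add: tits_def unit_vector_def if_distrib[of "\<lambda>x. _ * x"] cong: if_cong)

lemma tits_sym: "tits f g = tits g f"
proof -
  have "tits f g = (\<Sum>s\<in>S. \<Sum>t\<in>S. f t * g s * cartan t s)"
    unfolding tits_def pairing_def sum_distrib_right by (intro sum.cong HOL.refl) (simp add: mult_ac)
  also have "\<dots> = (\<Sum>t\<in>S. \<Sum>s\<in>S. f t * g s * cartan t s)" by (rule sum.swap)
  also have "\<dots> = (\<Sum>t\<in>S. \<Sum>s\<in>S. g s * cartan s t * f t)"
    by (intro sum.cong HOL.refl) (simp add: cartan_commute)
  also have "\<dots> = tits g f" by (simp add: tits_def pairing_def sum_distrib_right)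
  finally show ?thesis .
qed

lemma tits_linear: "tits (f - g) k = tits f k - tits g k" "tits (r *\<^sub>R f) k = r * tits f k"
  by (simp_all add: tits_def pairing_linear left_diff_distrib sum_subtractf sum_distrib_left mult.assoc)

lemma tits_linear_right: "tits k (f - g) = tits k f - tits k g" "tits k (r *\<^sub>R f) = r * tits k f"
  using tits_linear tits_sym by metis+

lemma tits_gen_refl: "s \<in> S \<Longrightarrow> tits (gen_refl s f) (gen_refl s g) = tits f g"
  using tits_unit[of s f] tits_unit[of s g] tits_sym[of "unit_vector s" g] tits_unit[of s "unit_vector s"]
  by (simp add: gen_refl_def tits_linear tits_linear_right pairing_unit algebra_simps)

lemma tits_act: "ws \<in> lists S \<Longrightarrow> tits (act ws f) (act ws g) = tits f g"
  by (induction ws) (auto simp: tits_gen_refl)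

lemma tits_root: "\<alpha> \<in> roots \<Longrightarrow> tits \<alpha> \<alpha> = 1"
proof -
  assume "\<alpha> \<in> roots"
  then obtain w s where w: "w \<in> carrier W" "s \<in> S" "\<alpha> = rep w (unit_vector s)" by (auto simp: roots_def)
  obtain ws where "ws \<in> lists S" "rep w = act ws" using word_exists[OF w(1)] rep_word by metis
  then show ?thesis using tits_act w by (simp add: tits_unit pairing_unit)
qed

lemma root_set_roots: "euclid.root_set roots"
  unfolding euclid.root_set_def
proof (intro conjI ballI allI impI)
  have "roots = (\<lambda>(w, s). rep w (unit_vector s)) ` (carrier W \<times> S)" by (auto simp: roots_def)
  then show "finite roots" using finite_W finite_S by simp
  show "roots \<subseteq> euclid.E" using rep_E unit_E by (auto simp: roots_def)
  show "0 \<notin> roots" using tits_root[of 0] by (auto simp: tits_def pairing_def pointwise)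
  show "euclid.refl \<beta> \<alpha> \<in> roots" if \<alpha>: "\<alpha> \<in> roots" and \<beta>: "\<beta> \<in> roots" for \<alpha> \<beta>
  proof -
    obtain w s where w: "w \<in> carrier W" "s \<in> S" "\<beta> = rep w (unit_vector s)" using \<beta> by (auto simp: roots_def)
    have "euclid.refl \<beta> \<alpha> = rep w (rep s (rep (inv w) \<alpha>))" unfolding w(3) refl_rep[OF w(1)] refl_unit[OF w(2)] rep_S[OF w(2)] ..
    then show ?thesis using w \<alpha> S_carrier by (simp add: rep_roots)
  qed
  show "c = 1" if "\<alpha> \<in> roots" "0 < c" "c *\<^sub>R \<alpha> \<in> roots" for \<alpha> c
  proof -
    have "c * c = 1" using tits_root[OF that(1)] tits_root[OF that(3)] by (simp add: tits_linear tits_linear_right)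
    then show ?thesis using that(2) by (simp add: square_eq_1_iff)
  qed
qed

lemma root_sign:
  assumes "\<alpha> \<in> roots" shows "(\<forall>i. 0 \<le> \<alpha> i) \<or> (\<forall>i. 0 \<le> (- \<alpha>) i)"
proof -
  obtain w s where w: "w \<in> carrier W" "s \<in> S" "\<alpha> = rep w (unit_vector s)" using assms by (auto simp: roots_def)
  consider "len (w \<otimes> s) = Suc (len w)" | "len w = Suc (len (w \<otimes> s))" using len_mult_S_cases[OF w(1,2)] by blast
  then show ?thesis
  proof cases
    case 1
    then show ?thesis using rep_positive[OF w(1,2)] w(3) by blast
  next
    case 2
    have c: "w \<otimes> s \<in> carrier W" using w S_carrier by simp
    have "rep (w \<otimes> s) (unit_vector s) = - \<alpha>"
      using w S_carrier by (simp add: rep_mult rep_S gen_refl_self rep_minus)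
    then show ?thesis using rep_positive[OF c w(2)] 2 w by (simp add: S_cancel)
  qed
qed

definition base :: "('a \<Rightarrow> real) set" where "base = unit_vector ` S"

abbreviation pos_roots :: "('a \<Rightarrow> real) set" where "pos_roots \<equiv> euclid.pos roots base"

lemma pos_roots_iff: "\<alpha> \<in> pos_roots \<longleftrightarrow> \<alpha> \<in> roots \<and> (\<forall>i. 0 \<le> \<alpha> i)"
proof (intro iffI conjI allI)
  fix i assume "\<alpha> \<in> pos_roots"
  then show "\<alpha> \<in> roots" by (simp add: euclid.pos_def)
  obtain c where c: "\<And>\<gamma>. \<gamma> \<in> base \<Longrightarrow> 0 \<le> c \<gamma>" "\<alpha> = (\<Sum>\<gamma>\<in>base. c \<gamma> *\<^sub>R \<gamma>)"
    using \<open>\<alpha> \<in> pos_roots\<close> by (auto simp: euclid.pos_def)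
  have "0 \<le> c \<gamma> * \<gamma> i" if "\<gamma> \<in> base" for \<gamma>
    using c(1)[OF that] that by (auto simp: base_def unit_vector_def)
  then show "0 \<le> \<alpha> i" unfolding c(2) sum_apply by (intro sum_nonneg) (simp add: pointwise)
next
  assume \<alpha>: "\<alpha> \<in> roots \<and> (\<forall>i. 0 \<le> \<alpha> i)"
  have "\<alpha> \<in> euclid.E" using \<alpha> root_set_roots by (auto dest: euclid.root_setD(2))
  then have "\<alpha> = (\<Sum>i\<in>S. \<alpha> i *\<^sub>R unit_vector i)" by (rule euclid.E_expansion)
  also have "\<dots> = (\<Sum>\<gamma>\<in>base. \<alpha> (inv_into UNIV unit_vector \<gamma>) *\<^sub>R \<gamma>)"
    unfolding base_def sum.reindex[OF inj_on_subset[OF inj_unit subset_UNIV]] by (simp add: inv_f_f[OF inj_unit])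
  finally show "\<alpha> \<in> pos_roots" using \<alpha> by (intro euclid.posI[where c = "\<lambda>\<gamma>. \<alpha> (inv_into UNIV unit_vector \<gamma>)"]) auto
qed

lemma simple_system_base: "euclid.simple_system roots base"
  unfolding euclid.simple_system_def
proof (intro conjI ballI)
  show "base \<subseteq> roots" by (auto simp: base_def unit_roots)
  show "independent base"
  proof (rule independent_if_scalars_zero)
    show "finite base" using finite_S by (simp add: base_def)
    fix f and x :: "'a \<Rightarrow> real" assume z: "(\<Sum>x\<in>base. f x *\<^sub>R x) = 0" and "x \<in> base"
    then obtain s where s: "s \<in> S" "x = unit_vector s" by (auto simp: base_def)
    have "0 = (\<Sum>x\<in>base. f x *\<^sub>R x) s" using z by (simp add: pointwise)
    also have "\<dots> = (\<Sum>t\<in>S. f (unit_vector t) * unit_vector t s)"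
      unfolding base_def sum_apply sum.reindex[OF inj_on_subset[OF inj_unit subset_UNIV]] by (simp add: pointwise)
    also have "\<dots> = (\<Sum>t\<in>S. if t = s then f x else 0)"
      unfolding s(2) by (intro sum.cong) (auto simp: unit_vector_def)
    also have "\<dots> = f x" using s finite_S by simp
    finally show "f x = 0" by simp
  qed
  show "\<alpha> \<in> pos_roots \<or> - \<alpha> \<in> pos_roots" if "\<alpha> \<in> roots" for \<alpha>
    using root_sign[OF that] that euclid.root_minus[OF root_set_roots that] by (auto simp: pos_roots_iff)
qed

lemma gen_refl_pos: "s \<in> S \<Longrightarrow> \<alpha> \<in> pos_roots \<Longrightarrow> \<alpha> \<noteq> unit_vector s \<Longrightarrow> gen_refl s \<alpha> \<in> pos_roots"
  using euclid.refl_pos[OF root_set_roots simple_system_base, of "unit_vector s" \<alpha>]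
  by (simp add: base_def refl_unit)

lemma unit_pos: "s \<in> S \<Longrightarrow> unit_vector s \<in> pos_roots"
  by (simp add: pos_roots_iff unit_roots) (simp add: unit_vector_def)

lemma minus_pos: "\<alpha> \<in> pos_roots \<Longrightarrow> - \<alpha> \<notin> pos_roots"
  using euclid.pos_not_neg[OF root_set_roots simple_system_base] .

lemma pos_roots_D: "\<alpha> \<in> pos_roots \<Longrightarrow> \<alpha> \<in> roots"
  by (simp add: pos_roots_iff)

lemma finite_pos_roots: "finite pos_roots"
  using euclid.root_setD(1)[OF root_set_roots] by (rule rev_finite_subset) (auto dest: pos_roots_D)

text \<open>
  If \<open>w = vs\<close> is longer than \<open>v\<close>, then the inversions of \<open>w\<close> are the root of \<open>s\<close> and the images under \<open>s\<close> of the
  inversions of \<open>v\<close>, because \<open>s\<close> permutes the positive roots other than its own.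
\<close>

theorem len_eq_inversions:
  assumes "w \<in> carrier W" shows "len w = card {\<alpha> \<in> pos_roots. rep w \<alpha> \<notin> pos_roots}"
  using assms
proof (induction "len w" arbitrary: w rule: less_induct)
  case less
  show ?case
  proof (cases "w = \<one>")
    case True
    then show ?thesis by simp
  next
    case False
    then obtain s where s: "s \<in> S" "len w = Suc (len (w \<otimes> s))" using descent_exists[OF less.prems] by blast
    define v where "v = w \<otimes> s"
    have v: "v \<in> carrier W" "w = v \<otimes> s" using s less.prems S_carrier by (simp_all add: v_def S_cancel)
    have lv: "len w = Suc (len v)" using s(2) by (simp only: v_def)
    then have lv: "len w = Suc (len v)" "len (v \<otimes> s) = Suc (len v)" using v(2)[symmetric] by simp_all
    let ?e = "unit_vector s"
    let ?N = "\<lambda>w. {\<alpha> \<in> pos_roots. rep w \<alpha> \<notin> pos_roots}"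
    have rw: "rep w f = rep v (gen_refl s f)" for f using v s S_carrier by (simp add: rep_mult rep_S)
    have ve: "rep v ?e \<in> pos_roots"
      unfolding pos_roots_iff using rep_positive[OF v(1) s(1) lv(2)] rep_roots[OF v(1) unit_roots[OF s(1)]] by blast
    have "?N w = insert ?e (gen_refl s ` ?N v)"
    proof (intro equalityI subsetI)
      fix \<alpha> assume \<alpha>: "\<alpha> \<in> ?N w"
      show "\<alpha> \<in> insert ?e (gen_refl s ` ?N v)"
      proof (cases "\<alpha> = ?e")
        case False
        then have "gen_refl s \<alpha> \<in> ?N v" using \<alpha> gen_refl_pos[OF s(1)] rw by auto
        then show ?thesis using gen_refl_gen_refl[OF s(1), of \<alpha>]
          by (intro insertI2 image_eqI[of _ _ "gen_refl s \<alpha>"]) simp_all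
      qed simp
    next
      fix \<alpha> assume "\<alpha> \<in> insert ?e (gen_refl s ` ?N v)"
      then consider "\<alpha> = ?e" | \<beta> where "\<beta> \<in> ?N v" "\<alpha> = gen_refl s \<beta>" by blast
      then show "\<alpha> \<in> ?N w"
      proof cases
        case 1
        have "rep w ?e = - rep v ?e" using rw s v by (simp add: gen_refl_self rep_minus)
        then show ?thesis using 1 minus_pos[OF ve] unit_pos[OF s(1)] by simp
      next
        case 2
        then have "\<beta> \<noteq> ?e" using ve by auto
        then show ?thesis using 2 gen_refl_pos[OF s(1)] rw gen_refl_gen_refl[OF s(1)] by simp
      qed
    qed
    moreover have "?e \<notin> gen_refl s ` ?N v"
    proof
      assume "?e \<in> gen_refl s ` ?N v"
      then obtain \<beta> where "\<beta> \<in> pos_roots" "?e = gen_refl s \<beta>" by blast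
      then have "\<beta> = - ?e" using gen_refl_gen_refl[OF s(1), of \<beta>] gen_refl_self[OF s(1)] by simp
      then show False using minus_pos[OF unit_pos[OF s(1)]] \<open>\<beta> \<in> pos_roots\<close> by simp
    qed
    moreover have "inj_on (gen_refl s) (?N v)" by (rule inj_on_inverseI[of _ "gen_refl s"]) (rule gen_refl_gen_refl[OF s(1)])
    ultimately have "card (?N w) = Suc (card (?N v))"
      using finite_pos_roots by (simp add: card_image)
    then show ?thesis using less.hyps[OF _ v(1)] lv(1) by simp
  qed
qed

text \<open>
  An element that acts trivially has no inversions, hence length zero.
\<close>

lemma rep_faithful:
  assumes "x \<in> carrier W" "y \<in> carrier W" "\<And>f. rep x f = rep y f" shows "x = y"
proof -
  have c: "inv x \<otimes> y \<in> carrier W" using assms by simp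
  have "rep (inv x \<otimes> y) f = f" for f using assms by (simp add: rep_mult rep_inv flip: assms(3))
  then have "len (inv x \<otimes> y) = 0" using len_eq_inversions[OF c] by simp
  then have "inv x \<otimes> y = \<one>" using len_0[OF c] by simp
  then show ?thesis using assms by (metis inv_closed inv_equality inv_inv inv_solve_left' l_inv m_closed r_one)
qed

section \<open>Reflections and the Bruhat order\<close>

definition refl_root :: "'a \<Rightarrow> ('a \<Rightarrow> real) \<Rightarrow> bool" where
  "refl_root r \<beta> \<longleftrightarrow> r \<in> carrier W \<and> \<beta> \<in> pos_roots \<and> rep r = euclid.refl \<beta>"

lemma refl_minus_root: "euclid.refl (- \<beta>) f = euclid.refl \<beta> f"
  by (simp add: euclid.refl_def euclid.b_minus)

lemma reflection_root: assumes "r \<in> reflections W S" obtains \<beta> where "refl_root r \<beta>"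
proof -
  obtain x s where x: "x \<in> carrier W" "s \<in> S" "r = x \<otimes> s \<otimes> inv x" using assms by (auto simp: reflections_def)
  let ?\<beta> = "rep x (unit_vector s)"
  have "rep r = euclid.refl ?\<beta>"
    using x S_carrier by (auto simp: fun_eq_iff refl_rep refl_unit rep_mult rep_S)
  moreover have "?\<beta> \<in> roots" using x by (auto simp: roots_def)
  then have "?\<beta> \<in> pos_roots \<or> - ?\<beta> \<in> pos_roots" using simple_system_base by (simp add: euclid.simple_system_def)
  moreover have "r \<in> carrier W" using x S_carrier by simp
  moreover have "euclid.refl (- ?\<beta>) = euclid.refl ?\<beta>" by (rule ext) (rule refl_minus_root)
  ultimately show ?thesis using that unfolding refl_root_def by metis
qed

lemma refl_root_nz: "refl_root r \<beta> \<Longrightarrow> bform \<beta> \<beta> \<noteq> 0"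
  using euclid.root_nz[OF root_set_roots] by (simp add: refl_root_def pos_roots_D)

lemma refl_root_unique: "refl_root r \<beta> \<Longrightarrow> refl_root r' \<beta> \<Longrightarrow> r = r'"
  unfolding refl_root_def by (metis rep_faithful)

lemma refl_root_square: "refl_root r \<beta> \<Longrightarrow> r \<otimes> r = \<one>"
proof -
  assume r: "refl_root r \<beta>"
  then have "rep (r \<otimes> r) f = rep \<one> f" for f
    using euclid.refl_refl[OF refl_root_nz[OF r]] by (simp add: rep_mult refl_root_def)
  then show ?thesis using r by (intro rep_faithful) (auto simp: refl_root_def)
qed

lemma refl_root_S: "s \<in> S \<Longrightarrow> refl_root s (unit_vector s)"
  by (auto simp: refl_root_def S_carrier unit_pos rep_S refl_unit fun_eq_iff)

lemma refl_root_conj: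
  assumes "refl_root r \<beta>" "x \<in> carrier W" "rep x \<beta> \<in> pos_roots"
  shows "refl_root (x \<otimes> r \<otimes> inv x) (rep x \<beta>)"
proof -
  have r: "r \<in> carrier W" "rep r = euclid.refl \<beta>" using assms(1) by (auto simp: refl_root_def)
  have "rep (x \<otimes> r \<otimes> inv x) = euclid.refl (rep x \<beta>)"
    using assms(2) r(1) by (intro ext) (simp add: refl_rep rep_mult flip: r(2))
  then show ?thesis using assms r by (simp add: refl_root_def)
qed

text \<open>
  The strong exchange condition. Write \<open>w = sv\<close> with \<open>v\<close> shorter. Either \<open>v \<beta>\<close> is already negative, or the sign changes when
  \<open>s\<close> is applied; then \<open>v \<beta>\<close> is the root of \<open>s\<close>, so \<open>v r v\<^sup>-\<^sup>1 = s\<close> and \<open>w r = v\<close>.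
\<close>

lemma len_reflection_less:
  assumes "refl_root r \<beta>" "w \<in> carrier W" "rep w \<beta> \<notin> pos_roots" shows "len (w \<otimes> r) < len w"
  using assms(2,3)
proof (induction "len w" arbitrary: w rule: less_induct)
  case less
  note w = less.prems(1)
  have r: "r \<in> carrier W" "\<beta> \<in> pos_roots" using assms(1) by (auto simp: refl_root_def)
  have "w \<noteq> \<one>" using less.prems(2) r by auto
  then have "inv w \<noteq> \<one>" using w by (metis inv_inv inv_one)
  then obtain s where s: "s \<in> S" "len (inv w) = Suc (len (inv w \<otimes> s))" using descent_exists[of "inv w"] w by auto
  define v where "v = s \<otimes> w"
  have v: "v \<in> carrier W" "w = s \<otimes> v" using s w S_carrier by (simp_all add: v_def S_cancel)
  have "inv v = inv w \<otimes> s" using w s S_carrier by (simp add: v_def inv_mult_group)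
  then have lv: "len w = Suc (len v)" using s len_inv[OF w] len_inv[OF v(1)] by simp
  show ?case
  proof (cases "rep v \<beta> \<in> pos_roots")
    case False
    then have "len (v \<otimes> r) < len v" using less.hyps[of v] lv v(1) by simp
    moreover have "len (w \<otimes> r) \<le> len s + len (v \<otimes> r)"
      using len_mult[of s "v \<otimes> r"] v r s S_carrier by (simp add: m_assoc)
    ultimately show ?thesis using lv len_S[OF s(1)] by linarith
  next
    case True
    have "rep w \<beta> = gen_refl s (rep v \<beta>)" using v s S_carrier by (simp add: rep_mult rep_S)
    then have e: "rep v \<beta> = unit_vector s" using gen_refl_pos[OF s(1) True] less.prems(2) by auto
    have "v \<otimes> r \<otimes> inv v = s"
      using refl_root_conj[OF assms(1) v(1) True] refl_root_S[OF s(1)] refl_root_unique e by metis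
    then have "v \<otimes> r = w" using v r s S_carrier by (metis inv_solve_right m_closed)
    then have "w \<otimes> r = v" using refl_root_square[OF assms(1)] v r by (metis m_assoc r_one)
    then show ?thesis using lv by simp
  qed
qed

lemma len_reflection_greater:
  assumes "refl_root r \<beta>" "w \<in> carrier W" "rep w \<beta> \<in> pos_roots" shows "len w < len (w \<otimes> r)"
proof -
  have r: "r \<in> carrier W" "rep r \<beta> = - \<beta>"
    using assms(1) euclid.refl_self[OF refl_root_nz[OF assms(1)]] by (auto simp: refl_root_def)
  have "rep (w \<otimes> r) \<beta> = - rep w \<beta>" using r assms by (simp add: rep_mult rep_minus)
  then have "rep (w \<otimes> r) \<beta> \<notin> pos_roots" using minus_pos assms(3) by simp
  then have "len (w \<otimes> r \<otimes> r) < len (w \<otimes> r)" using len_reflection_less[OF assms(1)] r assms(2) by simp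
  then show ?thesis using refl_root_square[OF assms(1)] r assms(2) by (simp add: m_assoc)
qed

lemma len_reflection_iff:
  assumes "refl_root r \<beta>" "w \<in> carrier W" shows "len w < len (w \<otimes> r) \<longleftrightarrow> rep w \<beta> \<in> pos_roots"
  using len_reflection_less[OF assms] len_reflection_greater[OF assms] by linarith

lemma reflection_conj:
  assumes "r \<in> reflections W S" "x \<in> carrier W" shows "x \<otimes> r \<otimes> inv x \<in> reflections W S"
proof -
  obtain y s where y: "y \<in> carrier W" "s \<in> S" "r = y \<otimes> s \<otimes> inv y" using assms by (auto simp: reflections_def)
  have "x \<otimes> r \<otimes> inv x = (x \<otimes> y) \<otimes> s \<otimes> inv (x \<otimes> y)"
    using y assms S_carrier by (simp add: m_assoc inv_mult_group)
  then show ?thesis using y assms unfolding reflections_def by blast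
qed

lemma S_reflection: "s \<in> S \<Longrightarrow> s \<in> reflections W S"
  unfolding reflections_def using S_carrier by (intro CollectI exI[of _ \<one>] exI[of _ s]) simp

abbreviation ble :: "'a \<Rightarrow> 'a \<Rightarrow> bool" (infix "\<preceq>" 50) where "x \<preceq> y \<equiv> bruhat_le W S x y"

lemma bruhat_step_carrier: "bruhat_step W S x y \<Longrightarrow> x \<in> carrier W \<and> y \<in> carrier W"
  using reflection_root by (auto simp: bruhat_step_def refl_root_def)

text \<open>
  For \<open>y = x r\<close> one has \<open>y s = (x s) (s r s)\<close>. If \<open>\<beta>\<close> is the positive root of \<open>r \<noteq> s\<close>, then \<open>s \<beta>\<close> is the positive root of
  \<open>s r s\<close>, and \<open>x s\<close> maps it to the same root as \<open>x\<close> maps \<open>\<beta>\<close>. So both steps go up or both go down.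
\<close>

lemma bruhat_step_mult_S:
  assumes st: "bruhat_step W S x y" and s: "s \<in> S"
  shows "y = x \<otimes> s \<or> bruhat_step W S (x \<otimes> s) (y \<otimes> s)"
proof -
  obtain r where r: "r \<in> reflections W S" "y = x \<otimes> r" "x \<in> carrier W" "len x < len y"
    using st by (auto simp: bruhat_step_def)
  obtain \<beta> where \<beta>: "refl_root r \<beta>" using reflection_root[OF r(1)] .
  have rc: "r \<in> carrier W" using \<beta> by (simp add: refl_root_def)
  show ?thesis
  proof (cases "\<beta> = unit_vector s")
    case True
    then have "r = s" using \<beta> refl_root_S[OF s] refl_root_unique by metis
    then show ?thesis using r by simp
  next
    case False
    have sb: "rep s \<beta> \<in> pos_roots" using gen_refl_pos[OF s _ False] \<beta> by (simp add: refl_root_def rep_S[OF s])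
    have c: "refl_root (s \<otimes> r \<otimes> inv s) (rep s \<beta>)" by (rule refl_root_conj[OF \<beta> S_carrier[OF s] sb])
    have "rep x \<beta> \<in> pos_roots" using len_reflection_iff[OF \<beta> r(3)] r by simp
    moreover have "rep (x \<otimes> s) (rep s \<beta>) = rep x \<beta>"
      using r s S_carrier by (simp add: rep_mult rep_S gen_refl_gen_refl)
    ultimately have "len (x \<otimes> s) < len (x \<otimes> s \<otimes> (s \<otimes> r \<otimes> inv s))"
      using len_reflection_iff[OF c, of "x \<otimes> s"] r s S_carrier by simp
    moreover have "x \<otimes> s \<otimes> (s \<otimes> r \<otimes> inv s) = y \<otimes> s"
      using r rc s S_carrier by (simp add: m_assoc S_cancel)
    moreover have "s \<otimes> r \<otimes> inv s \<in> reflections W S" using reflection_conj[OF r(1)] S_carrier[OF s] by simp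
    ultimately show ?thesis unfolding bruhat_step_def using r(3) S_carrier[OF s] by (metis m_closed)
  qed
qed

lemma ble_refl [simp]: "x \<preceq> x"
  by (simp add: bruhat_le_def)

lemma ble_trans: "x \<preceq> y \<Longrightarrow> y \<preceq> z \<Longrightarrow> x \<preceq> z"
  by (simp add: bruhat_le_def)

lemma ble_len: "x \<preceq> y \<Longrightarrow> x = y \<or> len x < len y"
  unfolding bruhat_le_def by (induction rule: rtranclp_induct) (auto simp: bruhat_step_def)

lemma ble_S: "x \<in> carrier W \<Longrightarrow> s \<in> S \<Longrightarrow> len x < len (x \<otimes> s) \<Longrightarrow> x \<preceq> x \<otimes> s"
  unfolding bruhat_le_def bruhat_step_def using S_reflection by blast

text \<open>
  Multiply a chain from \<open>x\<close> to \<open>y\<close> by \<open>s\<close>. Each step is either preserved or is of the form \<open>z \<rightarrow> zs\<close>. If no step has the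
  second form, the whole chain is preserved. Otherwise preserve the chain up to the first such step or after the last one.
  All usual forms of the lifting property follow by comparing \<open>x\<close> with \<open>xs\<close> and \<open>y\<close> with \<open>ys\<close>.
\<close>

theorem bruhat_lifting:
  assumes "x \<preceq> y" "x \<in> carrier W" "s \<in> S"
  shows "x \<otimes> s \<preceq> y \<otimes> s \<or> (x \<otimes> s \<preceq> y \<and> x \<preceq> y \<otimes> s)"
  using assms(1) unfolding bruhat_le_def
proof (induction rule: rtranclp_induct)
  case base
  show ?case by simp
next
  case (step y z)
  have y: "y \<in> carrier W" using bruhat_step_carrier step by blast
  consider "z = y \<otimes> s" | "bruhat_step W S (y \<otimes> s) (z \<otimes> s)" using bruhat_step_mult_S[OF step.hyps(2) assms(3)] by blast
  then show ?case
  proof cases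
    case 1
    then have "z \<otimes> s = y" using y assms by (simp add: S_cancel)
    then show ?thesis using step 1 by (auto intro: rtranclp.rtrancl_into_rtrancl)
  next
    case 2
    then show ?thesis using step by (auto intro: rtranclp.rtrancl_into_rtrancl)
  qed
qed

lemma ble_inv:
  assumes "x \<preceq> y" shows "inv x \<preceq> inv y"
  using assms unfolding bruhat_le_def
proof (induction rule: rtranclp_induct)
  case (step y z)
  obtain r where r: "r \<in> reflections W S" "z = y \<otimes> r" "y \<in> carrier W" "len y < len z"
    using step by (auto simp: bruhat_step_def)
  obtain \<beta> where \<beta>: "refl_root r \<beta>" using reflection_root[OF r(1)] .
  have rc: "r \<in> carrier W" "inv r = r" using \<beta> refl_root_square[OF \<beta>] inv_equality by (auto simp: refl_root_def)
  have "inv z = inv y \<otimes> (y \<otimes> r \<otimes> inv y)" using r rc by (simp add: inv_mult_group m_assoc[symmetric])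
  moreover have "len (inv y) < len (inv z)" using r rc by (simp add: len_inv)
  ultimately have "bruhat_step W S (inv y) (inv z)"
    unfolding bruhat_step_def using reflection_conj[OF r(1,3)] r(3) by blast
  then show ?case using step by simp
qed simp

lemma lift_up_right:
  assumes "x \<preceq> y" "x \<in> carrier W" "y \<in> carrier W" "s \<in> S" "len (y \<otimes> s) < len y" shows "x \<otimes> s \<preceq> y"
  using bruhat_lifting[OF assms(1,2,4)] ble_S[of "y \<otimes> s" s] assms S_carrier by (auto simp: S_cancel intro: ble_trans)

lemma lift_both_right:
  assumes "x \<preceq> y" "x \<in> carrier W" "y \<in> carrier W" "s \<in> S" "len y < len (y \<otimes> s)" shows "x \<otimes> s \<preceq> y \<otimes> s"
  using bruhat_lifting[OF assms(1,2,4)] ble_S[OF assms(3-5)] by (auto intro: ble_trans)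

lemma lift_down_right:
  assumes "x \<preceq> y" "x \<in> carrier W" "y \<in> carrier W" "s \<in> S" "len x < len (x \<otimes> s)" shows "x \<preceq> y \<otimes> s"
  using bruhat_lifting[OF assms(1,2,4)] ble_S[OF assms(2,4,5)] by (auto intro: ble_trans)

lemma len_left: "x \<in> carrier W \<Longrightarrow> s \<in> S \<Longrightarrow> len (s \<otimes> x) = len (inv x \<otimes> s)"
  using len_inv[of "s \<otimes> x"] S_carrier by (simp add: inv_mult_group)

lemma ble_inv_iff: "x \<in> carrier W \<Longrightarrow> y \<in> carrier W \<Longrightarrow> inv x \<preceq> inv y \<longleftrightarrow> x \<preceq> y"
  using ble_inv by force

lemma lift_up_left:
  assumes "x \<preceq> y" "x \<in> carrier W" "y \<in> carrier W" "s \<in> S" "len (s \<otimes> y) < len y" shows "s \<otimes> x \<preceq> y"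
  using lift_up_right[of "inv x" "inv y" s] ble_inv[of "inv x \<otimes> s" "inv y"] assms S_carrier
  by (simp add: ble_inv_iff len_left len_inv inv_mult_group)

lemma lift_both_left:
  assumes "x \<preceq> y" "x \<in> carrier W" "y \<in> carrier W" "s \<in> S" "len y < len (s \<otimes> y)" shows "s \<otimes> x \<preceq> s \<otimes> y"
  using lift_both_right[of "inv x" "inv y" s] ble_inv[of "inv x \<otimes> s" "inv y \<otimes> s"] assms S_carrier
  by (simp add: ble_inv_iff len_left len_inv inv_mult_group)

lemma lift_down_left:
  assumes "x \<preceq> y" "x \<in> carrier W" "y \<in> carrier W" "s \<in> S" "len x < len (s \<otimes> x)" shows "x \<preceq> s \<otimes> y"
  using lift_down_right[of "inv x" "inv y" s] ble_inv[of "inv x" "inv y \<otimes> s"] assms S_carrier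
  by (simp add: ble_inv_iff len_left len_inv inv_mult_group)

end


section \<open>Ascent within a twisted conjugacy class\<close>

locale twisted_coxeter = coxeter +
  fixes \<delta> :: "'a \<Rightarrow> 'a"
  assumes iso: "\<delta> \<in> iso W W" and delta_S: "\<delta> ` S = S"
begin

lemma delta_carrier [simp]: "x \<in> carrier W \<Longrightarrow> \<delta> x \<in> carrier W"
  using iso by (auto simp: iso_def hom_def)

lemma delta_mult [simp]: "x \<in> carrier W \<Longrightarrow> y \<in> carrier W \<Longrightarrow> \<delta> (x \<otimes> y) = \<delta> x \<otimes> \<delta> y"
  using iso by (auto simp: iso_def hom_def)

lemma delta_inj: "inj_on \<delta> (carrier W)"
  using iso by (auto simp: iso_def bij_betw_def)

lemma delta_surj: "\<delta> ` carrier W = carrier W"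
  using iso by (auto simp: iso_def bij_betw_def)

lemma delta_in_S [simp]: "s \<in> S \<Longrightarrow> \<delta> s \<in> S"
  using delta_S by auto

lemma delta_inj_S: "inj_on \<delta> S"
  using delta_inj S_carrier by (metis inj_on_subset subsetI)

lemma delta_one [simp]: "\<delta> \<one> = \<one>"
  using delta_mult[of \<one> \<one>] delta_carrier[of \<one>] by (metis l_cancel_one' l_one one_closed)

lemma delta_inv [simp]: "x \<in> carrier W \<Longrightarrow> \<delta> (inv x) = inv (\<delta> x)"
  by (metis delta_carrier delta_mult delta_one inv_closed inv_equality l_inv)

lemma delta_pow: "x \<in> carrier W \<Longrightarrow> \<delta> (x [^] (n::nat)) = \<delta> x [^] n"
  by (induction n) auto

lemma delta_ord: "x \<in> carrier W \<Longrightarrow> ord (\<delta> x) = ord x"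
proof -
  assume x: "x \<in> carrier W"
  have "\<delta> x [^] n = \<one> \<longleftrightarrow> x [^] n = \<one>" for n :: nat
    using x delta_pow[OF x, of n] inj_onD[OF delta_inj, of "x [^] n" \<one>] by auto
  then show ?thesis using x ord_unique[of "\<delta> x" "ord x"] pow_eq_id[of x] by simp
qed

lemma delta_wprod: "ws \<in> lists S \<Longrightarrow> wprod (map \<delta> ws) = \<delta> (wprod ws)"
  by (induction ws) (auto simp: S_carrier)

text \<open>
  The automorphism \<open>\<delta>\<close> as a permutation of the coordinates. Outside \<open>S\<close> the coordinates are left alone, so that the
  map is invertible on all functions.
\<close>

definition dperm :: "('a \<Rightarrow> real) \<Rightarrow> ('a \<Rightarrow> real)" where
  "dperm f = (\<lambda>i. if i \<in> S then f (inv_into S \<delta> i) else f i)"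

definition dperm' :: "('a \<Rightarrow> real) \<Rightarrow> ('a \<Rightarrow> real)" where
  "dperm' f = (\<lambda>i. if i \<in> S then f (\<delta> i) else f i)"

lemma dperm_at: "s \<in> S \<Longrightarrow> dperm f (\<delta> s) = f s"
  by (simp add: dperm_def inv_into_f_f[OF delta_inj_S])

lemma dperm_inverse: "dperm (dperm' f) = f" "dperm' (dperm f) = f"
  using delta_S by (auto simp: fun_eq_iff dperm_def dperm'_def inv_into_f_f[OF delta_inj_S] f_inv_into_f inv_into_into)

lemma linear_dperm: "linear dperm" "linear dperm'"
  by (rule linearI; simp add: fun_eq_iff dperm_def dperm'_def pointwise)+

lemma dperm_unit: "s \<in> S \<Longrightarrow> dperm (unit_vector s) = unit_vector (\<delta> s)"
proof (rule ext)
  fix i assume s: "s \<in> S"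
  show "dperm (unit_vector s) i = unit_vector (\<delta> s) i"
  proof (cases "i \<in> S")
    case True
    then obtain j where j: "j \<in> S" "i = \<delta> j" using delta_S by blast
    then show ?thesis using s inj_onD[OF delta_inj_S, of j s] by (auto simp: dperm_at unit_vector_def)
  next
    case False
    then have "i \<noteq> s" "i \<noteq> \<delta> s" using s by auto
    then show ?thesis using False by (simp add: dperm_def unit_vector_def)
  qed
qed

lemma dperm_E: "f \<in> euclid.E \<Longrightarrow> dperm f \<in> euclid.E" "f \<in> euclid.E \<Longrightarrow> dperm' f \<in> euclid.E"
  by (simp_all add: euclid.E_def dperm_def dperm'_def)

lemma bij_delta_S: "bij_betw \<delta> S S"
  using delta_inj_S delta_S by (simp add: bij_betw_def)

lemma pairing_dperm: "s \<in> S \<Longrightarrow> pairing (dperm f) (\<delta> s) = pairing f s"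
proof -
  assume s: "s \<in> S"
  have "pairing (dperm f) (\<delta> s) = (\<Sum>t\<in>S. dperm f (\<delta> t) * cartan (\<delta> t) (\<delta> s))"
    unfolding pairing_def by (rule sum.reindex_bij_betw[OF bij_delta_S, symmetric])
  also have "\<dots> = pairing f s"
    unfolding pairing_def
  proof (rule sum.cong[OF HOL.refl])
    fix t assume t: "t \<in> S"
    have "ord (\<delta> t \<otimes> \<delta> s) = ord (t \<otimes> s)" using delta_ord[of "t \<otimes> s"] s t S_carrier by simp
    then show "dperm f (\<delta> t) * cartan (\<delta> t) (\<delta> s) = f t * cartan t s" using t by (simp add: dperm_at cartan_def)
  qed
  finally show ?thesis .
qed

lemma dperm_gen_refl: "s \<in> S \<Longrightarrow> dperm (gen_refl s f) = gen_refl (\<delta> s) (dperm f)"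
  using linear_dperm(1) by (simp add: gen_refl_def linear_diff linear_scale dperm_unit pairing_dperm)

lemma dperm_act: "ws \<in> lists S \<Longrightarrow> dperm (act ws f) = act (map \<delta> ws) (dperm f)"
  by (induction ws) (auto simp: dperm_gen_refl)

lemma dperm_rep: "w \<in> carrier W \<Longrightarrow> dperm (rep w f) = rep (\<delta> w) (dperm f)"
proof -
  assume w: "w \<in> carrier W"
  obtain ws where ws: "ws \<in> lists S" "wprod ws = w" using word_exists[OF w] by blast
  have "map \<delta> ws \<in> lists S" using ws(1) by auto
  then have "rep (\<delta> w) = act (map \<delta> ws)" using rep_word[of "map \<delta> ws"] ws delta_wprod by simp
  then show ?thesis using dperm_act[OF ws(1), of f] rep_word[OF ws(1)] ws(2) by simp
qed

lemma bform_dperm: "bform (dperm u) (dperm v) = bform u v"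
proof -
  have bij: "bij_betw \<delta> (carrier W) (carrier W)" using delta_inj delta_surj by (simp add: bij_betw_def)
  have "bform (dperm u) (dperm v) = (\<Sum>w\<in>carrier W. \<Sum>s\<in>S. rep (\<delta> w) (dperm u) s * rep (\<delta> w) (dperm v) s)"
    unfolding bform_def by (rule sum.reindex_bij_betw[OF bij, symmetric])
  also have "\<dots> = (\<Sum>w\<in>carrier W. \<Sum>s\<in>S. dperm (rep w u) s * dperm (rep w v) s)"
    by (intro sum.cong HOL.refl) (simp add: dperm_rep)
  also have "\<dots> = (\<Sum>w\<in>carrier W. \<Sum>s\<in>S. dperm (rep w u) (\<delta> s) * dperm (rep w v) (\<delta> s))"
    by (intro sum.cong HOL.refl sum.reindex_bij_betw[OF bij_delta_S, symmetric])
  also have "\<dots> = bform u v" by (simp add: bform_def dperm_at)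
  finally show ?thesis .
qed

lemma dperm_pos: "dperm ` pos_roots = pos_roots"
proof -
  have "dperm \<alpha> \<in> pos_roots" if "\<alpha> \<in> pos_roots" for \<alpha>
  proof -
    have "\<alpha> \<in> roots" "\<And>i. 0 \<le> \<alpha> i" using that by (auto simp: pos_roots_iff)
    then obtain w s where w: "w \<in> carrier W" "s \<in> S" "\<alpha> = rep w (unit_vector s)" by (auto simp: roots_def)
    have "dperm \<alpha> \<in> roots" using w by (simp add: dperm_rep dperm_unit rep_roots unit_roots)
    moreover have "0 \<le> dperm \<alpha> i" for i using \<open>\<And>i. 0 \<le> \<alpha> i\<close> by (simp add: dperm_def)
    ultimately show ?thesis by (simp add: pos_roots_iff)
  qed
  moreover have "inj_on dperm pos_roots" by (rule inj_on_inverseI[of _ dperm']) (rule dperm_inverse)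
  ultimately show ?thesis using endo_inj_surj[OF finite_pos_roots] by blast
qed

text \<open>
  Crossing the wall \<open>x e\<^sub>s\<close> of the chamber of \<open>x\<close> leads to the chamber of \<open>xs\<close>.
\<close>

lemma chamber_step:
  assumes "x \<in> carrier W" "s \<in> S"
  shows "euclid.refl (rep x (unit_vector s)) ` rep x ` A = rep (x \<otimes> s) ` A"
  using assms S_carrier by (auto simp: image_image refl_rep rep_inv refl_unit rep_mult rep_S intro!: image_cong)

lemma chamber_simple:
  assumes "x \<in> carrier W"
  shows "euclid.simple_system roots (rep x ` base) \<and> euclid.pos roots (rep x ` base) = rep x ` pos_roots"
proof -
  obtain ws where ws: "ws \<in> lists S" "wprod ws = x" using word_exists[OF assms] by blast
  have "ws \<in> lists S \<Longrightarrow> euclid.simple_system roots (rep (wprod ws) ` base) \<and>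
      euclid.pos roots (rep (wprod ws) ` base) = rep (wprod ws) ` pos_roots"
  proof (induction ws rule: rev_induct)
    case Nil
    have "rep \<one> ` A = A" for A by simp
    then show ?case using simple_system_base by simp
  next
    case (snoc s ws)
    then have s: "s \<in> S" "ws \<in> lists S" by auto
    let ?x = "wprod ws"
    let ?\<beta> = "rep ?x (unit_vector s)"
    have x: "?x \<in> carrier W" using s by simp
    have \<beta>: "?\<beta> \<in> roots" using s x by (intro rep_roots unit_roots)
    have e: "wprod (ws @ [s]) = ?x \<otimes> s" using s S_carrier by (simp add: wprod_append)
    have IH: "euclid.simple_system roots (rep ?x ` base)" "euclid.pos roots (rep ?x ` base) = rep ?x ` pos_roots"
      using snoc.IH s by auto
    show ?case
      using euclid.refl_simple_system[OF root_set_roots IH(1) \<beta>] euclid.pos_refl_image[OF root_set_roots IH(1) \<beta>] IH(2)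
      unfolding e by (simp only: chamber_step[OF x s(1)])
  qed
  then show ?thesis using ws by blast
qed

definition up_step :: "'a \<Rightarrow> 'a \<Rightarrow> bool" where
  "up_step w w' \<longleftrightarrow> (\<exists>s\<in>S. w' = s \<otimes> w \<otimes> \<delta> s \<and> len w \<le> len w')"

text \<open>
  Apply \<open>reach_maximal_descents\<close> to the isometry \<open>g = w\<delta>\<close>. A root \<open>x \<gamma>\<close> is sent by \<open>g\<close> to \<open>x (x\<^sup>-\<^sup>1 w \<delta>(x)) \<delta>(\<gamma>)\<close>, so the
  descents of the chamber of \<open>x\<close> correspond to the inversions of \<open>x\<^sup>-\<^sup>1 w \<delta>(x)\<close>, and the wall crossings \<open>x \<rightarrow> xs\<close> to the
  steps by \<open>s\<close>. The chambers of the group elements are simple systems, so \<open>M\<close> bounds the lengths in the whole class.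
\<close>

theorem ascend_to_maximal:
  assumes w: "w \<in> carrier W"
  shows "\<exists>w'. up_step\<^sup>*\<^sup>* w w' \<and> w' \<in> carrier W \<and> (\<forall>y\<in>carrier W. len (y \<otimes> w' \<otimes> inv (\<delta> y)) \<le> len w')"
proof -
  define g where "g v = rep w (dperm v)" for v
  define h where "h v = dperm' (rep (inv w) v)" for v
  interpret tw: euclidean_isometry S bform g h
  proof (rule euclidean_isometry.intro[OF euclid.euclidean_form_axioms], rule euclidean_isometry_axioms.intro)
    have "g = rep w \<circ> dperm" "h = dperm' \<circ> rep (inv w)" by (auto simp: g_def h_def)
    then show "linear g" "linear h" 
      using linear_compose[OF linear_dperm(1) linear_rep[OF w]] linear_compose[OF linear_rep[of "inv w"] linear_dperm(2)] w
      by simp_all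
    show gh: "g (h v) = v" and "h (g v) = v" for v using w by (simp_all add: g_def h_def dperm_inverse rep_inv)
    show "bform (g u) v = bform u (h v)" for u v
    proof -
      have "bform (g u) v = bform (dperm u) (rep (inv w) v)" unfolding g_def by (rule bform_rep_shift[OF w])
      also have "\<dots> = bform (dperm u) (dperm (h v))" by (simp add: h_def dperm_inverse)
      finally show ?thesis by (simp add: bform_dperm)
    qed
    show "v \<in> euclid.E \<Longrightarrow> g v \<in> euclid.E" for v unfolding g_def by (intro rep_E w dperm_E)
    show "v \<in> euclid.E \<Longrightarrow> h v \<in> euclid.E" for v unfolding h_def using w by (intro rep_E dperm_E) auto
  qed
  let ?ch = "\<lambda>x. rep x ` base"
  define conj where "conj x = inv x \<otimes> w \<otimes> \<delta> x" for x
  have fin: "finite roots" using euclid.root_setD(1)[OF root_set_roots] .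
  have "g \<alpha> \<in> roots" if \<alpha>: "\<alpha> \<in> roots" for \<alpha>
  proof -
    obtain x s where "x \<in> carrier W" "s \<in> S" "\<alpha> = rep x (unit_vector s)" using \<alpha> by (auto simp: roots_def)
    then show ?thesis using w by (simp add: g_def dperm_rep dperm_unit rep_roots unit_roots)
  qed
  moreover have "inj_on g roots" by (rule inj_on_inverseI[of _ h]) (rule tw.hg)
  ultimately have st: "g ` roots = roots" using endo_inj_surj[OF fin] by blast
  have len: "euclid.descents g roots (?ch x) = len (conj x)" if x: "x \<in> carrier W" for x
  proof -
    have c: "conj x \<in> carrier W" using x w by (simp add: conj_def)
    have mem: "g (rep x \<alpha>) \<in> rep x ` pos_roots \<longleftrightarrow> rep (conj x) (dperm \<alpha>) \<in> pos_roots" for \<alpha>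
    proof -
      have "g (rep x \<alpha>) = rep x (rep (conj x) (dperm \<alpha>))"
        using x w by (simp add: g_def conj_def dperm_rep rep_mult rep_inv)
      moreover have "inj (rep x)" by (rule inj_on_inverseI[of _ "rep (inv x)"]) (rule rep_inv(1)[OF x])
      ultimately show ?thesis by (simp add: inj_image_mem_iff)
    qed
    have "euclid.descents g roots (?ch x) = card {\<alpha> \<in> rep x ` pos_roots. g \<alpha> \<notin> rep x ` pos_roots}"
      using chamber_simple[OF x] by (simp add: euclid.descents_def)
    also have "{\<alpha> \<in> rep x ` pos_roots. g \<alpha> \<notin> rep x ` pos_roots} = rep x ` {\<alpha> \<in> pos_roots. rep (conj x) (dperm \<alpha>) \<notin> pos_roots}"
      using mem by blast
    also have "card \<dots> = card {\<alpha> \<in> pos_roots. rep (conj x) (dperm \<alpha>) \<notin> pos_roots}"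
      by (intro card_image inj_on_inverseI[of _ "rep (inv x)"]) (rule rep_inv(1)[OF x])
    also have "\<dots> = card (dperm ` {\<alpha> \<in> pos_roots. rep (conj x) (dperm \<alpha>) \<notin> pos_roots})"
      by (intro card_image[symmetric] inj_on_inverseI[of _ dperm']) (rule dperm_inverse)
    also have "dperm ` {\<alpha> \<in> pos_roots. rep (conj x) (dperm \<alpha>) \<notin> pos_roots} = {\<gamma> \<in> dperm ` pos_roots. rep (conj x) \<gamma> \<notin> pos_roots}"
      by blast
    also have "card \<dots> = len (conj x)" unfolding dperm_pos by (rule len_eq_inversions[OF c, symmetric])
    finally show ?thesis .
  qed
  obtain M where M: "\<And>\<Delta>. euclid.simple_system roots \<Delta> \<Longrightarrow> \<exists>\<Delta>'\<in>tw.reach roots \<Delta>. euclid.descents g roots \<Delta>' = M"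
    using tw.reach_maximal_descents[OF root_set_roots st] by blast
  have bound: "len (conj x) \<le> M" if x: "x \<in> carrier W" for x
  proof -
    obtain \<Delta>' where \<Delta>': "(euclid.ascent_step g roots)\<^sup>*\<^sup>* (?ch x) \<Delta>'" "euclid.descents g roots \<Delta>' = M"
      using M[of "?ch x"] chamber_simple[OF x] by (auto simp: tw.reach_def)
    from \<Delta>'(1) have "euclid.descents g roots (?ch x) \<le> euclid.descents g roots \<Delta>'"
      by (induction rule: rtranclp_induct) (auto simp: euclid.ascent_step_def)
    then show ?thesis using len[OF x] \<Delta>'(2) by simp
  qed
  have track: "\<exists>x\<in>carrier W. \<Delta>' = ?ch x \<and> up_step\<^sup>*\<^sup>* w (conj x)"
    if "(euclid.ascent_step g roots)\<^sup>*\<^sup>* base \<Delta>'" for \<Delta>'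
    using that
  proof (induction rule: rtranclp_induct)
    case base
    have "base = ?ch \<one>" by simp
    moreover have "conj \<one> = w" using w by (simp add: conj_def)
    ultimately show ?case by (intro bexI[of _ \<one>]) auto
  next
    case (step \<Delta>1 \<Delta>2)
    then obtain x where x: "x \<in> carrier W" "\<Delta>1 = ?ch x" "up_step\<^sup>*\<^sup>* w (conj x)" by blast
    obtain s where s: "s \<in> S" "\<Delta>2 = euclid.refl (rep x (unit_vector s)) ` \<Delta>1" "euclid.descents g roots \<Delta>1 \<le> euclid.descents g roots \<Delta>2"
      using step.hyps(2) x(2) by (auto simp: euclid.ascent_step_def base_def)
    have xs: "x \<otimes> s \<in> carrier W" using x s S_carrier by simp
    have 2: "\<Delta>2 = ?ch (x \<otimes> s)" using s(2) x chamber_step[OF x(1) s(1)] by simp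
    have "conj (x \<otimes> s) = s \<otimes> conj x \<otimes> \<delta> s"
      using x s w S_carrier by (simp add: conj_def inv_mult_group m_assoc)
    moreover have "len (conj x) \<le> len (conj (x \<otimes> s))" using s(3) len[OF x(1)] len[OF xs] x(2) 2 by simp
    ultimately have "up_step (conj x) (conj (x \<otimes> s))" using s(1) by (auto simp: up_step_def)
    then have "up_step\<^sup>*\<^sup>* w (conj (x \<otimes> s))" using x(3) by simp
    then show ?case using xs 2 by blast
  qed
  obtain \<Delta>' where "(euclid.ascent_step g roots)\<^sup>*\<^sup>* base \<Delta>'" "euclid.descents g roots \<Delta>' = M"
    using M[OF simple_system_base] by (auto simp: tw.reach_def)
  then obtain x where x: "x \<in> carrier W" "up_step\<^sup>*\<^sup>* w (conj x)" "len (conj x) = M"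
    using track len by metis
  have "len (y \<otimes> conj x \<otimes> inv (\<delta> y)) \<le> len (conj x)" if y: "y \<in> carrier W" for y
  proof -
    have "y \<otimes> conj x \<otimes> inv (\<delta> y) = conj (x \<otimes> inv y)"
      using x y w by (simp add: conj_def inv_mult_group m_assoc)
    then show ?thesis using bound[of "x \<otimes> inv y"] x y by simp
  qed
  moreover have "conj x \<in> carrier W" using x w by (simp add: conj_def)
  ultimately show ?thesis using x(2) by blast
qed

end


section \<open>Linear combinations of a finite family\<close>

locale complex_vs =
  fixes V :: "(complex, 'h, 'n) module_scheme" (structure)
  assumes vectorspace: "vectorspace complex_field V"
begin

sublocale vs: vectorspace complex_field V
  by (rule vectorspace)

lemma smult_rules [simp]:
  "x \<in> carrier V \<Longrightarrow> c \<odot> x \<in> carrier V"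
  "x \<in> carrier V \<Longrightarrow> 1 \<odot> x = x"
  "x \<in> carrier V \<Longrightarrow> 0 \<odot> x = \<zero>"
  using vs.smult_closed[of c x] vs.smult_one[of x] vs.smult_l_null[of x] by simp_all

lemma smult_distrib:
  "x \<in> carrier V \<Longrightarrow> (c + d) \<odot> x = c \<odot> x \<oplus> d \<odot> x"
  "x \<in> carrier V \<Longrightarrow> y \<in> carrier V \<Longrightarrow> c \<odot> (x \<oplus> y) = c \<odot> x \<oplus> c \<odot> y"
  "x \<in> carrier V \<Longrightarrow> (c * d) \<odot> x = c \<odot> (d \<odot> x)"
  using vs.smult_l_distr[of c d x] vs.smult_r_distr[of c x y] vs.smult_assoc1[of c d x] by simp_all

definition comb :: "'i set \<Rightarrow> ('i \<Rightarrow> 'h) \<Rightarrow> ('i \<Rightarrow> complex) \<Rightarrow> 'h" where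
  "comb I b a = (\<Oplus>i\<in>I. a i \<odot> b i)"

context
  fixes I :: "'i set" and b :: "'i \<Rightarrow> 'h"
  assumes b: "b \<in> I \<rightarrow> carrier V"
begin

lemma family_carrier [simp]: "i \<in> I \<Longrightarrow> b i \<in> carrier V"
  using b by auto

lemma comb_closed [simp]: "comb I b a \<in> carrier V"
  unfolding comb_def using b by (intro vs.M.finsum_closed) auto

lemma comb_add: "comb I b (\<lambda>i. a i + c i) = comb I b a \<oplus> comb I b c"
proof -
  have "comb I b (\<lambda>i. a i + c i) = (\<Oplus>i\<in>I. a i \<odot> b i \<oplus> c i \<odot> b i)"
    unfolding comb_def using b by (intro vs.M.finsum_cong') (auto simp: smult_distrib)
  also have "\<dots> = comb I b a \<oplus> comb I b c"
    unfolding comb_def using b by (intro vs.M.finsum_addf) auto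
  finally show ?thesis .
qed

lemma comb_smult: "finite I \<Longrightarrow> comb I b (\<lambda>i. r * a i) = r \<odot> comb I b a"
proof -
  assume fin: "finite I"
  have "r \<odot> comb I b a = (\<Oplus>i\<in>I. r \<odot> (a i \<odot> b i))"
    unfolding comb_def using fin b by (intro vs.finsum_smult_ldistr) auto
  also have "\<dots> = comb I b (\<lambda>i. r * a i)"
    unfolding comb_def using b by (intro vs.M.finsum_cong') (auto simp: smult_distrib)
  finally show ?thesis by simp
qed

lemma comb_cong: "(\<And>i. i \<in> I \<Longrightarrow> a i = c i) \<Longrightarrow> comb I b a = comb I b c"
  unfolding comb_def using b by (intro vs.M.finsum_cong') auto

lemma comb_zero: "comb I b (\<lambda>i. 0) = \<zero>"
proof -
  have "comb I b (\<lambda>i. 0) = (\<Oplus>i\<in>I. \<zero>)"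
    unfolding comb_def using b by (intro vs.M.finsum_cong') auto
  then show ?thesis by simp
qed

lemma comb_minus: "comb I b (\<lambda>i. - a i) = \<ominus> comb I b a"
proof -
  have "comb I b (\<lambda>i. - a i) \<oplus> comb I b a = \<zero>"
    using comb_add[of "\<lambda>i. - a i" a] comb_zero by simp
  then show ?thesis by (intro vs.M.minus_equality[symmetric]) simp_all
qed

lemma comb_subset:
  assumes "finite I" "J \<subseteq> I"
  shows "comb I b (\<lambda>i. if i \<in> J then 1 else 0) = (\<Oplus>j\<in>J. b j)"
proof -
  have "(\<Oplus>j\<in>J. b j) = comb I b (\<lambda>i. if i \<in> J then 1 else 0)"
    unfolding comb_def using assms b
    by (intro vs.M.add.finprod_mono_neutral_cong_left) (auto simp: Pi_iff subset_iff)
  then show ?thesis by simp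
qed

lemma lincomb_image:
  assumes "inj_on b I" shows "vs.lincomb c (b ` I) = comb I b (c \<circ> b)"
  unfolding vs.lincomb_def comb_def using assms b
  by (subst vs.M.add.finprod_reindex) (auto simp: Pi_iff)

end

lemma basis_familyI:
  assumes fin: "finite I" and U: "U \<subseteq> carrier V" and b: "b \<in> I \<rightarrow> U" and inj: "inj_on b I"
    and indep: "\<And>a. comb I b a = \<zero> \<Longrightarrow> \<forall>i\<in>I. a i = 0"
    and span: "\<And>u. u \<in> U \<Longrightarrow> \<exists>a. u = comb I b a"
    and closed: "\<And>a. comb I b a \<in> U"
  shows "basis_family V U I b"
proof -
  have bc: "b \<in> I \<rightarrow> carrier V" using U b by auto
  have im: "b ` I \<subseteq> carrier V" using bc by auto
  have "\<not> vs.lin_dep (b ` I)"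
  proof (rule vs.finite_lin_indpt2)
    fix a assume "vs.lincomb a (b ` I) = \<zero>"
    then have "\<forall>i\<in>I. (a \<circ> b) i = 0" using indep[of "a \<circ> b"] lincomb_image[OF bc inj] by simp
    then show "\<forall>v\<in>b ` I. a v = \<zero>\<^bsub>complex_field\<^esub>" by simp
  qed (use fin im in auto)
  moreover have "vs.span (b ` I) = U"
  proof -
    have "vs.span (b ` I) = {vs.lincomb a (b ` I) |a. a \<in> b ` I \<rightarrow> carrier complex_field}"
      using fin im by (intro vs.finite_span) auto
    also have "\<dots> = {comb I b (a \<circ> b) |a. True}" using lincomb_image[OF bc inj] by auto
    also have "\<dots> = U"
    proof (intro equalityI subsetI)
      fix u assume "u \<in> U"
      then obtain a where a: "u = comb I b a" using span by blast
      have "comb I b a = comb I b ((a \<circ> inv_into I b) \<circ> b)"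
        using inj by (intro comb_cong[OF bc]) simp
      then show "u \<in> {comb I b (a \<circ> b) |a. True}" using a by blast
    qed (use closed in auto)
    finally show ?thesis .
  qed
  ultimately show ?thesis using b inj by (simp add: basis_family_def)
qed

lemma basis_familyD:
  assumes fin: "finite I" and B: "basis_family V (carrier V) I b"
  shows "b \<in> I \<rightarrow> carrier V" "comb I b a = \<zero> \<Longrightarrow> i \<in> I \<Longrightarrow> a i = 0"
    "h \<in> carrier V \<Longrightarrow> \<exists>a. h = comb I b a"
proof -
  show b: "b \<in> I \<rightarrow> carrier V" using B by (simp add: basis_family_def)
  have inj: "inj_on b I" using B by (simp add: basis_family_def)
  have im: "b ` I \<subseteq> carrier V" using b by auto
  show "a i = 0" if z: "comb I b a = \<zero>" and i: "i \<in> I"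
  proof (rule ccontr)
    assume ne: "a i \<noteq> 0"
    let ?c = "a \<circ> inv_into I b"
    have "vs.lincomb ?c (b ` I) = comb I b a"
      unfolding lincomb_image[OF b inj] using inj by (intro comb_cong[OF b]) simp
    then have "vs.lin_dep (b ` I)"
      using fin z ne i inj by (intro vs.lin_dep_crit[of "b ` I" "b ` I" ?c "b i"]) auto
    then show False using B by (simp add: basis_family_def)
  qed
  show "\<exists>a. h = comb I b a" if h: "h \<in> carrier V"
  proof -
    have "vs.span (b ` I) = {vs.lincomb a (b ` I) |a. a \<in> b ` I \<rightarrow> carrier complex_field}"
      using fin im by (intro vs.finite_span) auto
    then have "h \<in> {vs.lincomb a (b ` I) |a. a \<in> b ` I \<rightarrow> carrier complex_field}"
      using h B by (simp add: basis_family_def)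
    then show ?thesis using lincomb_image[OF b inj] by auto
  qed
qed

end

context twisted_coxeter
begin

section \<open>Classes of elements of maximal length\<close>

lemma twisted_conj_rel_iff:
  "(w, w') \<in> twisted_conj_rel W \<delta> \<longleftrightarrow> w \<in> carrier W \<and> (\<exists>x\<in>carrier W. w' = x \<otimes> w \<otimes> inv (\<delta> x))"
  by (simp add: twisted_conj_rel_def)

lemma equiv_twisted_conj: "equiv (carrier W) (twisted_conj_rel W \<delta>)"
proof (rule equivI)
  show "twisted_conj_rel W \<delta> \<subseteq> carrier W \<times> carrier W" by (auto simp: twisted_conj_rel_iff)
  show "refl_on (carrier W) (twisted_conj_rel W \<delta>)"
    by (auto simp: refl_on_def twisted_conj_rel_iff intro!: bexI[of _ \<one>])
  show "sym (twisted_conj_rel W \<delta>)"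
  proof (rule symI)
    fix w w' assume "(w, w') \<in> twisted_conj_rel W \<delta>"
    then obtain x where x: "w \<in> carrier W" "x \<in> carrier W" "w' = x \<otimes> w \<otimes> inv (\<delta> x)"
      by (auto simp: twisted_conj_rel_iff)
    then have "w = inv x \<otimes> w' \<otimes> inv (\<delta> (inv x))" by (simp add: m_assoc) (simp add: m_assoc[symmetric])
    then show "(w', w) \<in> twisted_conj_rel W \<delta>" using x by (auto simp: twisted_conj_rel_iff intro!: bexI[of _ "inv x"])
  qed
  show "trans (twisted_conj_rel W \<delta>)"
  proof (rule transI)
    fix u v w assume "(u, v) \<in> twisted_conj_rel W \<delta>" "(v, w) \<in> twisted_conj_rel W \<delta>"
    then obtain x y where x: "u \<in> carrier W" "x \<in> carrier W" "v = x \<otimes> u \<otimes> inv (\<delta> x)"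
      and y: "y \<in> carrier W" "w = y \<otimes> v \<otimes> inv (\<delta> y)" by (auto simp: twisted_conj_rel_iff)
    then have "w = (y \<otimes> x) \<otimes> u \<otimes> inv (\<delta> (y \<otimes> x))" by (simp add: m_assoc inv_mult_group)
    then show "(u, w) \<in> twisted_conj_rel W \<delta>" using x y by (auto simp: twisted_conj_rel_iff intro!: bexI[of _ "y \<otimes> x"])
  qed
qed

lemma twisted_max_iff:
  "w \<in> twisted_max W S \<delta> \<longleftrightarrow> w \<in> carrier W \<and> (\<forall>y\<in>carrier W. len (y \<otimes> w \<otimes> inv (\<delta> y)) \<le> len w)"
proof -
  let ?r = "twisted_conj_rel W \<delta>"
  have "w \<in> twisted_max W S \<delta> \<longleftrightarrow> (\<exists>C\<in>carrier W // ?r. w \<in> C \<and> (\<forall>v\<in>C. len v \<le> len w))"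
    by (auto simp: twisted_max_def twisted_classes_def max_length_elems_def)
  also have "\<dots> \<longleftrightarrow> w \<in> carrier W \<and> (\<forall>v\<in>?r `` {w}. len v \<le> len w)"
  proof
    assume "\<exists>C\<in>carrier W // ?r. w \<in> C \<and> (\<forall>v\<in>C. len v \<le> len w)"
    then obtain C where C: "C \<in> carrier W // ?r" "w \<in> C" "\<forall>v\<in>C. len v \<le> len w" by blast
    have wc: "w \<in> carrier W" using in_quotient_imp_subset[OF equiv_twisted_conj C(1)] C(2) by blast
    have "C = ?r `` {w}"
      using quotient_eqI[OF equiv_twisted_conj C(1) quotientI[OF wc] C(2)] wc
        equiv_class_self[OF equiv_twisted_conj wc] equiv_twisted_conj by (auto simp: equiv_def refl_on_def)
    then show "w \<in> carrier W \<and> (\<forall>v\<in>?r `` {w}. len v \<le> len w)" using C wc by simp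
  next
    assume "w \<in> carrier W \<and> (\<forall>v\<in>?r `` {w}. len v \<le> len w)"
    then show "\<exists>C\<in>carrier W // ?r. w \<in> C \<and> (\<forall>v\<in>C. len v \<le> len w)"
      using equiv_class_self[OF equiv_twisted_conj] by (intro bexI[of _ "?r `` {w}"]) (auto intro: quotientI)
  qed
  also have "\<dots> \<longleftrightarrow> w \<in> carrier W \<and> (\<forall>y\<in>carrier W. len (y \<otimes> w \<otimes> inv (\<delta> y)) \<le> len w)"
    by (auto simp: twisted_conj_rel_iff Image_singleton)
  finally show ?thesis .
qed

lemma twisted_max_step:
  assumes "w \<in> twisted_max W S \<delta>" "s \<in> S" shows "len (s \<otimes> w \<otimes> \<delta> s) \<le> len w"
  using assms S_carrier[OF assms(2)] by (force simp: twisted_max_iff)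

lemma step_carrier: "w \<in> carrier W \<Longrightarrow> s \<in> S \<Longrightarrow> s \<otimes> w \<otimes> \<delta> s \<in> carrier W"
  by (simp add: S_carrier)

lemma step_back: "w \<in> carrier W \<Longrightarrow> s \<in> S \<Longrightarrow> s \<otimes> (s \<otimes> w \<otimes> \<delta> s) \<otimes> \<delta> s = w"
  by (simp add: S_carrier m_assoc S_cancel)

lemma arrow_conj:
  assumes "twisted_arrow W S \<delta> w v" "w \<in> carrier W"
  shows "(w, v) \<in> twisted_conj_rel W \<delta> \<and> len v \<le> len w"
  using assms(1) unfolding twisted_arrow_def
proof (induction rule: rtranclp_induct)
  case base
  then show ?case using assms(2) equiv_twisted_conj by (auto simp: equiv_def refl_on_def)
next
  case (step v u)
  then obtain s where s: "s \<in> S" "u = s \<otimes> v \<otimes> \<delta> s" "len u \<le> len v" by (auto simp: twisted_step_def)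
  have "v \<in> carrier W" using step equiv_twisted_conj by (auto simp: equiv_def)
  then have "(v, u) \<in> twisted_conj_rel W \<delta>"
    using s S_carrier by (auto simp: twisted_conj_rel_iff intro!: bexI[of _ s])
  then have "(w, u) \<in> twisted_conj_rel W \<delta>" using step equiv_twisted_conj by (meson equivE transD)
  then show ?case using step s by auto
qed

abbreviation max_classes :: "'a set set" where "max_classes \<equiv> twisted_max_classes W S \<delta>"

lemma equiv_approx: "equiv (carrier W) (twisted_approx_rel W S \<delta>)"
  by (rule equivI) (auto simp: twisted_approx_rel_def twisted_arrow_def refl_on_def sym_def trans_def)

lemma class_of: "w \<in> twisted_max W S \<delta> \<Longrightarrow> \<exists>\<Sigma>\<in>max_classes. w \<in> \<Sigma>"
  unfolding twisted_max_classes_def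
  by (intro bexI[of _ "twisted_approx_rel W S \<delta> `` {w}"] equiv_class_self[OF equiv_approx] quotientI)
    (simp_all add: twisted_max_iff)

lemma class_elems:
  assumes "\<Sigma> \<in> max_classes" "w \<in> \<Sigma>"
  shows "\<Sigma> = twisted_approx_rel W S \<delta> `` {w}" "w \<in> twisted_max W S \<delta>"
proof -
  obtain v where v: "v \<in> twisted_max W S \<delta>" "\<Sigma> = twisted_approx_rel W S \<delta> `` {v}"
    using assms(1) by (auto simp: twisted_max_classes_def quotient_def)
  then have vw: "(v, w) \<in> twisted_approx_rel W S \<delta>" using assms(2) by simp
  then show "\<Sigma> = twisted_approx_rel W S \<delta> `` {w}" using v(2) equiv_class_eq[OF equiv_approx] by blast
  have a: "twisted_arrow W S \<delta> v w" "twisted_arrow W S \<delta> w v" "v \<in> carrier W" "w \<in> carrier W"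
    using vw by (auto simp: twisted_approx_rel_def)
  have len: "len v = len w" using arrow_conj[OF a(1,3)] arrow_conj[OF a(2,4)] by simp
  have "len (y \<otimes> w \<otimes> inv (\<delta> y)) \<le> len w" if y: "y \<in> carrier W" for y
  proof -
    obtain x where x: "x \<in> carrier W" "w = x \<otimes> v \<otimes> inv (\<delta> x)"
      using arrow_conj[OF a(1,3)] by (auto simp: twisted_conj_rel_iff)
    have "y \<otimes> w \<otimes> inv (\<delta> y) = (y \<otimes> x) \<otimes> v \<otimes> inv (\<delta> (y \<otimes> x))"
      using x y a by (simp add: m_assoc inv_mult_group)
    moreover have "len ((y \<otimes> x) \<otimes> v \<otimes> inv (\<delta> (y \<otimes> x))) \<le> len v"
      using v(1) x(1) y unfolding twisted_max_iff by (metis m_closed)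
    ultimately show ?thesis using len by simp
  qed
  then show "w \<in> twisted_max W S \<delta>" using a by (simp add: twisted_max_iff)
qed

lemma class_carrier: "\<Sigma> \<in> max_classes \<Longrightarrow> w \<in> \<Sigma> \<Longrightarrow> w \<in> carrier W"
  using class_elems(2) twisted_max_iff by blast

lemma class_nonempty: "\<Sigma> \<in> max_classes \<Longrightarrow> \<Sigma> \<noteq> {}"
proof -
  assume "\<Sigma> \<in> max_classes"
  then obtain v where v: "v \<in> twisted_max W S \<delta>" "\<Sigma> = twisted_approx_rel W S \<delta> `` {v}"
    by (auto simp: twisted_max_classes_def quotient_def)
  then have "v \<in> \<Sigma>" using equiv_class_self[OF equiv_approx, of v] by (simp add: twisted_max_iff)
  then show ?thesis by blast
qed

lemma class_unique: "\<Sigma> \<in> max_classes \<Longrightarrow> \<Sigma>' \<in> max_classes \<Longrightarrow> w \<in> \<Sigma> \<Longrightarrow> w \<in> \<Sigma>' \<Longrightarrow> \<Sigma> = \<Sigma>'"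
  using class_elems(1) by metis

lemma class_arrow: "\<Sigma> \<in> max_classes \<Longrightarrow> w \<in> \<Sigma> \<Longrightarrow> v \<in> \<Sigma> \<Longrightarrow> twisted_arrow W S \<delta> w v"
  using class_elems(1)[of \<Sigma> w] by (auto simp: twisted_approx_rel_def)

lemma class_len: "\<Sigma> \<in> max_classes \<Longrightarrow> w \<in> \<Sigma> \<Longrightarrow> v \<in> \<Sigma> \<Longrightarrow> len w = len v"
  using arrow_conj class_arrow class_carrier by (meson le_antisym)

lemma finite_classes: "finite max_classes"
proof (rule finite_subset)
  show "max_classes \<subseteq> Pow (carrier W)" using class_carrier by blast
qed (use finite_W in simp)

lemma class_step:
  assumes "\<Sigma> \<in> max_classes" "w \<in> \<Sigma>" "s \<in> S" "len w \<le> len (s \<otimes> w \<otimes> \<delta> s)"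
  shows "s \<otimes> w \<otimes> \<delta> s \<in> \<Sigma>"
proof -
  let ?v = "s \<otimes> w \<otimes> \<delta> s"
  have w: "w \<in> carrier W" using class_carrier assms by blast
  have "len ?v \<le> len w" using twisted_max_step class_elems(2) assms by blast
  then have "twisted_step W S \<delta> w ?v" using assms(3) by (auto simp: twisted_step_def)
  moreover have "twisted_step W S \<delta> ?v w"
    unfolding twisted_step_def using assms(3,4) step_back[OF w assms(3)] by (intro bexI[of _ s]) simp_all
  ultimately have "(w, ?v) \<in> twisted_approx_rel W S \<delta>"
    using w step_carrier[OF w assms(3)] by (auto simp: twisted_approx_rel_def twisted_arrow_def)
  then show ?thesis using class_elems(1)[OF assms(1,2)] by blast
qed

lemma len_left_cases:
  assumes "w \<in> carrier W" "s \<in> S"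
  obtains "len (s \<otimes> w) = Suc (len w)" | "len w = Suc (len (s \<otimes> w))"
  using len_mult_S_cases[of "inv w" s] assms by (auto simp: len_left len_inv)

text \<open>
  Since \<open>w\<close> is longest in its class, \<open>s w \<delta>(s)\<close> cannot be two longer than \<open>w\<close>. So after going up by \<open>s\<close> on the left one comes
  down by \<open>\<delta>(s)\<close> on the right, to an element of the same class.
\<close>

lemma class_left_ascent:
  assumes "\<Sigma> \<in> max_classes" "w \<in> \<Sigma>" "s \<in> S" "len w < len (s \<otimes> w)"
  shows "s \<otimes> w \<otimes> \<delta> s \<in> \<Sigma>" "len (s \<otimes> w \<otimes> \<delta> s) < len (s \<otimes> w)"
proof -
  have w: "w \<in> carrier W" "s \<otimes> w \<in> carrier W" using class_carrier assms S_carrier by auto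
  have le: "len (s \<otimes> w \<otimes> \<delta> s) \<le> len w" using twisted_max_step class_elems(2) assms by blast
  then show "len (s \<otimes> w \<otimes> \<delta> s) < len (s \<otimes> w)" using assms(4) by simp
  have "len w \<le> len (s \<otimes> w \<otimes> \<delta> s)"
    by (rule len_mult_S_cases[OF w(2) delta_in_S[OF assms(3)]]) (use assms(4) in linarith)+
  then show "s \<otimes> w \<otimes> \<delta> s \<in> \<Sigma>" using class_step assms by blast
qed

lemma class_right_ascent:
  assumes "\<Sigma> \<in> max_classes" "w \<in> \<Sigma>" "s \<in> S" "len w < len (w \<otimes> \<delta> s)"
  shows "s \<otimes> (w \<otimes> \<delta> s) \<in> \<Sigma>" "len (s \<otimes> (w \<otimes> \<delta> s)) < len (w \<otimes> \<delta> s)"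
proof -
  have w: "w \<in> carrier W" "w \<otimes> \<delta> s \<in> carrier W" using class_carrier assms S_carrier by auto
  have eq: "s \<otimes> (w \<otimes> \<delta> s) = s \<otimes> w \<otimes> \<delta> s" using w assms S_carrier by (simp add: m_assoc)
  have le: "len (s \<otimes> (w \<otimes> \<delta> s)) \<le> len w" unfolding eq using twisted_max_step class_elems(2) assms by blast
  then show "len (s \<otimes> (w \<otimes> \<delta> s)) < len (w \<otimes> \<delta> s)" using assms(4) by simp
  have "len w \<le> len (s \<otimes> (w \<otimes> \<delta> s))"
    by (rule len_left_cases[OF w(2) assms(3)]) (use assms(4) in linarith)+
  then show "s \<otimes> (w \<otimes> \<delta> s) \<in> \<Sigma>" unfolding eq using class_step assms by blast
qed

section \<open>The equations of the twisted centre\<close>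

text \<open>
  The coefficient at \<open>t\<^sub>u\<close> of \<open>t\<^sub>s h\<close>, where \<open>h\<close> has the coefficients \<open>a\<close>: contributions come from \<open>t\<^bsub>su\<^esub>\<close> with sign plus and
  from \<open>t\<^sub>u\<close> with sign minus, provided that \<open>su\<close> is shorter than \<open>u\<close>.
\<close>

definition coeff_left :: "'a \<Rightarrow> ('a \<Rightarrow> complex) \<Rightarrow> 'a \<Rightarrow> complex" where
  "coeff_left s a u = (if len (s \<otimes> u) < len u then a (s \<otimes> u) - a u else 0)"

definition coeff_right :: "('a \<Rightarrow> complex) \<Rightarrow> 'a \<Rightarrow> 'a \<Rightarrow> complex" where
  "coeff_right a s u = (if len (u \<otimes> s) < len u then a (u \<otimes> s) - a u else 0)"

definition central :: "('a \<Rightarrow> complex) \<Rightarrow> bool" where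
  "central a \<longleftrightarrow> (\<forall>s\<in>S. \<forall>u\<in>carrier W. coeff_left s a u = coeff_right a (\<delta> s) u)"

lemma central_diff_sum:
  assumes "central a" "\<And>i. i \<in> F \<Longrightarrow> central (e i)"
  shows "central (\<lambda>w. a w - (\<Sum>i\<in>F. c i * e i w))"
proof -
  have L: "coeff_left s (\<lambda>w. a w - (\<Sum>i\<in>F. c i * e i w)) u = coeff_left s a u - (\<Sum>i\<in>F. c i * coeff_left s (e i) u)" for s u
    by (simp add: coeff_left_def sum_subtractf algebra_simps)
  have R: "coeff_right (\<lambda>w. a w - (\<Sum>i\<in>F. c i * e i w)) s u = coeff_right a s u - (\<Sum>i\<in>F. c i * coeff_right (e i) s u)" for s u
    by (simp add: coeff_right_def sum_subtractf algebra_simps)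
  show ?thesis unfolding central_def L R using assms by (auto simp: central_def intro!: sum.cong)
qed

definition below :: "'a set \<Rightarrow> 'a \<Rightarrow> complex" where
  "below \<Sigma> w = (if w \<in> lower_set W S \<Sigma> then 1 else 0)"

lemma lower_iff: "x \<in> carrier W \<Longrightarrow> x \<in> lower_set W S \<Sigma> \<longleftrightarrow> (\<exists>w\<in>\<Sigma>. x \<preceq> w)"
  by (simp add: lower_set_def)

lemma lower_down: "x \<preceq> y \<Longrightarrow> x \<in> carrier W \<Longrightarrow> y \<in> lower_set W S \<Sigma> \<Longrightarrow> x \<in> lower_set W S \<Sigma>"
  using ble_trans by (auto simp: lower_set_def)

lemma ble_S_left: "x \<in> carrier W \<Longrightarrow> s \<in> S \<Longrightarrow> len x < len (s \<otimes> x) \<Longrightarrow> x \<preceq> s \<otimes> x"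
  using ble_S[of "inv x" s] ble_inv[of "inv x" "inv x \<otimes> s"] S_carrier by (simp add: len_left len_inv inv_mult_group)

text \<open>
  Let \<open>su < u\<close> and \<open>su \<le> w\<close> with \<open>w \<in> \<Sigma>\<close>. If \<open>sw < w\<close>, then \<open>u \<le> w\<close>. If \<open>sw > w\<close>, then \<open>u \<le> sw\<close>, and \<open>sw\<close> comes down on the right
  to \<open>s w \<delta>(s) \<in> \<Sigma>\<close>. By lifting on the right, whichever of \<open>u\<close> and \<open>u \<delta>(s)\<close> is the shorter one is below
  \<open>s w \<delta>(s)\<close>. The other case is symmetric, and together they yield the equation at \<open>u\<close>.
\<close>

theorem central_below:
  assumes \<Sigma>: "\<Sigma> \<in> max_classes" shows "central (below \<Sigma>)"
  unfolding central_def
proof (intro ballI)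
  fix s u assume s: "s \<in> S" and u: "u \<in> carrier W"
  let ?L = "lower_set W S \<Sigma>"
  let ?s = "\<delta> s"
  have c: "s \<in> carrier W" "?s \<in> S" "?s \<in> carrier W" "s \<otimes> u \<in> carrier W" "u \<otimes> ?s \<in> carrier W"
    using s u S_carrier by auto
  have su: "s \<otimes> (s \<otimes> u) = u" "u \<otimes> ?s \<otimes> ?s = u" using s u c by (simp_all add: S_cancel)
  have left: "(u \<otimes> ?s \<in> ?L \<and> len (u \<otimes> ?s) < len u) \<or> (u \<in> ?L)"
    if L: "s \<otimes> u \<in> ?L" "len (s \<otimes> u) < len u" "len (u \<otimes> ?s) < len u \<or> len u < len (u \<otimes> ?s)"
  proof -
    obtain w where w: "w \<in> \<Sigma>" "s \<otimes> u \<preceq> w" using L(1) c by (auto simp: lower_iff)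
    have wc: "w \<in> carrier W" using class_carrier \<Sigma> w by blast
    consider "len w < len (s \<otimes> w)" | "len (s \<otimes> w) < len w" using len_left_cases[OF wc s] by (metis lessI)
    then show ?thesis
    proof cases
      case 1
      have uw: "u \<preceq> s \<otimes> w" using lift_both_left[OF w(2) c(4) wc s 1] su by simp
      have sw: "s \<otimes> w \<in> carrier W" using wc c by simp
      note asc = class_left_ascent[OF \<Sigma> w(1) s 1]
      show ?thesis
      proof (cases "len u < len (u \<otimes> ?s)")
        case True
        have "u \<preceq> s \<otimes> w \<otimes> ?s" by (rule lift_down_right[OF uw u sw c(2) True])
        then show ?thesis using asc(1) u by (auto simp: lower_iff)
      next
        case False
        then have lt: "len (u \<otimes> ?s) < len u" using that(3) by simp
        then have "u \<otimes> ?s \<preceq> u" using ble_S[OF c(5,2)] su by simp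
        then have "u \<otimes> ?s \<preceq> s \<otimes> w" using uw ble_trans by blast
        then have "u \<otimes> ?s \<preceq> s \<otimes> w \<otimes> ?s" using lift_down_right[OF _ c(5) sw c(2)] lt su by simp
        then show ?thesis using asc(1) c(5) lt by (auto simp: lower_iff)
      qed
    next
      case 2
      have "u \<preceq> w" using lift_up_left[OF w(2) c(4) wc s 2] su by simp
      then show ?thesis using w u by (auto simp: lower_iff)
    qed
  qed
  have right: "(s \<otimes> u \<in> ?L \<and> len (s \<otimes> u) < len u) \<or> (u \<in> ?L)"
    if L: "u \<otimes> ?s \<in> ?L" "len (u \<otimes> ?s) < len u" "len (s \<otimes> u) < len u \<or> len u < len (s \<otimes> u)"
  proof -
    obtain w where w: "w \<in> \<Sigma>" "u \<otimes> ?s \<preceq> w" using L(1) c by (auto simp: lower_iff)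
    have wc: "w \<in> carrier W" using class_carrier \<Sigma> w by blast
    consider "len w < len (w \<otimes> ?s)" | "len (w \<otimes> ?s) < len w" using len_mult_S_cases[OF wc c(2)] by (metis lessI)
    then show ?thesis
    proof cases
      case 1
      have uw: "u \<preceq> w \<otimes> ?s" using lift_both_right[OF w(2) c(5) wc c(2) 1] su by simp
      have ws: "w \<otimes> ?s \<in> carrier W" using wc c by simp
      note asc = class_right_ascent[OF \<Sigma> w(1) s 1]
      show ?thesis
      proof (cases "len u < len (s \<otimes> u)")
        case True
        have "u \<preceq> s \<otimes> (w \<otimes> ?s)" by (rule lift_down_left[OF uw u ws s True])
        then show ?thesis using asc(1) u by (auto simp: lower_iff)
      next
        case False
        then have lt: "len (s \<otimes> u) < len u" using that(3) by simp
        then have "s \<otimes> u \<preceq> u" using ble_S_left[OF c(4) s] su by simp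
        then have "s \<otimes> u \<preceq> w \<otimes> ?s" using uw ble_trans by blast
        then have "s \<otimes> u \<preceq> s \<otimes> (w \<otimes> ?s)" using lift_down_left[OF _ c(4) ws s] lt su by simp
        then show ?thesis using asc(1) c(4) lt by (auto simp: lower_iff)
      qed
    next
      case 2
      have "u \<preceq> w" using lift_up_right[OF w(2) c(5) wc c(2) 2] su by simp
      then show ?thesis using w u by (auto simp: lower_iff)
    qed
  qed
  have dl: "s \<otimes> u \<in> ?L" if "u \<in> ?L" "len (s \<otimes> u) < len u"
    using lower_down[OF _ c(4) that(1)] ble_S_left[OF c(4) s] su that(2) by simp
  have dr: "u \<otimes> ?s \<in> ?L" if "u \<in> ?L" "len (u \<otimes> ?s) < len u"
    using lower_down[OF _ c(5) that(1)] ble_S[OF c(5,2)] su that(2) by simp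
  have tri: "len (s \<otimes> u) < len u \<or> len u < len (s \<otimes> u)" "len (u \<otimes> ?s) < len u \<or> len u < len (u \<otimes> ?s)"
    using len_left_cases[OF u s] len_mult_S_cases[OF u c(2)] by (metis lessI)+
  show "coeff_left s (below \<Sigma>) u = coeff_right (below \<Sigma>) ?s u"
    using left right dl dr tri unfolding coeff_left_def coeff_right_def below_def by auto
qed

text \<open>
  If \<open>sv\<close> or \<open>v \<delta>(s)\<close> is longer than \<open>v\<close>, the equation at that longer element compares \<open>v\<close> with \<open>s v \<delta>(s)\<close>. If both are shorter,
  the lifting property shows that \<open>s v \<delta>(s) = v\<close>.
\<close>

lemma central_const_step:
  assumes a: "central a" and v: "v \<in> carrier W" and s: "s \<in> S" and eq: "len (s \<otimes> v \<otimes> \<delta> s) = len v"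
  shows "a (s \<otimes> v \<otimes> \<delta> s) = a v"
proof -
  let ?s = "\<delta> s"
  have c: "s \<in> carrier W" "?s \<in> S" "?s \<in> carrier W" "s \<otimes> v \<in> carrier W" "v \<otimes> ?s \<in> carrier W"
    using s v S_carrier by auto
  have cancel: "s \<otimes> (s \<otimes> v) = v" "v \<otimes> ?s \<otimes> ?s = v" "s \<otimes> (v \<otimes> ?s) = s \<otimes> v \<otimes> ?s"
    using s v c by (simp_all add: S_cancel m_assoc)
  have ce: "coeff_left s a u = coeff_right a ?s u" if "u \<in> carrier W" for u using a s that by (simp add: central_def)
  show ?thesis
  proof (cases "len v < len (s \<otimes> v)")
    case True
    then show ?thesis using ce[OF c(4)] eq cancel by (simp add: coeff_left_def coeff_right_def)
  next
    case F1: False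
    show ?thesis
    proof (cases "len v < len (v \<otimes> ?s)")
      case True
      then show ?thesis using ce[OF c(5)] eq cancel by (simp add: coeff_left_def coeff_right_def)
    next
      case False
      have sv: "len (s \<otimes> v) < len v" using F1 len_left_cases[OF v s] by (metis lessI)
      have vs: "len (v \<otimes> ?s) < len v" using False len_mult_S_cases[OF v c(2)] by (metis lessI)
      have "s \<otimes> v \<preceq> v" using ble_S_left[OF c(4) s] sv cancel by simp
      then have "s \<otimes> v \<otimes> ?s \<preceq> v \<otimes> ?s \<or> s \<otimes> v \<otimes> ?s \<preceq> v" using bruhat_lifting[OF _ c(4,2)] by blast
      then have "s \<otimes> v \<otimes> ?s = v" using ble_len vs eq by fastforce
      then show ?thesis by simp
    qed
  qed
qed

text \<open>
  The longer element is \<open>sv\<close> or \<open>s v \<delta>(s)\<close>. The equation at \<open>sv\<close> compares \<open>a(v)\<close> with one of these two values.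
\<close>

lemma central_rise:
  assumes a: "central a" and v: "v \<in> carrier W" and s: "s \<in> S" and lt: "len v < len (s \<otimes> v \<otimes> \<delta> s)"
  shows "a (s \<otimes> v) = a v \<and> len v < len (s \<otimes> v) \<or> a (s \<otimes> v \<otimes> \<delta> s) = a v"
proof -
  let ?s = "\<delta> s"
  have c: "s \<in> carrier W" "?s \<in> S" "s \<otimes> v \<in> carrier W" using s v S_carrier by auto
  have cancel: "s \<otimes> (s \<otimes> v) = v" using s v by (simp add: S_cancel)
  consider "len v < len (s \<otimes> v)" | "len v = Suc (len (s \<otimes> v))" using len_left_cases[OF v s] by (metis lessI)
  then show ?thesis
  proof cases
    case 1
    have "coeff_left s a (s \<otimes> v) = coeff_right a ?s (s \<otimes> v)" using a s c by (simp add: central_def)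
    then have "a v - a (s \<otimes> v) = coeff_right a ?s (s \<otimes> v)" using 1 cancel by (simp add: coeff_left_def)
    moreover have "coeff_right a ?s (s \<otimes> v) = 0 \<or> coeff_right a ?s (s \<otimes> v) = a (s \<otimes> v \<otimes> ?s) - a (s \<otimes> v)"
      by (simp add: coeff_right_def)
    ultimately show ?thesis using 1 by auto
  next
    case 2
    then show ?thesis using len_mult_S[OF c(3,2)] lt by simp
  qed
qed

text \<open>
  Ascend from \<open>w\<close> to an element of maximal length. The value of \<open>a\<close> stays the same as long as the length does, and the
  length can never increase: an increase would give a longer element of the support.
\<close>

lemma central_top:
  assumes a: "central a" and w: "w \<in> carrier W" "a w \<noteq> 0"
    and top: "\<And>v. v \<in> carrier W \<Longrightarrow> len w < len v \<Longrightarrow> a v = 0"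
  shows "w \<in> twisted_max W S \<delta>"
proof -
  obtain w' where w': "up_step\<^sup>*\<^sup>* w w'" "w' \<in> carrier W" "\<And>y. y \<in> carrier W \<Longrightarrow> len (y \<otimes> w' \<otimes> inv (\<delta> y)) \<le> len w'"
    using ascend_to_maximal[OF w(1)] by blast
  have "v \<in> carrier W \<and> a v = a w \<and> len v = len w \<and> (w, v) \<in> twisted_conj_rel W \<delta>" if "up_step\<^sup>*\<^sup>* w v" for v
    using that
  proof (induction rule: rtranclp_induct)
    case base
    then show ?case using w equiv_twisted_conj by (auto simp: equiv_def refl_on_def)
  next
    case (step v u)
    then obtain s where s: "s \<in> S" "u = s \<otimes> v \<otimes> \<delta> s" "len v \<le> len u" by (auto simp: up_step_def)
    have v: "v \<in> carrier W" "a v = a w" "len v = len w" using step by auto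
    have u: "u \<in> carrier W" using step_carrier[OF v(1) s(1)] s(2) by simp
    have "len u = len v"
    proof (rule ccontr)
      assume "len u \<noteq> len v"
      then have "len v < len (s \<otimes> v \<otimes> \<delta> s)" using s by simp
      then have "a (s \<otimes> v) = a v \<and> len v < len (s \<otimes> v) \<or> a u = a v"
        using central_rise[OF a v(1) s(1)] s(2) by simp
      moreover have "a (s \<otimes> v) = 0" if "len v < len (s \<otimes> v)" using top[of "s \<otimes> v"] that v s S_carrier by simp
      moreover have "a u = 0" using top[OF u] \<open>len v < len (s \<otimes> v \<otimes> \<delta> s)\<close> s v by simp
      ultimately show False using v w by auto
    qed
    moreover have "a u = a v" using central_const_step[OF a v(1) s(1)] calculation s(2) by simp
    moreover have "(v, u) \<in> twisted_conj_rel W \<delta>"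
      using s v S_carrier by (auto simp: twisted_conj_rel_iff intro!: bexI[of _ s])
    then have "(w, u) \<in> twisted_conj_rel W \<delta>" using step equiv_twisted_conj by (meson equivE transD)
    ultimately show ?case using v u by simp
  qed
  from this[OF w'(1)] have len: "len w' = len w" and conj: "(w, w') \<in> twisted_conj_rel W \<delta>" by auto
  have "len (y \<otimes> w \<otimes> inv (\<delta> y)) \<le> len w" if y: "y \<in> carrier W" for y
  proof -
    have "(w', w) \<in> twisted_conj_rel W \<delta>" using conj equiv_twisted_conj by (meson equivE symD)
    then obtain x where x: "x \<in> carrier W" "w = x \<otimes> w' \<otimes> inv (\<delta> x)" by (auto simp: twisted_conj_rel_iff)
    have "y \<otimes> w \<otimes> inv (\<delta> y) = (y \<otimes> x) \<otimes> w' \<otimes> inv (\<delta> (y \<otimes> x))"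
      using x y w' by (simp add: m_assoc inv_mult_group)
    then show ?thesis using w'(3)[of "y \<otimes> x"] x y len by simp
  qed
  then show ?thesis using w by (simp add: twisted_max_iff)
qed

lemma central_const_class:
  assumes a: "central a" and \<Sigma>: "\<Sigma> \<in> max_classes" "w \<in> \<Sigma>" "v \<in> \<Sigma>" shows "a w = a v"
proof -
  have w: "w \<in> carrier W" using class_carrier \<Sigma> by blast
  have "twisted_arrow W S \<delta> w v" using class_arrow \<Sigma> by blast
  then have "v \<in> carrier W \<and> len v \<le> len w \<and> (len v = len w \<longrightarrow> a v = a w)"
    unfolding twisted_arrow_def
  proof (induction rule: rtranclp_induct)
    case (step v u)
    then obtain s where s: "s \<in> S" "u = s \<otimes> v \<otimes> \<delta> s" "len u \<le> len v" by (auto simp: twisted_step_def)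
    have v: "v \<in> carrier W" using step by simp
    have "a u = a v" if "len u = len v" using central_const_step[OF a v s(1)] that s(2) by simp
    then show ?case using step s step_carrier[OF v s(1)] by auto
  qed (use w in simp)
  then show ?thesis using class_len[OF \<Sigma>] by simp
qed

lemma lower_same_len:
  assumes "\<Sigma> \<in> max_classes" "w \<in> lower_set W S \<Sigma>" "v \<in> \<Sigma>" shows "w \<in> \<Sigma> \<or> len w < len v"
proof -
  obtain u where "u \<in> \<Sigma>" "w \<preceq> u" using assms(2) by (auto simp: lower_set_def)
  then show ?thesis using ble_len[of w u] class_len[OF assms(1,3)] by auto
qed

lemma class_in_lower: "\<Sigma> \<in> max_classes \<Longrightarrow> w \<in> \<Sigma> \<Longrightarrow> w \<in> lower_set W S \<Sigma>"
  using class_carrier lower_iff ble_refl by blast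

text \<open>
  Evaluate at an element of a class of greatest length among those with nonzero coefficient. It is below no other such class.
\<close>

lemma below_independent:
  assumes z: "\<And>w. w \<in> carrier W \<Longrightarrow> (\<Sum>\<Sigma>\<in>max_classes. c \<Sigma> * below \<Sigma> w) = 0"
  shows "\<forall>\<Sigma>\<in>max_classes. c \<Sigma> = 0"
proof (rule ccontr)
  define r where "r \<Sigma> = (SOME w. w \<in> \<Sigma>)" for \<Sigma> :: "'a set"
  have r: "r \<Sigma> \<in> \<Sigma>" if "\<Sigma> \<in> max_classes" for \<Sigma> unfolding r_def using class_nonempty[OF that] by (simp add: some_in_eq)
  let ?X = "{\<Sigma> \<in> max_classes. c \<Sigma> \<noteq> 0}"
  assume "\<not> (\<forall>\<Sigma>\<in>max_classes. c \<Sigma> = 0)"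
  then have ne: "?X \<noteq> {}" by blast
  have fin: "finite ?X" using finite_classes by simp
  define m where "m = Max ((\<lambda>\<Sigma>. len (r \<Sigma>)) ` ?X)"
  have "m \<in> (\<lambda>\<Sigma>. len (r \<Sigma>)) ` ?X" unfolding m_def using fin ne by (intro Max_in) auto
  then obtain \<Sigma> where \<Sigma>: "\<Sigma> \<in> max_classes" "c \<Sigma> \<noteq> 0" "len (r \<Sigma>) = m" by blast
  have max: "len (r \<Sigma>') \<le> m" if "\<Sigma>' \<in> ?X" for \<Sigma>'
    unfolding m_def using fin that by (intro Max_ge) auto
  have w: "r \<Sigma> \<in> carrier W" using class_carrier r \<Sigma> by blast
  have "c \<Sigma>' * below \<Sigma>' (r \<Sigma>) = (if \<Sigma>' = \<Sigma> then c \<Sigma> else 0)" if \<Sigma>': "\<Sigma>' \<in> max_classes" for \<Sigma>'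
  proof (cases "\<Sigma>' = \<Sigma>")
    case True
    then show ?thesis using class_in_lower[OF \<Sigma>(1) r[OF \<Sigma>(1)]] by (simp add: below_def)
  next
    case False
    have "c \<Sigma>' = 0" if "r \<Sigma> \<in> lower_set W S \<Sigma>'"
    proof (rule ccontr)
      assume "c \<Sigma>' \<noteq> 0"
      then have "len (r \<Sigma>') \<le> len (r \<Sigma>)" using max \<Sigma>' \<Sigma>(3) by simp
      then have "r \<Sigma> \<in> \<Sigma>'" using lower_same_len[OF \<Sigma>' that r[OF \<Sigma>']] by simp
      then show False using class_unique[OF \<Sigma>(1) \<Sigma>'] r[OF \<Sigma>(1)] False by blast
    qed
    then show ?thesis using False by (auto simp: below_def)
  qed
  then have "(\<Sum>\<Sigma>'\<in>max_classes. c \<Sigma>' * below \<Sigma>' (r \<Sigma>)) = (\<Sum>\<Sigma>'\<in>max_classes. if \<Sigma>' = \<Sigma> then c \<Sigma> else 0)" by simp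
  also have "\<dots> = c \<Sigma>" using finite_classes \<Sigma>(1) by simp
  finally show False using z[OF w] \<Sigma>(2) by simp
qed

text \<open>
  Let \<open>n\<close> be the greatest length in the support of \<open>a\<close>. A solution has a constant value \<open>a(\<Sigma>)\<close> on each class. Subtracting
  \<open>a(\<Sigma>)\<close> times the indicator of \<open>W\<^bsub>\<le>\<Sigma>\<^esub>\<close> for the classes
  \<open>\<Sigma>\<close> of length \<open>n\<close> leaves a solution whose support avoids those classes. Its elements of length \<open>n\<close>, were there any, would be
  longest in the support and hence in some class \<open>\<Sigma>\<close>.
\<close>

lemma below_span:
  assumes "central a" "\<And>w. w \<in> carrier W \<Longrightarrow> n \<le> len w \<Longrightarrow> a w = 0"
  shows "\<exists>c. \<forall>w\<in>carrier W. a w = (\<Sum>\<Sigma>\<in>max_classes. c \<Sigma> * below \<Sigma> w)"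
  using assms
proof (induction n arbitrary: a)
  case 0
  then show ?case by (intro exI[of _ "\<lambda>_. 0"]) simp
next
  case (Suc n)
  define r where "r \<Sigma> = (SOME w. w \<in> \<Sigma>)" for \<Sigma> :: "'a set"
  have r: "r \<Sigma> \<in> \<Sigma>" if "\<Sigma> \<in> max_classes" for \<Sigma> unfolding r_def using class_nonempty[OF that] by (simp add: some_in_eq)
  define c0 where "c0 \<Sigma> = (if len (r \<Sigma>) = n then a (r \<Sigma>) else 0)" for \<Sigma>
  define a' where "a' w = a w - (\<Sum>\<Sigma>\<in>max_classes. c0 \<Sigma> * below \<Sigma> w)" for w
  have a': "central a'" unfolding a'_def using Suc.prems(1) central_below by (rule central_diff_sum)
  have high: "a' w = 0" if w: "w \<in> carrier W" "n < len w" for w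
  proof -
    have "c0 \<Sigma> * below \<Sigma> w = 0" if "\<Sigma> \<in> max_classes" for \<Sigma>
      using lower_same_len[OF that _ r[OF that], of w] class_len[OF that _ r[OF that], of w] w by (auto simp: c0_def below_def)
    then show ?thesis using Suc.prems(2)[of w] w by (simp add: a'_def)
  qed
  have "a' w = 0" if w: "w \<in> carrier W" "n \<le> len w" for w
  proof (cases "n = len w")
    case True
    show ?thesis
    proof (rule ccontr)
      assume ne: "a' w \<noteq> 0"
      have "w \<in> twisted_max W S \<delta>" using central_top[OF a' w(1) ne] high True by simp
      then obtain \<Sigma> where \<Sigma>: "\<Sigma> \<in> max_classes" "w \<in> \<Sigma>" using class_of by blast
      have "c0 \<Sigma>' * below \<Sigma>' w = (if \<Sigma>' = \<Sigma> then a w else 0)" if \<Sigma>': "\<Sigma>' \<in> max_classes" for \<Sigma>'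
      proof (cases "\<Sigma>' = \<Sigma>")
        case eq: True
        have "len (r \<Sigma>) = n" "a (r \<Sigma>) = a w"
          using class_len[OF \<Sigma>(1) r[OF \<Sigma>(1)] \<Sigma>(2)] True central_const_class[OF Suc.prems(1) \<Sigma>(1) r[OF \<Sigma>(1)] \<Sigma>(2)] by auto
        then show ?thesis using eq class_in_lower[OF \<Sigma>] by (simp add: c0_def below_def)
      next
        case False
        then have "w \<notin> \<Sigma>'" using class_unique[OF \<Sigma>(1) \<Sigma>' \<Sigma>(2)] by blast
        then have "c0 \<Sigma>' = 0" if "w \<in> lower_set W S \<Sigma>'"
          using lower_same_len[OF \<Sigma>' that r[OF \<Sigma>']] True by (simp add: c0_def)
        then show ?thesis using False by (auto simp: below_def)
      qed
      then have "(\<Sum>\<Sigma>'\<in>max_classes. c0 \<Sigma>' * below \<Sigma>' w) = (\<Sum>\<Sigma>'\<in>max_classes. if \<Sigma>' = \<Sigma> then a w else 0)" by simp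
      also have "\<dots> = a w" using finite_classes \<Sigma>(1) by simp
      finally show False using ne by (simp add: a'_def)
    qed
  qed (use high w in simp)
  then obtain c where c: "\<forall>w\<in>carrier W. a' w = (\<Sum>\<Sigma>\<in>max_classes. c \<Sigma> * below \<Sigma> w)" using Suc.IH[OF a'] by blast
  have "a w = (\<Sum>\<Sigma>\<in>max_classes. (c0 \<Sigma> + c \<Sigma>) * below \<Sigma> w)" if "w \<in> carrier W" for w
  proof -
    have "a w = (\<Sum>\<Sigma>\<in>max_classes. c0 \<Sigma> * below \<Sigma> w) + a' w" by (simp add: a'_def)
    then show ?thesis using c that by (simp add: sum.distrib distrib_right)
  qed
  then show ?case by (intro exI[of _ "\<lambda>\<Sigma>. c0 \<Sigma> + c \<Sigma>"]) blast
qed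

end


section \<open>The twisted centre of the 0-Hecke algebra\<close>

locale twisted_hecke = twisted_coxeter W S \<delta> for W (structure) and S \<delta> +
  fixes H :: "(complex, 'h, 'n) module_scheme" and t :: "'a \<Rightarrow> 'h" and \<delta>\<^sub>H :: "'h \<Rightarrow> 'h"
  assumes hecke: "zero_hecke_algebra W S H t" and induced: "induced_automorphism W \<delta> H t \<delta>\<^sub>H"
begin

sublocale alg: ring H
  using hecke by (simp add: zero_hecke_algebra_def complex_algebra_def)

sublocale cvs: complex_vs H
  by (rule complex_vs.intro) (use hecke in \<open>simp add: zero_hecke_algebra_def complex_algebra_def\<close>)

lemma smult_mult:
  assumes "x \<in> carrier H" "y \<in> carrier H"
  shows "(c \<odot>\<^bsub>H\<^esub> x) \<otimes>\<^bsub>H\<^esub> y = c \<odot>\<^bsub>H\<^esub> (x \<otimes>\<^bsub>H\<^esub> y)" "x \<otimes>\<^bsub>H\<^esub> (c \<odot>\<^bsub>H\<^esub> y) = c \<odot>\<^bsub>H\<^esub> (x \<otimes>\<^bsub>H\<^esub> y)"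
  using hecke assms by (simp_all add: zero_hecke_algebra_def complex_algebra_def)

lemma basis_t: "basis_family H (carrier H) (carrier W) t"
  using hecke by (simp add: zero_hecke_algebra_def)

lemmas t_family = cvs.basis_familyD(1)[OF finite_W basis_t]

lemma t_carrier [simp]: "w \<in> carrier W \<Longrightarrow> t w \<in> carrier H"
  using t_family by auto

lemma t_mult: "x \<in> carrier W \<Longrightarrow> y \<in> carrier W \<Longrightarrow> len (x \<otimes> y) = len x + len y \<Longrightarrow> t x \<otimes>\<^bsub>H\<^esub> t y = t (x \<otimes> y)"
  using hecke by (simp add: zero_hecke_algebra_def)

lemma t_square: "s \<in> S \<Longrightarrow> t s \<otimes>\<^bsub>H\<^esub> t s = \<ominus>\<^bsub>H\<^esub> t s"
proof -
  assume s: "s \<in> S"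
  then have c: "t s \<in> carrier H" using S_carrier by simp
  have "(t s \<oplus>\<^bsub>H\<^esub> \<one>\<^bsub>H\<^esub>) \<otimes>\<^bsub>H\<^esub> t s = \<zero>\<^bsub>H\<^esub>" using hecke s by (simp add: zero_hecke_algebra_def)
  then have "t s \<otimes>\<^bsub>H\<^esub> t s \<oplus>\<^bsub>H\<^esub> t s = \<zero>\<^bsub>H\<^esub>" using c by (simp add: alg.l_distr)
  then show ?thesis using c alg.minus_equality by (metis alg.m_closed)
qed

lemma t_left: "s \<in> S \<Longrightarrow> w \<in> carrier W \<Longrightarrow> len w < len (s \<otimes> w) \<Longrightarrow> t s \<otimes>\<^bsub>H\<^esub> t w = t (s \<otimes> w)"
proof -
  assume s: "s \<in> S" and w: "w \<in> carrier W" and lt: "len w < len (s \<otimes> w)"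
  have "len (s \<otimes> w) = Suc (len w)" by (rule len_left_cases[OF w s]) (use lt in simp_all)
  then show ?thesis using s w by (intro t_mult) (simp_all add: S_carrier len_S)
qed

lemma t_right: "s \<in> S \<Longrightarrow> w \<in> carrier W \<Longrightarrow> len w < len (w \<otimes> s) \<Longrightarrow> t w \<otimes>\<^bsub>H\<^esub> t s = t (w \<otimes> s)"
proof -
  assume s: "s \<in> S" and w: "w \<in> carrier W" and lt: "len w < len (w \<otimes> s)"
  have "len (w \<otimes> s) = Suc (len w)" by (rule len_mult_S_cases[OF w s]) (use lt in simp_all)
  then show ?thesis using s w by (intro t_mult) (simp_all add: S_carrier len_S)
qed

lemma t_left_down: "s \<in> S \<Longrightarrow> w \<in> carrier W \<Longrightarrow> len (s \<otimes> w) < len w \<Longrightarrow> t s \<otimes>\<^bsub>H\<^esub> t w = \<ominus>\<^bsub>H\<^esub> t w"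
proof -
  assume s: "s \<in> S" and w: "w \<in> carrier W" and lt: "len (s \<otimes> w) < len w"
  have sw: "s \<otimes> w \<in> carrier W" "s \<otimes> (s \<otimes> w) = w" "s \<in> carrier W" using s w S_carrier by (auto simp: S_cancel)
  have tw: "t w = t s \<otimes>\<^bsub>H\<^esub> t (s \<otimes> w)" using t_left[OF s sw(1)] sw lt by simp
  have "t s \<otimes>\<^bsub>H\<^esub> t w = (t s \<otimes>\<^bsub>H\<^esub> t s) \<otimes>\<^bsub>H\<^esub> t (s \<otimes> w)" unfolding tw using sw by (simp add: alg.m_assoc)
  then show ?thesis using sw tw by (simp add: t_square[OF s] alg.l_minus)
qed

lemma t_right_down: "s \<in> S \<Longrightarrow> w \<in> carrier W \<Longrightarrow> len (w \<otimes> s) < len w \<Longrightarrow> t w \<otimes>\<^bsub>H\<^esub> t s = \<ominus>\<^bsub>H\<^esub> t w"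
proof -
  assume s: "s \<in> S" and w: "w \<in> carrier W" and lt: "len (w \<otimes> s) < len w"
  have sw: "w \<otimes> s \<in> carrier W" "w \<otimes> s \<otimes> s = w" "s \<in> carrier W" using s w S_carrier by (auto simp: S_cancel)
  have tw: "t w = t (w \<otimes> s) \<otimes>\<^bsub>H\<^esub> t s" using t_right[OF s sw(1)] sw lt by simp
  have "t w \<otimes>\<^bsub>H\<^esub> t s = t (w \<otimes> s) \<otimes>\<^bsub>H\<^esub> (t s \<otimes>\<^bsub>H\<^esub> t s)" unfolding tw using sw by (simp add: alg.m_assoc)
  then show ?thesis using sw tw by (simp add: t_square[OF s] alg.r_minus)
qed

abbreviation elem :: "('a \<Rightarrow> complex) \<Rightarrow> 'h" where "elem \<equiv> cvs.comb (carrier W) t"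

lemmas elem_closed = cvs.comb_closed[OF t_family]

lemma elem_exists: "h \<in> carrier H \<Longrightarrow> \<exists>a. h = elem a"
  using cvs.basis_familyD(3)[OF finite_W basis_t] .

lemma elem_zero: "elem a = \<zero>\<^bsub>H\<^esub> \<Longrightarrow> w \<in> carrier W \<Longrightarrow> a w = 0"
  using cvs.basis_familyD(2)[OF finite_W basis_t] .

lemma elem_inj: "elem a = elem c \<longleftrightarrow> (\<forall>w\<in>carrier W. a w = c w)"
proof
  assume eq: "elem a = elem c"
  have "elem (\<lambda>w. a w + - c w) = elem a \<oplus>\<^bsub>H\<^esub> \<ominus>\<^bsub>H\<^esub> elem c"
    using cvs.comb_add[OF t_family, of a "\<lambda>w. - c w"] cvs.comb_minus[OF t_family] by simp
  also have "\<dots> = \<zero>\<^bsub>H\<^esub>" using eq elem_closed by (simp add: alg.r_neg)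
  finally show "\<forall>w\<in>carrier W. a w = c w" using elem_zero[of "\<lambda>w. a w + - c w"] by auto
qed (rule cvs.comb_cong[OF t_family], simp)

text \<open>
  Common form of left and right multiplication by a generator: \<open>\<sigma>\<close> is multiplication by \<open>s\<close> on the group, and \<open>d\<close> says that
  \<open>\<sigma>\<close> decreases the length.
\<close>

lemma collect_coeffs:
  assumes \<sigma>: "bij_betw \<sigma> (carrier W) (carrier W)" "\<And>w. w \<in> carrier W \<Longrightarrow> \<sigma> (\<sigma> w) = w"
    and d: "\<And>w. w \<in> carrier W \<Longrightarrow> d (\<sigma> w) \<longleftrightarrow> \<not> d w"
    and x: "\<And>w. w \<in> carrier W \<Longrightarrow> x w = (if d w then \<ominus>\<^bsub>H\<^esub> t w else t (\<sigma> w))"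
  shows "(\<Oplus>\<^bsub>H\<^esub>w\<in>carrier W. a w \<odot>\<^bsub>H\<^esub> x w) = elem (\<lambda>u. if d u then a (\<sigma> u) - a u else 0)"
proof -
  have \<sigma>c: "\<sigma> w \<in> carrier W" if "w \<in> carrier W" for w using \<sigma>(1) that by (auto simp: bij_betw_def)
  define F where "F u = (if d u then a (\<sigma> u) else 0) \<odot>\<^bsub>H\<^esub> t u" for u
  define G where "G u = (if d u then - a u else 0) \<odot>\<^bsub>H\<^esub> t u" for u
  have FG: "F w \<in> carrier H" "G w \<in> carrier H" if "w \<in> carrier W" for w using that by (simp_all add: F_def G_def)
  have neg: "a w \<odot>\<^bsub>H\<^esub> \<ominus>\<^bsub>H\<^esub> t w = (- a w) \<odot>\<^bsub>H\<^esub> t w" if "w \<in> carrier W" for w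
    using that cvs.vs.smult_r_minus[of "a w" "t w"] cvs.vs.smult_l_minus[of "a w" "t w"] by (simp add: class_ring_simps)
  have "(\<Oplus>\<^bsub>H\<^esub>w\<in>carrier W. a w \<odot>\<^bsub>H\<^esub> x w) = (\<Oplus>\<^bsub>H\<^esub>w\<in>carrier W. F (\<sigma> w) \<oplus>\<^bsub>H\<^esub> G w)"
  proof (rule alg.finsum_cong'[OF HOL.refl])
    show "(\<lambda>w. F (\<sigma> w) \<oplus>\<^bsub>H\<^esub> G w) \<in> carrier W \<rightarrow> carrier H" using FG \<sigma>c by auto
    fix w assume w: "w \<in> carrier W"
    then show "a w \<odot>\<^bsub>H\<^esub> x w = F (\<sigma> w) \<oplus>\<^bsub>H\<^esub> G w" using \<sigma>c[OF w] by (simp add: x F_def G_def d \<sigma>(2) neg)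
  qed
  also have "\<dots> = (\<Oplus>\<^bsub>H\<^esub>w\<in>carrier W. F (\<sigma> w)) \<oplus>\<^bsub>H\<^esub> (\<Oplus>\<^bsub>H\<^esub>w\<in>carrier W. G w)"
    using FG \<sigma>c by (intro alg.finsum_addf) auto
  also have "(\<Oplus>\<^bsub>H\<^esub>w\<in>carrier W. F (\<sigma> w)) = (\<Oplus>\<^bsub>H\<^esub>w\<in>\<sigma> ` carrier W. F w)"
    using FG \<sigma>(1) \<sigma>c by (intro alg.add.finprod_reindex[symmetric]) (auto simp: bij_betw_def)
  also have "\<sigma> ` carrier W = carrier W" using \<sigma>(1) by (simp add: bij_betw_def)
  also have "(\<Oplus>\<^bsub>H\<^esub>w\<in>carrier W. F w) \<oplus>\<^bsub>H\<^esub> (\<Oplus>\<^bsub>H\<^esub>w\<in>carrier W. G w) =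
      elem (\<lambda>u. (if d u then a (\<sigma> u) else 0) + (if d u then - a u else 0))"
    unfolding F_def G_def cvs.comb_add[OF t_family] by (simp add: cvs.comb_def)
  also have "\<dots> = elem (\<lambda>u. if d u then a (\<sigma> u) - a u else 0)"
    by (rule cvs.comb_cong[OF t_family]) simp
  finally show ?thesis .
qed

lemma elem_left: "s \<in> S \<Longrightarrow> t s \<otimes>\<^bsub>H\<^esub> elem a = elem (coeff_left s a)"
proof -
  assume s: "s \<in> S"
  have sc: "s \<in> carrier W" using S_carrier s .
  have "t s \<otimes>\<^bsub>H\<^esub> elem a = (\<Oplus>\<^bsub>H\<^esub>w\<in>carrier W. t s \<otimes>\<^bsub>H\<^esub> (a w \<odot>\<^bsub>H\<^esub> t w))"
    unfolding cvs.comb_def using finite_W sc by (intro alg.finsum_rdistr) auto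
  also have "\<dots> = (\<Oplus>\<^bsub>H\<^esub>w\<in>carrier W. a w \<odot>\<^bsub>H\<^esub> (t s \<otimes>\<^bsub>H\<^esub> t w))"
    using sc by (intro alg.finsum_cong') (auto simp: smult_mult)
  also have "\<dots> = elem (\<lambda>u. if len (s \<otimes> u) < len u then a (s \<otimes> u) - a u else 0)"
  proof (rule collect_coeffs)
    show "bij_betw (\<lambda>w. s \<otimes> w) (carrier W) (carrier W)"
      using s sc by (intro bij_betwI[of _ _ _ "\<lambda>w. s \<otimes> w"]) (auto simp: S_cancel)
    show "s \<otimes> (s \<otimes> w) = w" if "w \<in> carrier W" for w using s that by (simp add: S_cancel)
    show "len (s \<otimes> (s \<otimes> w)) < len (s \<otimes> w) \<longleftrightarrow> \<not> len (s \<otimes> w) < len w" if w: "w \<in> carrier W" for w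
      using s w by (cases rule: len_left_cases[OF w s]) (simp_all add: S_cancel)
    show "t s \<otimes>\<^bsub>H\<^esub> t w = (if len (s \<otimes> w) < len w then \<ominus>\<^bsub>H\<^esub> t w else t (s \<otimes> w))" if w: "w \<in> carrier W" for w
      using t_left[OF s w] t_left_down[OF s w] by (cases rule: len_left_cases[OF w s]) simp_all
  qed
  finally show ?thesis by (simp add: coeff_left_def[abs_def])
qed

lemma elem_right: "s \<in> S \<Longrightarrow> elem a \<otimes>\<^bsub>H\<^esub> t s = elem (coeff_right a s)"
proof -
  assume s: "s \<in> S"
  have sc: "s \<in> carrier W" using S_carrier s .
  have "elem a \<otimes>\<^bsub>H\<^esub> t s = (\<Oplus>\<^bsub>H\<^esub>w\<in>carrier W. (a w \<odot>\<^bsub>H\<^esub> t w) \<otimes>\<^bsub>H\<^esub> t s)"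
    unfolding cvs.comb_def using finite_W sc by (intro alg.finsum_ldistr) auto
  also have "\<dots> = (\<Oplus>\<^bsub>H\<^esub>w\<in>carrier W. a w \<odot>\<^bsub>H\<^esub> (t w \<otimes>\<^bsub>H\<^esub> t s))"
    using sc by (intro alg.finsum_cong') (auto simp: smult_mult)
  also have "\<dots> = elem (\<lambda>u. if len (u \<otimes> s) < len u then a (u \<otimes> s) - a u else 0)"
  proof (rule collect_coeffs)
    show "bij_betw (\<lambda>w. w \<otimes> s) (carrier W) (carrier W)"
      using s sc by (intro bij_betwI[of _ _ _ "\<lambda>w. w \<otimes> s"]) (auto simp: S_cancel)
    show "w \<otimes> s \<otimes> s = w" if "w \<in> carrier W" for w using s that by (simp add: S_cancel)
    show "len (w \<otimes> s \<otimes> s) < len (w \<otimes> s) \<longleftrightarrow> \<not> len (w \<otimes> s) < len w" if w: "w \<in> carrier W" for w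
      using s w by (cases rule: len_mult_S_cases[OF w s]) (simp_all add: S_cancel)
    show "t w \<otimes>\<^bsub>H\<^esub> t s = (if len (w \<otimes> s) < len w then \<ominus>\<^bsub>H\<^esub> t w else t (w \<otimes> s))" if w: "w \<in> carrier W" for w
      using t_right[OF s w] t_right_down[OF s w] by (cases rule: len_mult_S_cases[OF w s]) simp_all
  qed
  finally show ?thesis by (simp add: coeff_right_def[abs_def])
qed

lemma t_one: "t \<one> = \<one>\<^bsub>H\<^esub>"
proof -
  obtain c where c: "\<one>\<^bsub>H\<^esub> = elem c" using elem_exists by blast
  have "t \<one> = t \<one> \<otimes>\<^bsub>H\<^esub> elem c" unfolding c[symmetric] by simp
  also have "\<dots> = (\<Oplus>\<^bsub>H\<^esub>w\<in>carrier W. t \<one> \<otimes>\<^bsub>H\<^esub> (c w \<odot>\<^bsub>H\<^esub> t w))"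
    unfolding cvs.comb_def using finite_W by (intro alg.finsum_rdistr) auto
  also have "\<dots> = elem c"
    unfolding cvs.comb_def by (intro alg.finsum_cong') (auto simp: smult_mult t_mult)
  finally show ?thesis using c by simp
qed

lemma delta_H:
  "h \<in> carrier H \<Longrightarrow> \<delta>\<^sub>H h \<in> carrier H"
  "h \<in> carrier H \<Longrightarrow> h' \<in> carrier H \<Longrightarrow> \<delta>\<^sub>H (h \<oplus>\<^bsub>H\<^esub> h') = \<delta>\<^sub>H h \<oplus>\<^bsub>H\<^esub> \<delta>\<^sub>H h'"
  "h \<in> carrier H \<Longrightarrow> h' \<in> carrier H \<Longrightarrow> \<delta>\<^sub>H (h \<otimes>\<^bsub>H\<^esub> h') = \<delta>\<^sub>H h \<otimes>\<^bsub>H\<^esub> \<delta>\<^sub>H h'"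
  "h \<in> carrier H \<Longrightarrow> \<delta>\<^sub>H (c \<odot>\<^bsub>H\<^esub> h) = c \<odot>\<^bsub>H\<^esub> \<delta>\<^sub>H h"
  "\<delta>\<^sub>H \<one>\<^bsub>H\<^esub> = \<one>\<^bsub>H\<^esub>"
  "w \<in> carrier W \<Longrightarrow> \<delta>\<^sub>H (t w) = t (\<delta> w)"
  using induced by (auto simp: induced_automorphism_def ring_iso_def Ring.ring_hom_def)

text \<open>
  The elements \<open>x\<close> with \<open>x h = h \<delta>(x)\<close> are closed under products and linear combinations, so it suffices to test the
  generators \<open>t\<^sub>s\<close>.
\<close>

theorem twisted_center_iff: "elem a \<in> twisted_center H \<delta>\<^sub>H \<longleftrightarrow> central a"
proof
  assume "elem a \<in> twisted_center H \<delta>\<^sub>H"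
  then have "t s \<otimes>\<^bsub>H\<^esub> elem a = elem a \<otimes>\<^bsub>H\<^esub> t (\<delta> s)" if "s \<in> S" for s
    using that S_carrier[OF that] delta_H(6) by (simp add: twisted_center_def)
  then have "elem (coeff_left s a) = elem (coeff_right a (\<delta> s))" if "s \<in> S" for s
    using that by (simp add: elem_left elem_right)
  then show "central a" unfolding central_def elem_inj by blast
next
  assume a: "central a"
  let ?h = "elem a"
  let ?Z = "{x \<in> carrier H. x \<otimes>\<^bsub>H\<^esub> ?h = ?h \<otimes>\<^bsub>H\<^esub> \<delta>\<^sub>H x}"
  have h: "?h \<in> carrier H" by (rule elem_closed)
  have gen: "t s \<in> ?Z" if s: "s \<in> S" for s
  proof -
    have "elem (coeff_left s a) = elem (coeff_right a (\<delta> s))" unfolding elem_inj using a s by (simp add: central_def)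
    then show ?thesis using s S_carrier[OF s] by (simp add: elem_left elem_right delta_H)
  qed
  have mult: "x \<otimes>\<^bsub>H\<^esub> y \<in> ?Z" if "x \<in> ?Z" "y \<in> ?Z" for x y
  proof -
    have x: "x \<in> carrier H" "y \<in> carrier H" "x \<otimes>\<^bsub>H\<^esub> ?h = ?h \<otimes>\<^bsub>H\<^esub> \<delta>\<^sub>H x" "y \<otimes>\<^bsub>H\<^esub> ?h = ?h \<otimes>\<^bsub>H\<^esub> \<delta>\<^sub>H y" using that by auto
    have "x \<otimes>\<^bsub>H\<^esub> y \<otimes>\<^bsub>H\<^esub> ?h = x \<otimes>\<^bsub>H\<^esub> (?h \<otimes>\<^bsub>H\<^esub> \<delta>\<^sub>H y)" using x h by (simp add: alg.m_assoc)
    also have "\<dots> = (x \<otimes>\<^bsub>H\<^esub> ?h) \<otimes>\<^bsub>H\<^esub> \<delta>\<^sub>H y" 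
      by (rule alg.m_assoc[symmetric]) (use x h delta_H(1) in auto)
    also have "\<dots> = ?h \<otimes>\<^bsub>H\<^esub> \<delta>\<^sub>H (x \<otimes>\<^bsub>H\<^esub> y)" using x h delta_H(1) by (simp add: delta_H(3) alg.m_assoc)
    finally show ?thesis using x by simp
  qed
  have tZ: "t w \<in> ?Z" if "w \<in> carrier W" for w
    using that
  proof (induction "len w" arbitrary: w rule: less_induct)
    case less
    show ?case
    proof (cases "w = \<one>")
      case True
      then show ?thesis using h by (simp add: t_one delta_H)
    next
      case False
      then obtain s where s: "s \<in> S" "len w = Suc (len (w \<otimes> s))" using descent_exists[OF less.prems] by blast
      have c: "w \<otimes> s \<in> carrier W" using less.prems S_carrier[OF s(1)] by simp
      have "t (w \<otimes> s) \<otimes>\<^bsub>H\<^esub> t s = t w"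
        using t_right[OF s(1) c] s less.prems by (simp add: S_cancel)
      then show ?thesis using mult[OF less.hyps[OF _ c] gen[OF s(1)]] s(2) by simp
    qed
  qed
  have add: "x \<oplus>\<^bsub>H\<^esub> y \<in> ?Z" if "x \<in> ?Z" "y \<in> ?Z" for x y
    using that h delta_H(1) by (simp add: alg.l_distr alg.r_distr delta_H(2))
  have smult: "c \<odot>\<^bsub>H\<^esub> x \<in> ?Z" if "x \<in> ?Z" for c x
    using that h delta_H(1) by (simp add: smult_mult delta_H(4))
  have zero: "\<zero>\<^bsub>H\<^esub> \<in> ?Z" using smult[OF tZ[OF one_closed], of 0] by simp
  have "elem c \<in> ?Z" for c
  proof -
    have "(\<Oplus>\<^bsub>H\<^esub>w\<in>F. c w \<odot>\<^bsub>H\<^esub> t w) \<in> ?Z" if "finite F" "F \<subseteq> carrier W" for F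
      using that
    proof (induction F rule: finite_induct)
      case (insert w F)
      have w: "w \<in> carrier W" "F \<subseteq> carrier W" using insert.prems by auto
      have "(\<lambda>w. c w \<odot>\<^bsub>H\<^esub> t w) \<in> F \<rightarrow> carrier H" using w by auto
      then have "(\<Oplus>\<^bsub>H\<^esub>w\<in>insert w F. c w \<odot>\<^bsub>H\<^esub> t w) = c w \<odot>\<^bsub>H\<^esub> t w \<oplus>\<^bsub>H\<^esub> (\<Oplus>\<^bsub>H\<^esub>w\<in>F. c w \<odot>\<^bsub>H\<^esub> t w)"
        using w by (intro alg.finsum_insert insert.hyps) simp_all
      then show ?case using add[OF smult[OF tZ[OF w(1)]] insert.IH[OF w(2)]] by (simp only:)
    qed (use zero in simp)
    then show ?thesis unfolding cvs.comb_def using finite_W by blast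
  qed
  then have "x \<otimes>\<^bsub>H\<^esub> ?h = ?h \<otimes>\<^bsub>H\<^esub> \<delta>\<^sub>H x" if "x \<in> carrier H" for x
    using elem_exists[OF that] by blast
  then show "elem a \<in> twisted_center H \<delta>\<^sub>H" using h by (simp add: twisted_center_def)
qed

lemma t_lower_elem: "t_lower W S H t \<Sigma> = elem (below \<Sigma>)"
proof -
  have "lower_set W S \<Sigma> \<subseteq> carrier W" by (auto simp: lower_set_def)
  from cvs.comb_subset[OF t_family finite_W this]
  show ?thesis by (simp add: t_lower_def below_def[abs_def])
qed

lemma comb_t_lower:
  "cvs.comb max_classes (t_lower W S H t) c = elem (\<lambda>w. \<Sum>\<Sigma>\<in>max_classes. c \<Sigma> * below \<Sigma> w)"
proof -
  have "(\<Oplus>\<^bsub>H\<^esub>\<Sigma>\<in>F. c \<Sigma> \<odot>\<^bsub>H\<^esub> elem (below \<Sigma>)) = elem (\<lambda>w. \<Sum>\<Sigma>\<in>F. c \<Sigma> * below \<Sigma> w)" if "finite F" for F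
    using that
  proof (induction F rule: finite_induct)
    case empty
    then show ?case using cvs.comb_zero[OF t_family] by simp
  next
    case (insert \<Sigma> F)
    then have "(\<Oplus>\<^bsub>H\<^esub>\<Sigma>\<in>insert \<Sigma> F. c \<Sigma> \<odot>\<^bsub>H\<^esub> elem (below \<Sigma>)) =
        c \<Sigma> \<odot>\<^bsub>H\<^esub> elem (below \<Sigma>) \<oplus>\<^bsub>H\<^esub> (\<Oplus>\<^bsub>H\<^esub>\<Sigma>\<in>F. c \<Sigma> \<odot>\<^bsub>H\<^esub> elem (below \<Sigma>))"
      using elem_closed by (intro alg.finsum_insert) auto
    also have "\<dots> = elem (\<lambda>w. c \<Sigma> * below \<Sigma> w + (\<Sum>\<Sigma>\<in>F. c \<Sigma> * below \<Sigma> w))"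
      using insert.IH cvs.comb_smult[OF t_family finite_W] cvs.comb_add[OF t_family] by simp
    finally show ?case using insert.hyps by simp
  qed
  then show ?thesis unfolding cvs.comb_def[of max_classes] t_lower_elem using finite_classes by blast
qed

theorem twisted_center_basis:
  "basis_family H (twisted_center H \<delta>\<^sub>H) max_classes (t_lower W S H t)"
proof (rule cvs.basis_familyI[OF finite_classes])
  show "twisted_center H \<delta>\<^sub>H \<subseteq> carrier H" by (auto simp: twisted_center_def)
  show "t_lower W S H t \<in> max_classes \<rightarrow> twisted_center H \<delta>\<^sub>H"
    using central_below by (auto simp: t_lower_elem twisted_center_iff)
  show "inj_on (t_lower W S H t) max_classes"
  proof (rule inj_onI)
    fix \<Sigma> \<Sigma>' assume \<Sigma>: "\<Sigma> \<in> max_classes" "\<Sigma>' \<in> max_classes" "t_lower W S H t \<Sigma> = t_lower W S H t \<Sigma>'"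
    have low: "w \<in> lower_set W S \<Sigma> \<longleftrightarrow> w \<in> lower_set W S \<Sigma>'" if "w \<in> carrier W" for w
      using \<Sigma>(3) that unfolding t_lower_elem elem_inj below_def by (metis zero_neq_one)
    obtain v v' where v: "v \<in> \<Sigma>" "v' \<in> \<Sigma>'" using class_nonempty \<Sigma> by blast
    have "v \<in> lower_set W S \<Sigma>'" "v' \<in> lower_set W S \<Sigma>"
      using low[of v] low[of v'] class_in_lower[OF \<Sigma>(1) v(1)] class_in_lower[OF \<Sigma>(2) v(2)]
        class_carrier[OF \<Sigma>(1) v(1)] class_carrier[OF \<Sigma>(2) v(2)] by blast+
    then have "v \<in> \<Sigma>' \<or> v' \<in> \<Sigma>"
      using lower_same_len[OF \<Sigma>(2) _ v(2)] lower_same_len[OF \<Sigma>(1) _ v(1)] by (meson less_asym)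
    then show "\<Sigma> = \<Sigma>'" using class_unique[OF \<Sigma>(1,2)] v by blast
  qed
  show "\<forall>\<Sigma>\<in>max_classes. c \<Sigma> = 0" if z: "cvs.comb max_classes (t_lower W S H t) c = \<zero>\<^bsub>H\<^esub>" for c
    using elem_zero z unfolding comb_t_lower by (intro below_independent) blast
  show "\<exists>c. u = cvs.comb max_classes (t_lower W S H t) c" if u: "u \<in> twisted_center H \<delta>\<^sub>H" for u
  proof -
    have "u \<in> carrier H" using u by (simp add: twisted_center_def)
    then obtain a where a: "u = elem a" using elem_exists by blast
    have "central a" using u unfolding a twisted_center_iff .
    moreover have "a w = 0" if "w \<in> carrier W" "Suc (Max (len ` carrier W)) \<le> len w" for w

    proof -
      have "len w \<le> Max (len ` carrier W)" using finite_W that(1) by (intro Max_ge) auto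
      then show ?thesis using that(2) by linarith
    qed
    ultimately obtain c where "\<forall>w\<in>carrier W. a w = (\<Sum>\<Sigma>\<in>max_classes. c \<Sigma> * below \<Sigma> w)"
      using below_span[of a "Suc (Max (len ` carrier W))"] by blast
    then show ?thesis unfolding comb_t_lower a elem_inj by blast
  qed
  show "cvs.comb max_classes (t_lower W S H t) c \<in> twisted_center H \<delta>\<^sub>H" for c
  proof -
    have "central (\<lambda>w. (0::complex))" by (simp add: central_def coeff_left_def coeff_right_def)
    then have "central (\<lambda>w. 0 - (\<Sum>\<Sigma>\<in>max_classes. (- c \<Sigma>) * below \<Sigma> w))"
      using central_below by (rule central_diff_sum)
    then show ?thesis unfolding comb_t_lower twisted_center_iff by (simp add: sum_negf)
  qed
qed

end

theorem theorem4p4: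
  fixes W :: "('a, 'm) monoid_scheme" and S :: "'a set" and \<delta> :: "'a \<Rightarrow> 'a"
    and H\<^sub>0 :: "(complex, 'h, 'n) module_scheme" and t :: "'a \<Rightarrow> 'h" and \<delta>\<^sub>H :: "'h \<Rightarrow> 'h"
  assumes "coxeter_system W S" and "finite (carrier W)"
    and "\<delta> \<in> iso W W" and "\<delta> ` S = S"
    and "zero_hecke_algebra W S H\<^sub>0 t"
    and "induced_automorphism W \<delta> H\<^sub>0 t \<delta>\<^sub>H"
  shows "basis_family H\<^sub>0 (twisted_center H\<^sub>0 \<delta>\<^sub>H) (twisted_max_classes W S \<delta>) (t_lower W S H\<^sub>0 t)"
proof -
  have "group W" using assms(1) by (simp add: coxeter_system_def)
  then interpret twisted_hecke W S \<delta> H\<^sub>0 t \<delta>\<^sub>H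
    using assms by (intro twisted_hecke.intro twisted_coxeter.intro coxeter.intro coxeter_axioms.intro
        twisted_coxeter_axioms.intro twisted_hecke_axioms.intro)
  show ?thesis by (rule twisted_center_basis)
qed

end
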